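(* There exists a polynomial time rounding algorithm that, given a feasible solution $(x^*,y^* )$ to $\operatorname{SC-LP}(T,k)$ and any $\varepsilon\in(0,1)$, outputs an integral $(2+\varepsilon,\,O(1/\varepsilon^2))$-approximate solution to $\operatorname{SC-LP}(T,k)$ (the constant in $O(\cdot)$ being absolute).
   Context: Let $F$ (facilities) and $C$ (clients) be finite sets, $(F\cup C,d)$ a finite metric space, $T>0$ and $k>0$. The polytope $\operatorname{SC-LP}(T,k)$ consists of vectors $(x,y)$, $x=(x_{ij})_{i\in F,j\in C}$, $y=(y_i)_{i\in F}$, satisfying: $\sum_{j\in C}d(i,j)x_{ij}\le T y_i$ for all $i\in F$; $\sum_{i\in F}y_i\le k$; $\sum_{i\in F}x_{ij}=1$ for all $j\in C$; $x_{ij}\le y_i$ for all $i,j$; $y_i\in[0,1]$, $x_{ij}\in[0,1]$ for all $i,j$; and $x_{ij}=0$ whenever $d(i,j)>T$. For an assignment $x$ and $i\in F$, the fractional load is $L(i,x):=\sum_{j\in C}d(i,j)x_{ij}$. A solution $(x,y)$ (with $x_{ij},y_i\in[0,1]$, $\sum_{i}x_{ij}=1$ for all $j$, and $x_{ij}\le y_i$, but not necessarily satisfying the load and cardinality constraints) is called $(\alpha,\beta)$-approximate if $L(i,x)\le\alpha T y_i$ for every $i\in F$ and $\sum_{i\in F}y_i\le\beta k$. It is integral if all $x_{ij},y_i\in\{0,1\}$. *)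

theory Defs
  imports
    "HOL-Analysis.Analysis"
    "HOL-Library.Log_Nat"
    "HOL-Computational_Algebra.Polynomial"
begin

definition load :: "'a set \<Rightarrow> ('a \<Rightarrow> 'a \<Rightarrow> real) \<Rightarrow> ('a \<Rightarrow> 'a \<Rightarrow> real) \<Rightarrow> 'a \<Rightarrow> real" where
  "load C d x i = (\<Sum>j\<in>C. d i j * x i j)"

text \<open>
  Vectors indexed by \<open>F \<times> C\<close> and by \<open>F\<close> are total functions whose values outside of the
  index set are never inspected.
\<close>

definition fractional_assignment ::
    "'a set \<Rightarrow> 'a set \<Rightarrow> ('a \<Rightarrow> 'a \<Rightarrow> real) \<Rightarrow> ('a \<Rightarrow> real) \<Rightarrow> bool" where
  "fractional_assignment F C x y \<longleftrightarrow>
     (\<forall>j\<in>C. (\<Sum>i\<in>F. x i j) = 1) \<and>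
     (\<forall>i\<in>F. \<forall>j\<in>C. x i j \<le> y i) \<and>
     (\<forall>i\<in>F. y i \<in> {0..1}) \<and>
     (\<forall>i\<in>F. \<forall>j\<in>C. x i j \<in> {0..1})"

definition SC_LP ::
    "'a set \<Rightarrow> 'a set \<Rightarrow> ('a \<Rightarrow> 'a \<Rightarrow> real) \<Rightarrow> real \<Rightarrow> real \<Rightarrow> (('a \<Rightarrow> 'a \<Rightarrow> real) \<times> ('a \<Rightarrow> real)) set" where
  "SC_LP F C d T k = {(x, y).
     fractional_assignment F C x y \<and>
     (\<forall>i\<in>F. load C d x i \<le> T * y i) \<and>
     (\<Sum>i\<in>F. y i) \<le> k \<and>
     (\<forall>i\<in>F. \<forall>j\<in>C. d i j > T \<longrightarrow> x i j = 0)}"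

definition approximate_solution ::
    "'a set \<Rightarrow> 'a set \<Rightarrow> ('a \<Rightarrow> 'a \<Rightarrow> real) \<Rightarrow> real \<Rightarrow> real \<Rightarrow> real \<Rightarrow> real
       \<Rightarrow> ('a \<Rightarrow> 'a \<Rightarrow> real) \<Rightarrow> ('a \<Rightarrow> real) \<Rightarrow> bool" where
  "approximate_solution F C d T k \<alpha> \<beta> x y \<longleftrightarrow>
     fractional_assignment F C x y \<and>
     (\<forall>i\<in>F. load C d x i \<le> \<alpha> * T * y i) \<and>
     (\<Sum>i\<in>F. y i) \<le> \<beta> * k"

definition integral_solution ::
    "'a set \<Rightarrow> 'a set \<Rightarrow> ('a \<Rightarrow> 'a \<Rightarrow> real) \<Rightarrow> ('a \<Rightarrow> real) \<Rightarrow> bool" where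
  "integral_solution F C x y \<longleftrightarrow>
     (\<forall>i\<in>F. y i \<in> {0, 1}) \<and> (\<forall>i\<in>F. \<forall>j\<in>C. x i j \<in> {0, 1})"

text \<open>
  Algorithms are while programs over binary trees with integer leaves.  Running time is
  bit cost: every evaluation of an expression is charged the sizes, in bits, of the values of
  all its subexpressions.  Each primitive is computable by a Turing machine in time polynomial
  in the sizes of its arguments and its result, and a program cannot create data larger than
  the time it has been charged, so that up to a polynomial this cost is Turing machine time.
\<close>

datatype val = VInt int | VPair val val

fun vsize :: "val \<Rightarrow> nat" where
  "vsize (VInt n) = 1 + nat (bitlen \<bar>n\<bar>)"
| "vsize (VPair u v) = 1 + vsize u + vsize v"

datatype expr =
    Lit int | Var nat
  | Cons expr expr | Fst expr | Snd expr | IsPair expr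
  | Add expr expr | Sub expr expr | Mul expr expr | Quot expr expr
  | Less expr expr | Equal expr expr

datatype com =
    Skip
  | Assign nat expr
  | Seq com com
  | Cond expr com com
  | While expr com

type_synonym store = "nat \<Rightarrow> val"

text \<open>All primitives are total: arithmetic reads a pair as \<open>0\<close>, projections of a leaf are \<open>0\<close>.\<close>

fun int_of_val :: "val \<Rightarrow> int" where
  "int_of_val (VInt n) = n"
| "int_of_val (VPair u v) = 0"

fun vfst :: "val \<Rightarrow> val" where
  "vfst (VInt n) = VInt 0"
| "vfst (VPair u v) = u"

fun vsnd :: "val \<Rightarrow> val" where
  "vsnd (VInt n) = VInt 0"
| "vsnd (VPair u v) = v"

fun is_VPair :: "val \<Rightarrow> bool" where
  "is_VPair (VInt n) = False"
| "is_VPair (VPair u v) = True"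

fun eval_expr :: "expr \<Rightarrow> store \<Rightarrow> val" where
  "eval_expr (Lit n) s = VInt n"
| "eval_expr (Var r) s = s r"
| "eval_expr (Cons a b) s = VPair (eval_expr a s) (eval_expr b s)"
| "eval_expr (Fst a) s = vfst (eval_expr a s)"
| "eval_expr (Snd a) s = vsnd (eval_expr a s)"
| "eval_expr (IsPair a) s = VInt (of_bool (is_VPair (eval_expr a s)))"
| "eval_expr (Add a b) s = VInt (int_of_val (eval_expr a s) + int_of_val (eval_expr b s))"
| "eval_expr (Sub a b) s = VInt (int_of_val (eval_expr a s) - int_of_val (eval_expr b s))"
| "eval_expr (Mul a b) s = VInt (int_of_val (eval_expr a s) * int_of_val (eval_expr b s))"
| "eval_expr (Quot a b) s = VInt (int_of_val (eval_expr a s) div int_of_val (eval_expr b s))"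
| "eval_expr (Less a b) s = VInt (of_bool (int_of_val (eval_expr a s) < int_of_val (eval_expr b s)))"
| "eval_expr (Equal a b) s = VInt (of_bool (eval_expr a s = eval_expr b s))"

fun subexprs :: "expr \<Rightarrow> expr list" where
  "subexprs (Lit n) = []"
| "subexprs (Var r) = []"
| "subexprs (Cons a b) = [a, b]"
| "subexprs (Fst a) = [a]"
| "subexprs (Snd a) = [a]"
| "subexprs (IsPair a) = [a]"
| "subexprs (Add a b) = [a, b]"
| "subexprs (Sub a b) = [a, b]"
| "subexprs (Mul a b) = [a, b]"
| "subexprs (Quot a b) = [a, b]"
| "subexprs (Less a b) = [a, b]"
| "subexprs (Equal a b) = [a, b]"

lemma size_subexprs [termination_simp]: "a \<in> set (subexprs e) \<Longrightarrow> size a < size e"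
  by (cases e) auto

fun cost_expr :: "expr \<Rightarrow> store \<Rightarrow> nat" where
  "cost_expr e s = vsize (eval_expr e s) + (\<Sum>a\<leftarrow>subexprs e. cost_expr a s)"

declare cost_expr.simps [simp del]

abbreviation holds :: "expr \<Rightarrow> store \<Rightarrow> bool" where
  "holds e s \<equiv> int_of_val (eval_expr e s) \<noteq> 0"

text \<open>\<open>exec c s t s'\<close>: started in \<open>s\<close>, program \<open>c\<close> halts in \<open>s'\<close> at total cost \<open>t\<close>.\<close>

inductive exec :: "com \<Rightarrow> store \<Rightarrow> nat \<Rightarrow> store \<Rightarrow> bool" where
  Skip: "exec Skip s 1 s"
| Assign: "exec (Assign r e) s (1 + cost_expr e s) (s(r := eval_expr e s))"
| Seq: "exec c1 s t1 s' \<Longrightarrow> exec c2 s' t2 s'' \<Longrightarrow> exec (Seq c1 c2) s (1 + t1 + t2) s''"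
| CondTrue: "holds e s \<Longrightarrow> exec c1 s t s' \<Longrightarrow> exec (Cond e c1 c2) s (1 + cost_expr e s + t) s'"
| CondFalse: "\<not> holds e s \<Longrightarrow> exec c2 s t s' \<Longrightarrow> exec (Cond e c1 c2) s (1 + cost_expr e s + t) s'"
| WhileFalse: "\<not> holds e s \<Longrightarrow> exec (While e c) s (1 + cost_expr e s) s"
| WhileTrue: "holds e s \<Longrightarrow> exec c s t1 s' \<Longrightarrow> exec (While e c) s' t2 s'' \<Longrightarrow>
    exec (While e c) s (1 + cost_expr e s + t1 + t2) s''"

inductive_cases SkipE: "exec Skip s t s'"
inductive_cases AssignE: "exec (Assign r e) s t s'"
inductive_cases SeqE: "exec (Seq c1 c2) s t s'"
inductive_cases CondE: "exec (Cond e c1 c2) s t s'"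
inductive_cases WhileE: "exec (While e c) s t s'"

lemma exec_deterministic:
  "exec c s t s' \<Longrightarrow> exec c s u s'' \<Longrightarrow> u = t \<and> s'' = s'"
proof (induction arbitrary: u s'' rule: exec.induct)
  case (Skip s)
  then show ?case by (auto elim: SkipE)
next
  case (Assign r e s)
  then show ?case by (auto elim: AssignE)
next
  case (Seq c1 s t1 s' c2 t2 s1)
  from Seq.prems show ?case by (rule SeqE) (use Seq.IH in fastforce)
next
  case (CondTrue e s c1 t s' c2)
  from CondTrue.prems show ?case by (rule CondE) (use CondTrue.IH CondTrue.hyps(1) in fastforce)+
next
  case (CondFalse e s c2 t s' c1)
  from CondFalse.prems show ?case by (rule CondE) (use CondFalse.IH CondFalse.hyps(1) in fastforce)+
next
  case (WhileFalse e s c)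
  from WhileFalse.prems show ?case by (rule WhileE) (use WhileFalse.hyps(1) in fastforce)+
next
  case (WhileTrue e s c t1 s' t2 s1)
  from WhileTrue.prems show ?case by (rule WhileE) (use WhileTrue.IH WhileTrue.hyps(1) in fastforce)+
qed

text \<open>Register \<open>0\<close> holds the input initially and the output finally.\<close>

definition computes_within :: "com \<Rightarrow> val \<Rightarrow> val \<Rightarrow> nat \<Rightarrow> bool" where
  "computes_within P inp out b \<longleftrightarrow>
     (\<exists>t s. exec P ((\<lambda>_. VInt 0)(0 := inp)) t s \<and> s 0 = out \<and> t \<le> b)"

text \<open>
  Rationals are encoded in lowest terms; \<open>enc_rat\<close> is used on real numbers in \<open>\<rat>\<close> only.
  A function on a finite set of points is encoded by its table of key-value pairs.
\<close>

definition enc_rat :: "real \<Rightarrow> val" where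
  "enc_rat r = (case quotient_of (THE q. of_rat q = r) of (a, b) \<Rightarrow> VPair (VInt a) (VInt b))"

definition enc_list :: "val list \<Rightarrow> val" where
  "enc_list vs = foldr VPair vs (VInt 0)"

definition enc_set :: "nat set \<Rightarrow> val" where
  "enc_set A = enc_list (map (\<lambda>a. VInt (int a)) (sorted_list_of_set A))"

definition enc_table :: "nat set \<Rightarrow> (nat \<Rightarrow> val) \<Rightarrow> val" where
  "enc_table A f = enc_list (map (\<lambda>a. VPair (VInt (int a)) (f a)) (sorted_list_of_set A))"

definition enc_solution :: "nat set \<Rightarrow> nat set \<Rightarrow> (nat \<Rightarrow> nat \<Rightarrow> real) \<Rightarrow> (nat \<Rightarrow> real) \<Rightarrow> val" where
  "enc_solution F C x y =
     VPair (enc_table F (\<lambda>i. enc_table C (\<lambda>j. enc_rat (x i j))))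
           (enc_table F (\<lambda>i. enc_rat (y i)))"

definition enc_input ::
    "nat set \<Rightarrow> nat set \<Rightarrow> (nat \<Rightarrow> nat \<Rightarrow> real) \<Rightarrow> real \<Rightarrow> real
       \<Rightarrow> (nat \<Rightarrow> nat \<Rightarrow> real) \<Rightarrow> (nat \<Rightarrow> real) \<Rightarrow> real \<Rightarrow> val" where
  "enc_input F C d T k x y \<epsilon> = enc_list
     [enc_set F, enc_set C,
      enc_table (F \<union> C) (\<lambda>p. enc_table (F \<union> C) (\<lambda>q. enc_rat (d p q))),
      enc_rat T, enc_rat k, enc_solution F C x y, enc_rat \<epsilon>]"

definition rational_input ::
    "nat set \<Rightarrow> nat set \<Rightarrow> (nat \<Rightarrow> nat \<Rightarrow> real) \<Rightarrow> real \<Rightarrow> real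
       \<Rightarrow> (nat \<Rightarrow> nat \<Rightarrow> real) \<Rightarrow> (nat \<Rightarrow> real) \<Rightarrow> real \<Rightarrow> bool" where
  "rational_input F C d T k x y \<epsilon> \<longleftrightarrow>
     (\<forall>p\<in>F \<union> C. \<forall>q\<in>F \<union> C. d p q \<in> \<rat>) \<and> T \<in> \<rat> \<and> k \<in> \<rat> \<and>
     (\<forall>i\<in>F. \<forall>j\<in>C. x i j \<in> \<rat>) \<and> (\<forall>i\<in>F. y i \<in> \<rat>) \<and> \<epsilon> \<in> \<rat>"

end

theory Submission
  imports Defs
begin

text \<open>
  Call a facility large if \<open>y i \<ge> \<epsilon> / 16\<close>; there are \<open>O(k / \<epsilon>)\<close> of them and all may be opened.  A client with
  all but an \<open>\<epsilon> / 2\<close> fraction of its assignment on large facilities is served by these after rescaling, which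
  increases loads by a factor \<open>1 + \<epsilon>\<close> only.  Any other client is served by small facilities after rescaling by
  \<open>4 / \<epsilon>\<close>; as small facilities carry load at most \<open>\<epsilon> T / 16\<close>, this leaves them room.

  The radius of a small facility is the smallest one whose ball has mass \<open>\<epsilon> / 4\<close> of small facilities; up to a
  constant factor it is bounded by the distance to a client plus the average connection cost of that client.
  So if a constant part of the assignment of a client is at distance plus four radii more than \<open>T\<close>, the
  client pays for a facility of its own.  The remaining facilities are clustered by the usual greedy choice of
  disjoint balls, and every cluster is thinned out by merging facilities into others of smaller
  radius as long as the moved load stays below \<open>T / 2\<close>.  The outcome is a fractional assignment with
  loads at most \<open>(1 + \<epsilon>) T\<close> in which \<open>O(k / \<epsilon>)\<close> facilities can be used, and the Shmoys-Tardos slot rounding makes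
  it integral at the price of one more distance, at most \<open>T\<close>, per facility.  The bipartite matching is found by an
  auction, whose labels stay below the number of clients by Hall's condition.

  For the running time, functions between encodable types that are computed by programs of polynomial cost are
  shown to be closed under list comprehensions, sums and size-bounded folds.  All quantities of the algorithm are
  recomputed whenever they are needed, so that only the greedy clustering and the auction carry a state.
\<close>

section \<open>Bit sizes and costs\<close>

text \<open>A client not served by large facilities has more than \<epsilon>/2 of its assignment on
  small ones, so \<epsilon>/4 of it is far or more than \<epsilon>/4 is near: rescaling by
  4/\<epsilon> is enough in both cases. A small facility then carries at most 4/\<epsilon> times
  \<epsilon> T/16, that is T/4, of its own, which together with T/2 of moved load stays below T. The
  ball mass \<epsilon>/4 is half of \<epsilon>/2, so at least half of such a client's small
  assignment avoids the open ball around any small facility; averaging over that half bounds the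
  radius. Four radii come from moving via the cluster center, two radii per hop. Distance plus four
  radii, averaged over a client's small assignment, is at most 13 times its connection cost, 13 T k
  in total. This pays for 52 k/\<epsilon> far clients and 104 k/\<epsilon> groups; with 4
  k/\<epsilon> centers and 16 k/\<epsilon> large facilities the constant is 176. Running times are
  claimed for every value of the input type, feasible or not. Hence all functions are total with
  default values, and their size bounds must not rest on the LP constraints.\<close>

lemma poly_nat_mono: "a \<le> b \<Longrightarrow> poly (p :: nat poly) a \<le> poly p b"
  by (induction p) (auto simp: mult_le_mono add_le_mono)

lemma vsize_pos: "0 < vsize v"
  by (cases v) auto

lemma nat_bitlen_le_iff: "nat (bitlen x) \<le> k \<longleftrightarrow> x < 2 ^ k"
  using bitlen_le_iff_power[of x "int k"] bitlen_nonneg[of x] by auto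

lemma less_two_power_bitlen: "x < 2 ^ nat (bitlen x)"
  using nat_bitlen_le_iff[of x "nat (bitlen x)"] by simp

lemma nat_bitlen_mono: "x \<le> y \<Longrightarrow> nat (bitlen x) \<le> nat (bitlen y)"
  using less_two_power_bitlen[of y] by (simp add: nat_bitlen_le_iff)

lemma vsize_VInt_mono: "\<bar>m\<bar> \<le> \<bar>n\<bar> \<Longrightarrow> vsize (VInt m) \<le> vsize (VInt n)"
  by (simp add: nat_bitlen_mono)

lemma vsize_VInt_le: "vsize (VInt n) \<le> 1 + nat \<bar>n\<bar>"
proof -
  have "\<bar>n\<bar> < 2 ^ nat \<bar>n\<bar>"
    by (metis abs_ge_zero nat_0_le of_nat_less_two_power)
  thus ?thesis by (simp add: nat_bitlen_le_iff)
qed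

text \<open>A bound by the sum of sizes, though crude for addition, has the same form as the one for
  products, so that folding either operation over a list stays linear in the size of the
  list.\<close>

lemma vsize_VInt_add: "vsize (VInt (m + n)) \<le> vsize (VInt m) + vsize (VInt n)"
proof -
  let ?a = "nat (bitlen \<bar>m\<bar>)" and ?b = "nat (bitlen \<bar>n\<bar>)"
  have "\<bar>m + n\<bar> < 2 ^ ?a + 2 ^ ?b"
    using less_two_power_bitlen[of "\<bar>m\<bar>"] less_two_power_bitlen[of "\<bar>n\<bar>"] by linarith
  also have "\<dots> \<le> 2 ^ (?a + ?b) + 2 ^ (?a + ?b)"
    by (intro add_mono power_increasing) auto
  also have "\<dots> = 2 ^ Suc (?a + ?b)" by simp
  finally have "nat (bitlen \<bar>m + n\<bar>) \<le> Suc (?a + ?b)"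
    by (simp only: nat_bitlen_le_iff)
  thus ?thesis by simp
qed

lemma vsize_VInt_mult: "vsize (VInt (m * n)) \<le> vsize (VInt m) + vsize (VInt n)"
proof -
  let ?a = "nat (bitlen \<bar>m\<bar>)" and ?b = "nat (bitlen \<bar>n\<bar>)"
  have "\<bar>m * n\<bar> < 2 ^ ?a * 2 ^ ?b"
    unfolding abs_mult
    by (rule mult_strict_mono') (simp_all add: less_two_power_bitlen)
  hence "nat (bitlen \<bar>m * n\<bar>) \<le> ?a + ?b"
    by (simp only: nat_bitlen_le_iff power_add)
  thus ?thesis by simp
qed

lemma vsize_VInt_diff: "vsize (VInt (m - n)) \<le> vsize (VInt m) + vsize (VInt n)"
  using vsize_VInt_add[of m "- n"] by simp

text \<open>Quotients are rounded down, so the delicate case is a negative dividend over a positive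
  divisor: the quotient is negative, and it is least for divisor 1. A negative divisor is reduced to
  a positive one by negating both arguments.\<close>

lemma abs_div_le: "\<bar>m div n\<bar> \<le> \<bar>m :: int\<bar>"
proof (cases "n = 0")
  case False
  have *: "\<bar>m div n\<bar> \<le> \<bar>m\<bar>" if "n > 0" for m n :: int
  proof (cases "m \<ge> 0")
    case True
    thus ?thesis using that by (metis abs_of_nonneg div_by_1 pos_imp_zdiv_nonneg_iff zdiv_mono2 zless_imp_add1_zle zero_less_one add_0)
  next
    case False
    have "m \<le> m div n"
      using that False zdiv_mono2_neg[of m 1 n] by simp
    moreover have "m div n < 0" using False that by (simp add: pos_imp_zdiv_neg_iff)
    ultimately show ?thesis by linarith
  qed
  show ?thesis
  proof (cases "n > 0")
    case True thus ?thesis by (rule *)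
  next
    case False
    hence "\<bar>(- m) div (- n)\<bar> \<le> \<bar>- m\<bar>" using \<open>n \<noteq> 0\<close> by (intro *) auto
    thus ?thesis by simp
  qed
qed simp

lemma vsize_VInt_div: "vsize (VInt (m div n)) \<le> vsize (VInt m)"
  by (intro vsize_VInt_mono abs_div_le)

lemma cost_expr_simps:
  "cost_expr (Lit n) s = vsize (VInt n)"
  "cost_expr (Var r) s = vsize (s r)"
  "cost_expr (Cons a b) s = vsize (eval_expr (Cons a b) s) + (cost_expr a s + cost_expr b s)"
  "cost_expr (Fst a) s = vsize (eval_expr (Fst a) s) + cost_expr a s"
  "cost_expr (Snd a) s = vsize (eval_expr (Snd a) s) + cost_expr a s"
  "cost_expr (IsPair a) s = vsize (eval_expr (IsPair a) s) + cost_expr a s"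
  "cost_expr (Equal a b) s = vsize (eval_expr (Equal a b) s) + (cost_expr a s + cost_expr b s)"
  by (simp_all add: cost_expr.simps[of "Lit n"] cost_expr.simps[of "Var r"] cost_expr.simps[of "Cons a b"]
    cost_expr.simps[of "Fst a"] cost_expr.simps[of "Snd a"] cost_expr.simps[of "IsPair a"]
    cost_expr.simps[of "Equal a b"])

section \<open>Encodable types\<close>

text \<open>No injectivity is asked for, since programs are only required to map the code of an
  argument to the code of the value. \<open>False\<close>, \<open>0\<close> and \<open>[]\<close>
  share a code, and so do a pair and a list cell; some operations below are therefore the identity
  on codes.\<close>

class encodable =
  fixes enc :: "'a \<Rightarrow> val"

instantiation int :: encodable
begin
definition enc_int :: "int \<Rightarrow> val" where "enc_int n = VInt n"
instance ..
end

instantiation bool :: encodable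
begin
definition enc_bool :: "bool \<Rightarrow> val" where "enc_bool b = VInt (of_bool b)"
instance ..
end

instantiation prod :: (encodable, encodable) encodable
begin
definition enc_prod :: "'a \<times> 'b \<Rightarrow> val" where "enc_prod p = VPair (enc (fst p)) (enc (snd p))"
instance ..
end

instantiation list :: (encodable) encodable
begin
definition enc_list_inst: "enc xs = enc_list (map enc xs)"
instance ..
end

lemma enc_Nil: "enc [] = VInt 0"
  by (simp add: enc_list_inst enc_list_def)

lemma enc_Cons: "enc (x # xs) = VPair (enc x) (enc xs)"
  by (simp add: enc_list_inst enc_list_def)

abbreviation esize :: "'a::encodable \<Rightarrow> nat" where "esize x \<equiv> vsize (enc x)"

lemma esize_Nil: "esize ([] :: 'a::encodable list) = 1"
  by (simp add: enc_Nil)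

lemma esize_Cons: "esize (x # xs) = Suc (esize x + esize xs)"
  by (simp add: enc_Cons)

lemma esize_Pair: "esize (x, y) = Suc (esize x + esize y)"
  by (simp add: enc_prod_def)

lemma esize_append: "esize (xs @ ys) + 1 = esize xs + esize ys"
  by (induction xs) (auto simp: esize_Nil esize_Cons)

lemma esize_rev: "esize (rev xs) = esize xs"
proof (induction xs)
  case (Cons x xs)
  thus ?case using esize_append[of "rev xs" "[x]"] by (simp add: esize_Nil esize_Cons)
qed simp

lemma length_le_esize: "length xs \<le> esize xs"
  by (induction xs) (auto simp: esize_Nil esize_Cons)

lemma esize_mem: "x \<in> set xs \<Longrightarrow> esize x \<le> esize xs"
  by (induction xs) (auto simp: esize_Cons)

lemma esize_list_le:
  assumes "length xs \<le> n" "\<And>x. x \<in> set xs \<Longrightarrow> esize x \<le> b"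
  shows "esize xs \<le> 1 + n * Suc b"
proof -
  have "esize xs \<le> 1 + length xs * Suc b"
    using assms(2)
  proof (induction xs)
    case (Cons x xs)
    have "esize xs \<le> 1 + length xs * Suc b" using Cons by simp
    moreover have "esize x \<le> b" using Cons.prems by simp
    ultimately show ?case by (simp add: esize_Cons)
  qed (simp add: esize_Nil)
  also have "\<dots> \<le> 1 + n * Suc b" using assms(1) by (intro add_left_mono mult_le_mono1)
  finally show ?thesis .
qed

section \<open>Polynomial-time functions\<close>

text \<open>The program must work in every store holding the argument in register 0, whatever lies
  elsewhere, and must leave all registers from some \<open>N\<close> on untouched. This makes
  programs composable: a caller keeps its own data above \<open>N\<close>, and a loop body may be
  run again on dirty scratch registers.\<close>

definition polytime :: "('a::encodable \<Rightarrow> 'b::encodable) \<Rightarrow> bool" where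
  "polytime f \<longleftrightarrow> (\<exists>P N p. \<forall>v s. s 0 = enc v \<longrightarrow>
     (\<exists>t s'. exec P s t s' \<and> s' 0 = enc (f v) \<and> t \<le> poly p (esize v) \<and> (\<forall>r\<ge>N. s' r = s r)))"

text \<open>The bound \<open>N\<close> is raised above 0 so that data saved from register
  \<open>N\<close> on never collides with the argument and result register.\<close>

lemma polytimeE:
  assumes "polytime f"
  obtains P N p where "\<And>v s. s 0 = enc v \<Longrightarrow>
    \<exists>t s'. exec P s t s' \<and> s' 0 = enc (f v) \<and> t \<le> poly p (esize v) \<and> (\<forall>r\<ge>N. s' r = s r)"
    "N > (0::nat)"
proof -
  obtain P N p where *: "\<And>v s. s 0 = enc v \<Longrightarrow>
    \<exists>t s'. exec P s t s' \<and> s' 0 = enc (f v) \<and> t \<le> poly p (esize v) \<and> (\<forall>r\<ge>N. s' r = s r)"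
    using assms unfolding polytime_def by blast
  show ?thesis
    by (rule that[of P p "Suc N"]) (use * in \<open>meson Suc_leD\<close>, simp)
qed

lemma polytimeI:
  assumes "\<And>v s. s 0 = enc v \<Longrightarrow>
    \<exists>t s'. exec P s t s' \<and> s' 0 = enc (f v) \<and> t \<le> poly p (esize v) \<and> (\<forall>r\<ge>N. s' r = s r)"
  shows "polytime f"
  unfolding polytime_def using assms by blast

text \<open>An assignment is charged the size of the value it stores, so a register that has grown
  has been paid for by the running time.\<close>

lemma exec_size:
  assumes "exec P s t s'" shows "vsize (s' r) \<le> max (vsize (s r)) t"
  using assms
proof (induction arbitrary: r rule: exec.induct)
  case (Assign q e s)
  show ?case by (auto simp: cost_expr.simps[of e])
next
  case (Seq c1 s t1 s' c2 t2 s'')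
  from Seq.IH(1)[of r] Seq.IH(2)[of r] show ?case by linarith
next
  case (CondTrue e s c1 t s' c2)
  from CondTrue.IH[of r] show ?case by linarith
next
  case (CondFalse e s c1 t s' c2)
  from CondFalse.IH[of r] show ?case by linarith
next
  case (WhileTrue e s c t1 s' t2 s'')
  from WhileTrue.IH(1)[of r] WhileTrue.IH(2)[of r] show ?case by linarith
qed auto

section \<open>Polynomially bounded quantities\<close>

definition poly_bounded :: "('a::encodable \<Rightarrow> nat) \<Rightarrow> bool" where
  "poly_bounded b \<longleftrightarrow> (\<exists>p :: nat poly. \<forall>x. b x \<le> poly p (esize x))"

lemma poly_boundedI: "(\<And>x. b x \<le> poly p (esize x)) \<Longrightarrow> poly_bounded b"
  by (auto simp: poly_bounded_def)

lemma poly_bounded_mono: "poly_bounded c \<Longrightarrow> (\<And>x. b x \<le> c x) \<Longrightarrow> poly_bounded b"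
  unfolding poly_bounded_def by (meson order_trans)

lemma poly_bounded_const: "poly_bounded (\<lambda>_. c)"
  by (rule poly_boundedI[where p = "[:c:]"]) simp

lemma poly_bounded_add: "poly_bounded b \<Longrightarrow> poly_bounded c \<Longrightarrow> poly_bounded (\<lambda>x. b x + c x)"
  unfolding poly_bounded_def by (metis add_mono poly_add)

lemma poly_bounded_mult: "poly_bounded b \<Longrightarrow> poly_bounded c \<Longrightarrow> poly_bounded (\<lambda>x. b x * c x)"
  unfolding poly_bounded_def by (metis mult_le_mono poly_mult)

lemma poly_bounded_Suc: "poly_bounded b \<Longrightarrow> poly_bounded (\<lambda>x. Suc (b x))"
  using poly_bounded_add[OF _ poly_bounded_const[of 1], of b] by simp

lemma poly_bounded_esize_id: "poly_bounded (\<lambda>x. esize x)"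
  by (rule poly_boundedI[where p = "[:0, 1:]"]) simp

lemma poly_bounded_poly: "poly_bounded b \<Longrightarrow> poly_bounded (\<lambda>x. poly p (b x))"
  unfolding poly_bounded_def
proof (elim exE)
  fix q assume "\<forall>x. b x \<le> poly q (esize x)"
  hence "\<forall>x. poly p (b x) \<le> poly (pcompose p q) (esize x)"
    by (simp add: poly_pcompose poly_nat_mono)
  thus "\<exists>p'. \<forall>x. poly p (b x) \<le> poly p' (esize x)" ..
qed

text \<open>The output is either no larger than the input or was charged for, by
  \<open>exec_size\<close>. This is what makes composition polynomial: the second program runs on a
  value of polynomial size.\<close>

lemma polytime_bounded:
  fixes f :: "'a::encodable \<Rightarrow> 'b::encodable"
  assumes "polytime f" shows "poly_bounded (\<lambda>x. esize (f x))"
proof -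
  obtain P N p where *: "\<And>v s. s 0 = enc v \<Longrightarrow>
    \<exists>t s'. exec P s t s' \<and> s' 0 = enc (f v) \<and> t \<le> poly p (esize v) \<and> (\<forall>r\<ge>N. s' r = s r)"
    by (rule polytimeE[OF assms]) (rule that; assumption)
  have "esize (f x) \<le> esize x + poly p (esize x)" for x
  proof -
    obtain t s' where "exec P (\<lambda>_. enc x) t s'" "s' 0 = enc (f x)" "t \<le> poly p (esize x)"
      using *[of "\<lambda>_. enc x" x] by blast
    thus ?thesis using exec_size[of P "\<lambda>_. enc x" t s' 0] by simp
  qed
  thus ?thesis
    by (rule poly_bounded_mono[OF poly_bounded_add[OF poly_bounded_esize_id
        poly_bounded_poly[OF poly_bounded_esize_id]]])
qed

lemma polytimeI':
  assumes "poly_bounded b"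
    "\<And>v s. s 0 = enc v \<Longrightarrow>
    \<exists>t s'. exec P s t s' \<and> s' 0 = enc (f v) \<and> t \<le> b v \<and> (\<forall>r\<ge>N. s' r = s r)"
  shows "polytime f"
proof -
  obtain p where p: "\<And>x. b x \<le> poly p (esize x)"
    using assms(1) unfolding poly_bounded_def by blast
  show ?thesis by (rule polytimeI[where P = P and p = p and N = N]) (use assms(2) p order_trans in meson)
qed

lemma polytimeE':
  assumes "polytime f"
  obtains P N b where "poly_bounded b" "\<And>v s. s 0 = enc v \<Longrightarrow>
    \<exists>t s'. exec P s t s' \<and> s' 0 = enc (f v) \<and> t \<le> b v \<and> (\<forall>r\<ge>N. s' r = s r)"
    "N > (0::nat)"
proof -
  obtain P N p where *: "\<And>v s. s 0 = enc v \<Longrightarrow>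
    \<exists>t s'. exec P s t s' \<and> s' 0 = enc (f v) \<and> t \<le> poly p (esize v) \<and> (\<forall>r\<ge>N. s' r = s r)" "N > 0"
    by (rule polytimeE[OF assms]) (rule that; assumption)
  show ?thesis
    by (rule that[OF poly_bounded_poly[OF poly_bounded_esize_id] *])
qed

lemma poly_bounded_comp:
  assumes "poly_bounded b" "polytime f" shows "poly_bounded (\<lambda>x. b (f x))"
proof -
  obtain p where p: "\<And>x. b x \<le> poly p (esize x)"
    using assms(1) unfolding poly_bounded_def by blast
  show ?thesis
    by (rule poly_bounded_mono[OF poly_bounded_poly[OF polytime_bounded[OF assms(2)]]]) (rule p)
qed

section \<open>Closure of polynomial time under program constructs\<close>

lemma polytime_expr:
  fixes f :: "'a::encodable \<Rightarrow> 'b::encodable" and b :: "'a \<Rightarrow> nat"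
  assumes "\<And>v s. s 0 = enc v \<Longrightarrow> eval_expr e s = enc (f v)"
    and "\<And>(v :: 'a) s. s 0 = enc v \<Longrightarrow> cost_expr e s \<le> b v" "poly_bounded b"
  shows "polytime f"
proof (rule polytimeI'[where P = "Assign 0 e" and N = 1 and b = "\<lambda>v. 1 + b v"])
  show "poly_bounded (\<lambda>v. 1 + b v)"
    by (intro poly_bounded_add poly_bounded_const assms)
  fix v :: 'a and s :: store assume *: "s 0 = enc v"
  show "\<exists>t s'. exec (Assign 0 e) s t s' \<and> s' 0 = enc (f v) \<and> t \<le> 1 + b v \<and> (\<forall>r\<ge>1. s' r = s r)"
    using exec.Assign[of 0 e s] assms(1)[of s v, OF *] assms(2)[of s v, OF *] by fastforce
qed

lemma polytime_linear_expr:
  fixes f :: "'a::encodable \<Rightarrow> 'b::encodable"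
  assumes "\<And>v s. s 0 = enc v \<Longrightarrow> eval_expr e s = enc (f v)"
    and "\<And>(v :: 'a) s. s 0 = enc v \<Longrightarrow> cost_expr e s \<le> c + k * esize v"
  shows "polytime f"
  by (rule polytime_expr[where b = "\<lambda>v. c + k * esize v"])
    (use assms in \<open>auto intro!: poly_bounded_add poly_bounded_mult poly_bounded_const poly_bounded_esize_id\<close>)

lemma polytime_id: "polytime (\<lambda>x. x)"
  by (rule polytime_linear_expr[where e = "Var 0" and c = 0 and k = 1]) (auto simp: cost_expr_simps)

lemma polytime_comp:
  fixes f :: "'b::encodable \<Rightarrow> 'c::encodable" and g :: "'a::encodable \<Rightarrow> 'b"
  assumes "polytime f" "polytime g" shows "polytime (\<lambda>x. f (g x))"
proof -
  obtain P N b where f: "poly_bounded b" "\<And>v s. s 0 = enc v \<Longrightarrow>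
    \<exists>t s'. exec P s t s' \<and> s' 0 = enc (f v) \<and> t \<le> b v \<and> (\<forall>r\<ge>N. s' r = s r)" "N > 0"
    by (rule polytimeE'[OF assms(1)]) (rule that; assumption)
  obtain Q M c where g: "poly_bounded c" "\<And>v s. s 0 = enc v \<Longrightarrow>
    \<exists>t s'. exec Q s t s' \<and> s' 0 = enc (g v) \<and> t \<le> c v \<and> (\<forall>r\<ge>M. s' r = s r)" "M > 0"
    by (rule polytimeE'[OF assms(2)]) (rule that; assumption)
  show ?thesis
  proof (rule polytimeI'[where P = "Seq Q P" and N = "max N M" and b = "\<lambda>v. 1 + c v + b (g v)"])
    show "poly_bounded (\<lambda>v. 1 + c v + b (g v))"
      by (intro poly_bounded_add poly_bounded_const f g poly_bounded_comp[OF f(1) assms(2)])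
    fix v :: 'a and s :: store assume "s 0 = enc v"
    from g(2)[of s v, OF this] obtain t1 s1 where 1: "exec Q s t1 s1" "s1 0 = enc (g v)" "t1 \<le> c v" "\<forall>r\<ge>M. s1 r = s r"
      by blast
    from f(2)[of s1 "g v", OF 1(2)] obtain t2 s2 where 2: "exec P s1 t2 s2" "s2 0 = enc (f (g v))" "t2 \<le> b (g v)" "\<forall>r\<ge>N. s2 r = s1 r"
      by blast
    show "\<exists>t s'. exec (Seq Q P) s t s' \<and> s' 0 = enc (f (g v)) \<and> t \<le> 1 + c v + b (g v) \<and> (\<forall>r\<ge>max N M. s' r = s r)"
      by (intro exI[of _ "1 + t1 + t2"] exI[of _ s2] conjI exec.Seq[OF 1(1) 2(1)])
        (use 1 2 in auto)
  qed
qed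

text \<open>Register \<open>L\<close> lies above the scratch registers of both programs. It keeps
  the argument during the first run, and its successor keeps the first result during the second
  run.\<close>

lemma polytime_Pair:
  fixes f :: "'a::encodable \<Rightarrow> 'b::encodable" and g :: "'a \<Rightarrow> 'c::encodable"
  assumes "polytime f" "polytime g" shows "polytime (\<lambda>x. (f x, g x))"
proof -
  obtain P N b where f: "poly_bounded b" "\<And>v s. s 0 = enc v \<Longrightarrow>
    \<exists>t s'. exec P s t s' \<and> s' 0 = enc (f v) \<and> t \<le> b v \<and> (\<forall>r\<ge>N. s' r = s r)" "N > 0"
    by (rule polytimeE'[OF assms(1)]) (rule that; assumption)
  obtain Q M c where g: "poly_bounded c" "\<And>v s. s 0 = enc v \<Longrightarrow>
    \<exists>t s'. exec Q s t s' \<and> s' 0 = enc (g v) \<and> t \<le> c v \<and> (\<forall>r\<ge>M. s' r = s r)" "M > 0"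
    by (rule polytimeE'[OF assms(2)]) (rule that; assumption)
  define L where "L = max N M"
  have L: "L > 0" "L \<ge> N" "L \<ge> M" using f(3) by (auto simp: L_def)
  let ?R = "Seq (Assign L (Var 0)) (Seq P (Seq (Assign (Suc L) (Var 0)) (Seq (Assign 0 (Var L))
    (Seq Q (Assign 0 (Cons (Var (Suc L)) (Var 0)))))))"
  let ?B = "\<lambda>v. 20 + b v + c v + 10 * esize v + 10 * esize (f v) + 10 * esize (g v)"
  show ?thesis
  proof (rule polytimeI'[where P = ?R and N = "Suc (Suc L)" and b = ?B])
    show "poly_bounded ?B"
      by (intro poly_bounded_add poly_bounded_const poly_bounded_mult f g poly_bounded_esize_id
           polytime_bounded assms)
    fix v :: 'a and s :: store assume s: "s 0 = enc v"
    let ?s1 = "s(L := enc v)"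
    have "?s1 0 = enc v" using s L by simp
    from f(2)[of ?s1 v, OF this] obtain t2 s2 where 2: "exec P ?s1 t2 s2" "s2 0 = enc (f v)" "t2 \<le> b v" "\<forall>r\<ge>N. s2 r = ?s1 r"
      by blast
    let ?s3 = "s2(Suc L := enc (f v))"
    let ?s4 = "?s3(0 := enc v)"
    have "?s4 0 = enc v" by simp
    from g(2)[of ?s4 v, OF this] obtain t5 s5 where 5: "exec Q ?s4 t5 s5" "s5 0 = enc (g v)" "t5 \<le> c v" "\<forall>r\<ge>M. s5 r = ?s4 r"
      by blast
    let ?s6 = "s5(0 := enc (f v, g v))"
    have e1: "exec (Assign L (Var 0)) s (1 + esize v) ?s1"
      using exec.Assign[of L "Var 0" s] s by (simp add: cost_expr_simps)
    have e3: "exec (Assign (Suc L) (Var 0)) s2 (1 + esize (f v)) ?s3"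
      using exec.Assign[of "Suc L" "Var 0" s2] 2 by (simp add: cost_expr_simps)
    have "?s3 L = enc v" using 2(4) L by simp
    hence e4: "exec (Assign 0 (Var L)) ?s3 (1 + esize v) ?s4"
      using exec.Assign[of 0 "Var L" ?s3] by (simp add: cost_expr_simps)
    have "s5 (Suc L) = enc (f v)" using 5(4) L by simp
    hence e6: "exec (Assign 0 (Cons (Var (Suc L)) (Var 0))) s5 (1 + (1 + 2 * esize (f v) + 2 * esize (g v))) ?s6"
      using exec.Assign[of 0 "Cons (Var (Suc L)) (Var 0)" s5] 5(2)
      by (simp add: cost_expr_simps enc_prod_def mult_2 add_ac)
    note e = exec.Seq[OF e1 exec.Seq[OF 2(1) exec.Seq[OF e3 exec.Seq[OF e4 exec.Seq[OF 5(1) e6]]]]]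
    have "\<forall>r\<ge>Suc (Suc L). ?s6 r = s r"
      using 5(4) 2(4) L by simp
    note frame = this
    show "\<exists>t s'. exec ?R s t s' \<and> s' 0 = enc (f v, g v) \<and> t \<le> ?B v \<and> (\<forall>r\<ge>Suc (Suc L). s' r = s r)"
      by (intro exI[of _ ?s6] exI conjI, rule e) (use 2(3) 5(3) frame in simp_all)
  qed
qed

lemma polytime_fst: assumes "polytime f" shows "polytime (\<lambda>x. fst (f x))"
proof (rule polytime_comp[OF _ assms])
  show "polytime fst"
    by (rule polytime_linear_expr[where e = "Fst (Var 0)" and c = 0 and k = 2])
      (auto simp: cost_expr_simps enc_prod_def)
qed

lemma polytime_snd: assumes "polytime f" shows "polytime (\<lambda>x. snd (f x))"
proof (rule polytime_comp[OF _ assms])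
  show "polytime snd"
    by (rule polytime_linear_expr[where e = "Snd (Var 0)" and c = 0 and k = 2])
      (auto simp: cost_expr_simps enc_prod_def)
qed

lemma polytime_lit: "polytime (\<lambda>_. n :: int)"
  by (rule polytime_linear_expr[where e = "Lit n" and c = "vsize (VInt n)" and k = 0])
    (auto simp: cost_expr_simps enc_int_def)

lemma polytime_True: "polytime (\<lambda>_. True)"
  by (rule polytime_linear_expr[where e = "Lit 1" and c = 2 and k = 0])
    (auto simp: cost_expr_simps enc_bool_def bitlen_alt_def)

lemma polytime_False: "polytime (\<lambda>_. False)"
  by (rule polytime_linear_expr[where e = "Lit 0" and c = 2 and k = 0])
    (auto simp: cost_expr_simps enc_bool_def)

lemma polytime_Nil: "polytime (\<lambda>_. [] :: 'b::encodable list)"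
  by (rule polytime_linear_expr[where e = "Lit 0" and c = 2 and k = 0])
    (auto simp: cost_expr_simps enc_Nil)

lemma polytime_Cons:
  fixes f :: "'a::encodable \<Rightarrow> 'b::encodable"
  assumes "polytime f" "polytime g" shows "polytime (\<lambda>x. f x # g x)"
proof -
  \<comment> \<open>A pair and the list cell built from it have the same code, so the program does
    nothing.\<close>
  have "polytime (\<lambda>p :: 'b \<times> 'b list. fst p # snd p)"
    by (rule polytime_linear_expr[where e = "Var 0" and c = 0 and k = 1])
      (auto simp: cost_expr_simps enc_prod_def enc_Cons)
  from polytime_comp[OF this polytime_Pair[OF assms]] show ?thesis by simp
qed

lemma polytime_binop:
  fixes f g :: "'a::encodable \<Rightarrow> int" and h :: "int \<Rightarrow> int \<Rightarrow> 'c::encodable"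
  assumes "polytime f" "polytime g"
    and eval: "\<And>a b s. eval_expr (op a b) s = enc (h (int_of_val (eval_expr a s)) (int_of_val (eval_expr b s)))"
    and sub: "\<And>a b. subexprs (op a b) = [a, b]"
    and size: "\<And>m n. esize (h m n) \<le> vsize (VInt m) + vsize (VInt n)"
  shows "polytime (\<lambda>x. h (f x) (g x))"
proof -
  have "polytime (\<lambda>p. h (fst p) (snd p))"
  proof (rule polytime_linear_expr[where e = "op (Fst (Var 0)) (Snd (Var 0))" and c = 0 and k = 10])
    fix v :: "int \<times> int" and s :: store assume "s 0 = enc v"
    thus "eval_expr (op (Fst (Var 0)) (Snd (Var 0))) s = enc (h (fst v) (snd v))"
      "cost_expr (op (Fst (Var 0)) (Snd (Var 0))) s \<le> 0 + 10 * esize v"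
      using size[of "fst v" "snd v"]
      by (auto simp: eval cost_expr.simps[of "op _ _"] sub cost_expr_simps enc_prod_def enc_int_def)
  qed
  from polytime_comp[OF this polytime_Pair[OF assms(1,2)]] show ?thesis by simp
qed

lemma polytime_add: "polytime f \<Longrightarrow> polytime g \<Longrightarrow> polytime (\<lambda>x. f x + g x :: int)"
  by (rule polytime_binop[where op = Add]) (use vsize_VInt_add in \<open>auto simp: enc_int_def simp del: vsize.simps\<close>)

lemma polytime_diff: "polytime f \<Longrightarrow> polytime g \<Longrightarrow> polytime (\<lambda>x. f x - g x :: int)"
  by (rule polytime_binop[where op = Sub]) (use vsize_VInt_diff in \<open>auto simp: enc_int_def simp del: vsize.simps\<close>)

lemma polytime_mult: "polytime f \<Longrightarrow> polytime g \<Longrightarrow> polytime (\<lambda>x. f x * g x :: int)"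
  by (rule polytime_binop[where op = Mul]) (use vsize_VInt_mult in \<open>auto simp: enc_int_def simp del: vsize.simps\<close>)

lemma polytime_div: "polytime f \<Longrightarrow> polytime g \<Longrightarrow> polytime (\<lambda>x. f x div g x :: int)"
  by (rule polytime_binop[where op = Quot])
    (use vsize_VInt_div in \<open>auto simp: enc_int_def trans_le_add1 simp del: vsize.simps\<close>)

lemma polytime_less: "polytime f \<Longrightarrow> polytime g \<Longrightarrow> polytime (\<lambda>x. (f x :: int) < g x)"
  by (rule polytime_binop[where op = Less])
    (auto simp: enc_bool_def bitlen_alt_def)

lemma polytime_if:
  fixes f :: "'a::encodable \<Rightarrow> 'b::encodable"
  assumes "polytime c" "polytime f" "polytime g"
  shows "polytime (\<lambda>x. if c x then f x else g x)"
proof -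
  obtain P N b where f: "poly_bounded b" "\<And>v s. s 0 = enc v \<Longrightarrow>
    \<exists>t s'. exec P s t s' \<and> s' 0 = enc (f v) \<and> t \<le> b v \<and> (\<forall>r\<ge>N. s' r = s r)" "N > 0"
    by (rule polytimeE'[OF assms(2)]) (rule that; assumption)
  obtain Q M d where g: "poly_bounded d" "\<And>v s. s 0 = enc v \<Longrightarrow>
    \<exists>t s'. exec Q s t s' \<and> s' 0 = enc (g v) \<and> t \<le> d v \<and> (\<forall>r\<ge>M. s' r = s r)" "M > 0"
    by (rule polytimeE'[OF assms(3)]) (rule that; assumption)
  let ?R = "Cond (Fst (Var 0)) (Seq (Assign 0 (Snd (Var 0))) P) (Seq (Assign 0 (Snd (Var 0))) Q)"
  let ?B = "\<lambda>v :: bool \<times> 'a. 20 + b (snd v) + d (snd v) + 10 * esize v"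
  have "polytime (\<lambda>p. if fst p then f (snd p) else g (snd p))"
  proof (rule polytimeI'[where P = ?R and N = "max N M" and b = ?B])
    show "poly_bounded ?B"
      by (intro poly_bounded_add poly_bounded_const poly_bounded_mult poly_bounded_esize_id
           poly_bounded_comp[OF f(1) polytime_snd[OF polytime_id]]
           poly_bounded_comp[OF g(1) polytime_snd[OF polytime_id]])
    fix v :: "bool \<times> 'a" and s :: store assume s: "s 0 = enc v"
    let ?s1 = "s(0 := enc (snd v))"
    have e0: "exec (Assign 0 (Snd (Var 0))) s (1 + (esize (snd v) + esize v)) ?s1"
      using exec.Assign[of 0 "Snd (Var 0)" s] s by (simp add: cost_expr_simps enc_prod_def)
    have holds: "holds (Fst (Var 0)) s \<longleftrightarrow> fst v"
      using s by (auto simp: enc_prod_def enc_bool_def)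
    have cost: "cost_expr (Fst (Var 0)) s = esize (fst v) + esize v"
      using s by (simp add: cost_expr_simps enc_prod_def)
    have sz: "esize v = Suc (esize (fst v) + esize (snd v))"
      by (simp add: enc_prod_def)
    have 1: "?s1 0 = enc (snd v)" by simp
    show "\<exists>t s'. exec ?R s t s' \<and> s' 0 = enc (if fst v then f (snd v) else g (snd v)) \<and> t \<le> ?B v
        \<and> (\<forall>r\<ge>max N M. s' r = s r)"
    proof (cases "fst v")
      case True
      from f(2)[of ?s1 "snd v", OF 1] obtain t s' where 2: "exec P ?s1 t s'" "s' 0 = enc (f (snd v))" "t \<le> b (snd v)" "\<forall>r\<ge>N. s' r = ?s1 r"
        by blast
      note e = exec.CondTrue[where ?c2.0 = "Seq (Assign 0 (Snd (Var 0))) Q", OF _ exec.Seq[OF e0 2(1)]]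
      show ?thesis
        by (intro exI[of _ s'] exI conjI, rule e) (use 2 True cost sz f(3) holds in simp_all)
    next
      case False
      from g(2)[of ?s1 "snd v", OF 1] obtain t s' where 2: "exec Q ?s1 t s'" "s' 0 = enc (g (snd v))" "t \<le> d (snd v)" "\<forall>r\<ge>M. s' r = ?s1 r"
        by blast
      note e = exec.CondFalse[where ?c1.0 = "Seq (Assign 0 (Snd (Var 0))) P", OF _ exec.Seq[OF e0 2(1)]]
      show ?thesis
        by (intro exI[of _ s'] exI conjI, rule e) (use 2 False cost sz g(3) holds in simp_all)
    qed
  qed
  from polytime_comp[OF this polytime_Pair[OF assms(1) polytime_id]] show ?thesis
    by (simp only: fst_conv snd_conv)
qed

lemma polytime_null:
  fixes f :: "'a::encodable \<Rightarrow> 'b::encodable list"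
  assumes "polytime f" shows "polytime (\<lambda>x. f x = [])"
proof (rule polytime_comp[OF _ assms])
  show "polytime (\<lambda>xs :: 'b list. xs = [])"
  \<comment> \<open>The empty list is coded by a leaf and every other list by a pair, whatever the
    element type.\<close>
  proof (rule polytime_linear_expr[where e = "Equal (Var 0) (Lit 0)" and c = 3 and k = 1])
    fix xs :: "'b list" and s :: store assume s: "s 0 = enc xs"
    show "eval_expr (Equal (Var 0) (Lit 0)) s = enc (xs = [])"
      using s by (cases xs) (auto simp: enc_Nil enc_Cons enc_bool_def)
    show "cost_expr (Equal (Var 0) (Lit 0)) s \<le> 3 + 1 * esize xs"
      using s by (auto simp: cost_expr_simps bitlen_alt_def)
  qed
qed

(* the head of an empty list is unspecified, so it is only taken after the test *)
lemma polytime_case_list: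
  fixes f :: "'a::encodable \<Rightarrow> 'c::encodable" and g :: "'a \<Rightarrow> 'b::encodable \<Rightarrow> 'c"
  assumes "polytime xs" "polytime f" "polytime (\<lambda>p. g (fst p) (snd p))"
  shows "polytime (\<lambda>x. case xs x of [] \<Rightarrow> f x | y # ys \<Rightarrow> g x y)"
proof -
  obtain P N b where f: "poly_bounded b" "\<And>v s. s 0 = enc v \<Longrightarrow>
    \<exists>t s'. exec P s t s' \<and> s' 0 = enc (f v) \<and> t \<le> b v \<and> (\<forall>r\<ge>N. s' r = s r)" "N > 0"
    by (rule polytimeE'[OF assms(2)]) (rule that; assumption)
  obtain Q M d where g: "poly_bounded d" "\<And>v s. s 0 = enc v \<Longrightarrow>
    \<exists>t s'. exec Q s t s' \<and> s' 0 = enc (g (fst v) (snd v)) \<and> t \<le> d v \<and> (\<forall>r\<ge>M. s' r = s r)" "M > 0"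
    by (rule polytimeE'[OF assms(3)]) (rule that; assumption)
  from g(1)[unfolded poly_bounded_def] obtain dp where dp: "\<forall>x. d x \<le> poly dp (esize x)" ..
  let ?E = "Cons (Fst (Var 0)) (Fst (Snd (Var 0)))"
  let ?R = "Cond (IsPair (Snd (Var 0))) (Seq (Assign 0 ?E) Q) (Seq (Assign 0 (Fst (Var 0))) P)"
  let ?B = "\<lambda>v :: 'a \<times> 'b list. 20 + b (fst v) + poly dp (esize v) + 10 * esize v"
  have "polytime (\<lambda>p. case snd p of [] \<Rightarrow> f (fst p) | y # ys \<Rightarrow> g (fst p) y)"
  proof (rule polytimeI'[where P = ?R and N = "max N M" and b = ?B])
    show "poly_bounded ?B"
      by (intro poly_bounded_add poly_bounded_const poly_bounded_mult poly_bounded_esize_id poly_bounded_poly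
           poly_bounded_comp[OF f(1) polytime_fst[OF polytime_id]])
    fix v :: "'a \<times> 'b list" and s :: store assume s: "s 0 = enc v"
    obtain x ys where v: "v = (x, ys)" by (cases v)
    have cost: "cost_expr (IsPair (Snd (Var 0))) s \<le> 2 + esize ys + esize v"
      using s by (simp add: cost_expr_simps enc_prod_def bitlen_alt_def v)
    have sz: "esize v = Suc (esize x + esize ys)"
      by (simp add: enc_prod_def v)
    show "\<exists>t s'. exec ?R s t s' \<and> s' 0 = enc (case snd v of [] \<Rightarrow> f (fst v) | y # ys \<Rightarrow> g (fst v) y) \<and> t \<le> ?B v
        \<and> (\<forall>r\<ge>max N M. s' r = s r)"
    proof (cases ys)
      case Nil
      let ?s1 = "s(0 := enc x)"
      have e0: "exec (Assign 0 (Fst (Var 0))) s (1 + (esize x + esize v)) ?s1"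
        using exec.Assign[of 0 "Fst (Var 0)" s] s by (simp add: cost_expr_simps enc_prod_def v)
      have 1: "?s1 0 = enc x" by simp
      from f(2)[of ?s1 x, OF 1] obtain t s' where 2: "exec P ?s1 t s'" "s' 0 = enc (f x)" "t \<le> b x" "\<forall>r\<ge>N. s' r = ?s1 r"
        by blast
      note e = exec.CondFalse[where ?c1.0 = "Seq (Assign 0 ?E) Q", OF _ exec.Seq[OF e0 2(1)]]
      show ?thesis
        by (intro exI[of _ s'] exI conjI, rule e) (use 2 cost sz f(3) s in \<open>simp_all add: v Nil enc_prod_def enc_Nil\<close>)
    next
      case (Cons y zs)
      let ?s1 = "s(0 := enc (x, y))"
      have cE: "cost_expr ?E s = esize (x, y) + (esize x + esize v + (esize y + (esize ys + esize v)))"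
        using s by (simp add: cost_expr_simps enc_prod_def v Cons enc_Cons)
      have e0: "exec (Assign 0 ?E) s (1 + cost_expr ?E s) ?s1"
        using exec.Assign[of 0 ?E s] s by (simp add: enc_prod_def v Cons enc_Cons)
      have 1: "?s1 0 = enc (x, y)" by simp
      from g(2)[of ?s1 "(x, y)", OF 1] obtain t s' where 2: "exec Q ?s1 t s'" "s' 0 = enc (g x y)" "t \<le> d (x, y)" "\<forall>r\<ge>M. s' r = ?s1 r"
        by auto
      have le: "esize (x, y) \<le> esize v" "esize y \<le> esize ys"
        by (auto simp: v Cons enc_prod_def enc_Cons)
      have "t \<le> poly dp (esize v)"
        using 2(3) dp[rule_format, of "(x, y)"] poly_nat_mono[OF le(1), of dp] by linarith
      note t = this
      note e = exec.CondTrue[where ?c2.0 = "Seq (Assign 0 (Fst (Var 0))) P", OF _ exec.Seq[OF e0 2(1)]]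
      show ?thesis
        by (intro exI[of _ s'] exI conjI, rule e) (use 2 t cost cE sz f(3) le s in \<open>simp_all add: v Cons enc_prod_def enc_Cons\<close>)
    qed
  qed
  from polytime_comp[OF this polytime_Pair[OF polytime_id assms(1)]] show ?thesis
    by (simp only: fst_conv snd_conv)
qed

text \<open>Register 0 holds the accumulator, \<open>N\<close> the parameter and
  \<open>Suc N\<close> the rest of the list, out of reach of the body. All arguments of the body
  stay below one size \<open>Z\<close>, so that each round costs the same bound.\<close>

lemma exec_foldl_loop:
  fixes g :: "'a::encodable \<Rightarrow> 'b::encodable \<Rightarrow> 'c::encodable \<Rightarrow> 'b"
  assumes P: "\<And>v s. s 0 = enc v \<Longrightarrow>
      \<exists>t s'. exec P s t s' \<and> s' 0 = enc (g (fst v) (fst (snd v)) (snd (snd v))) \<and> t \<le> poly q (esize v)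
        \<and> (\<forall>r\<ge>N. s' r = s r)"
    and "N > 0"
    and "s 0 = enc acc" "s N = enc x" "s (Suc N) = enc l"
    and "\<And>n. n \<le> length l \<Longrightarrow> esize (foldl (g x) acc (take n l)) \<le> K"
    and Z: "2 + esize x + K + esize l \<le> Z"
  shows "\<exists>t s'. exec (While (IsPair (Var (Suc N)))
      (Seq (Assign 0 (Cons (Var N) (Cons (Var 0) (Fst (Var (Suc N))))))
        (Seq P (Assign (Suc N) (Snd (Var (Suc N))))))) s t s' \<and>
    s' 0 = enc (foldl (g x) acc l) \<and> t \<le> (length l + 1) * (poly q Z + 20 * Z) \<and> (\<forall>r\<ge>N + 2. s' r = s r)"
  (is "\<exists>t s'. exec (While ?e ?c) s t s' \<and> _")
  using assms(3-)
proof (induction l arbitrary: acc s)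
  case Nil
  have "exec (While ?e ?c) s (1 + cost_expr ?e s) s"
    by (rule exec.WhileFalse) (use Nil in \<open>simp add: enc_Nil\<close>)
  moreover have "1 + cost_expr ?e s \<le> 20 * Z"
    using Nil by (simp add: cost_expr_simps enc_Nil)
  ultimately show ?case using Nil.prems(1) by (intro exI[of _ s] exI conjI) auto
next
  case (Cons a l)
  have Kacc: "esize acc \<le> K" using Cons.prems(4)[of 0] by simp
  have szl: "esize (a # l) = Suc (esize a + esize l)" by (simp add: enc_Cons)
  let ?E = "Cons (Var N) (Cons (Var 0) (Fst (Var (Suc N))))"
  let ?s1 = "s(0 := enc (x, acc, a))"
  have e1: "exec (Assign 0 ?E) s (1 + cost_expr ?E s) ?s1"
    using exec.Assign[of 0 ?E s] Cons.prems by (simp add: enc_prod_def enc_Cons)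
  have cE: "cost_expr ?E s \<le> 4 * Z"
    using Cons.prems Kacc szl by (simp add: cost_expr_simps enc_prod_def enc_Cons)
  have "?s1 0 = enc (x, acc, a)" by simp
  from P[of ?s1 "(x, acc, a)", OF this] obtain t2 s2 where
    2: "exec P ?s1 t2 s2" "s2 0 = enc (g x acc a)" "t2 \<le> poly q (esize (x, acc, a))" "\<forall>r\<ge>N. s2 r = ?s1 r"
    by auto
  have "esize (x, acc, a) \<le> Z"
    using Cons.prems Kacc szl by (simp add: enc_prod_def)
  hence t2: "t2 \<le> poly q Z" using 2(3) poly_nat_mono order_trans by blast
  let ?s3 = "s2(Suc N := enc l)"
  have s2N: "s2 (Suc N) = enc (a # l)" "s2 N = enc x" using 2(4) Cons.prems \<open>N > 0\<close> by auto
  have e3: "exec (Assign (Suc N) (Snd (Var (Suc N)))) s2 (1 + (esize l + esize (a # l))) ?s3"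
    using exec.Assign[of "Suc N" "Snd (Var (Suc N))" s2] s2N by (simp add: cost_expr_simps enc_Cons)
  have b3: "esize l + esize (a # l) \<le> 2 * Z" using Cons.prems szl by simp
  have "\<exists>t s'. exec (While ?e ?c) ?s3 t s' \<and> s' 0 = enc (foldl (g x) (g x acc a) l) \<and>
    t \<le> (length l + 1) * (poly q Z + 20 * Z) \<and> (\<forall>r\<ge>N + 2. s' r = ?s3 r)"
  proof (rule Cons.IH)
    show "?s3 0 = enc (g x acc a)" "?s3 N = enc x" "?s3 (Suc N) = enc l"
      using 2(2) s2N by auto
    show "esize (foldl (g x) (g x acc a) (take n l)) \<le> K" if "n \<le> length l" for n
      using Cons.prems(4)[of "Suc n"] that by simp
    show "2 + esize x + K + esize l \<le> Z" using Cons.prems(5) szl by simp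
  qed
  then obtain t4 s4 where 4: "exec (While ?e ?c) ?s3 t4 s4" "s4 0 = enc (foldl (g x) (g x acc a) l)"
    "t4 \<le> (length l + 1) * (poly q Z + 20 * Z)" "\<forall>r\<ge>N + 2. s4 r = ?s3 r"
    by blast
  have h: "holds ?e s" using Cons.prems by (simp add: enc_Cons)
  have ce: "cost_expr ?e s \<le> 2 + Z"
    using Cons.prems szl by (simp add: cost_expr_simps enc_Cons bitlen_alt_def)
  note e = exec.WhileTrue[OF h exec.Seq[OF e1 exec.Seq[OF 2(1) e3]] 4(1)]
  have "Z \<ge> 2" using Cons.prems(5) by simp
  show ?case
    by (intro exI[of _ s4] exI conjI, rule e)
      (use 4 2 t2 cE b3 ce \<open>Z \<ge> 2\<close> in \<open>simp_all add: algebra_simps\<close>)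
qed

text \<open>A polynomial-time body alone is not enough, since squaring the accumulator in every
  round would make it exponentially long. The bound \<open>B\<close> on all intermediate
  accumulators excludes this and has to be supplied for every use.\<close>

lemma polytime_foldl:
  fixes g :: "'a::encodable \<Rightarrow> 'b::encodable \<Rightarrow> 'c::encodable \<Rightarrow> 'b"
  assumes g: "polytime (\<lambda>p. g (fst p) (fst (snd p)) (snd (snd p)))"
    and ini: "polytime ini" and xs: "polytime xs"
    and B: "poly_bounded B" "\<And>x n. n \<le> length (xs x) \<Longrightarrow> esize (foldl (g x) (ini x) (take n (xs x))) \<le> B x"
  shows "polytime (\<lambda>x. foldl (g x) (ini x) (xs x))"
proof -
  obtain P N q where P: "\<And>v s. s 0 = enc v \<Longrightarrow>
      \<exists>t s'. exec P s t s' \<and> s' 0 = enc (g (fst v) (fst (snd v)) (snd (snd v))) \<and> t \<le> poly q (esize v)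
        \<and> (\<forall>r\<ge>N. s' r = s r)" "N > 0"
    by (rule polytimeE[OF g]) (rule that; assumption)
  obtain R M b where R: "poly_bounded b" "\<And>v s. s 0 = enc v \<Longrightarrow>
    \<exists>t s'. exec R s t s' \<and> s' 0 = enc (v, ini v, xs v) \<and> t \<le> b v \<and> (\<forall>r\<ge>M. s' r = s r)" "M > 0"
    by (rule polytimeE'[OF polytime_Pair[OF polytime_id polytime_Pair[OF ini xs]]]) (rule that; assumption)
  let ?L = "While (IsPair (Var (Suc N)))
      (Seq (Assign 0 (Cons (Var N) (Cons (Var 0) (Fst (Var (Suc N))))))
        (Seq P (Assign (Suc N) (Snd (Var (Suc N))))))"
  let ?a1 = "Assign N (Fst (Var 0))" and ?a2 = "Assign (Suc N) (Snd (Snd (Var 0)))" and ?a3 = "Assign 0 (Fst (Snd (Var 0)))"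
  let ?R = "Seq R (Seq ?a1 (Seq ?a2 (Seq ?a3 ?L)))"
  let ?Z = "\<lambda>x. 4 + esize x + B x + esize (xs x)"
  let ?C = "\<lambda>x. b x + 30 * ?Z x + (esize (xs x) + 1) * (poly q (?Z x) + 20 * ?Z x)"
  show ?thesis
  proof (rule polytimeI'[where P = ?R and N = "max (N + 2) M" and b = ?C])
    show "poly_bounded ?C"
      by (intro poly_bounded_add poly_bounded_const poly_bounded_mult poly_bounded_esize_id poly_bounded_poly R(1) B(1)
          polytime_bounded xs)
    fix x and s :: store assume "s 0 = enc (x :: 'a)"
    from R(2)[of s x, OF this] obtain t1 s1 where 1: "exec R s t1 s1" "s1 0 = enc (x, ini x, xs x)" "t1 \<le> b x"
      "\<forall>r\<ge>M. s1 r = s r" by blast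
    let ?s2 = "s1(N := enc x)" let ?s3 = "?s2(Suc N := enc (xs x))" let ?s4 = "?s3(0 := enc (ini x))"
    have Bx: "esize (ini x) \<le> B x" using B(2)[of 0 x] by simp
    have "?s2 0 = s1 0" "?s3 0 = s1 0" using \<open>N > 0\<close> by auto
    hence e: "exec ?a1 s1 (1 + cost_expr (Fst (Var 0)) s1) ?s2"
      "exec ?a2 ?s2 (1 + cost_expr (Snd (Snd (Var 0))) ?s2) ?s3"
      "exec ?a3 ?s3 (1 + cost_expr (Fst (Snd (Var 0))) ?s3) ?s4"
      using exec.Assign[of N "Fst (Var 0)" s1] exec.Assign[of "Suc N" "Snd (Snd (Var 0))" ?s2]
        exec.Assign[of 0 "Fst (Snd (Var 0))" ?s3] 1(2) by (simp_all add: enc_prod_def)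
    have c: "cost_expr (Fst (Var 0)) s1 \<le> 3 * ?Z x" "cost_expr (Snd (Snd (Var 0))) ?s2 \<le> 3 * ?Z x"
      "cost_expr (Fst (Snd (Var 0))) ?s3 \<le> 3 * ?Z x"
      using 1(2) \<open>N > 0\<close> Bx by (simp_all add: cost_expr_simps enc_prod_def)
    have "\<exists>t s'. exec ?L ?s4 t s' \<and> s' 0 = enc (foldl (g x) (ini x) (xs x)) \<and>
      t \<le> (length (xs x) + 1) * (poly q (?Z x) + 20 * ?Z x) \<and> (\<forall>r\<ge>N + 2. s' r = ?s4 r)"
      by (rule exec_foldl_loop[OF P, where K = "B x"]) (use \<open>N > 0\<close> B(2)[of _ x] in auto)
    then obtain t5 s5 where 5: "exec ?L ?s4 t5 s5" "s5 0 = enc (foldl (g x) (ini x) (xs x))"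
      "t5 \<le> (length (xs x) + 1) * (poly q (?Z x) + 20 * ?Z x)" "\<forall>r\<ge>N + 2. s5 r = ?s4 r" by blast
    have "(length (xs x) + 1) * (poly q (?Z x) + 20 * ?Z x) \<le> (esize (xs x) + 1) * (poly q (?Z x) + 20 * ?Z x)"
      by (intro mult_le_mono1 add_right_mono length_le_esize)
    with 5(3) have t5: "t5 \<le> (esize (xs x) + 1) * (poly q (?Z x) + 20 * ?Z x)" by linarith
    have "1 + t1 + (1 + (1 + cost_expr (Fst (Var 0)) s1) + (1 + (1 + cost_expr (Snd (Snd (Var 0))) ?s2) +
       (1 + (1 + cost_expr (Fst (Snd (Var 0))) ?s3) + t5))) \<le> ?C x"
    proof -
      have "1 + t1 + (1 + (1 + c1) + (1 + (1 + c2) + (1 + (1 + c3) + t5))) \<le> d + 30 * z + w"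
        if "c1 \<le> 3 * z" "c2 \<le> 3 * z" "c3 \<le> 3 * z" "t5 \<le> w" "t1 \<le> d" "4 \<le> z" for c1 c2 c3 d w z :: nat
        using that by linarith
      from this[OF c t5 1(3)] show ?thesis by simp
    qed
    moreover have "\<forall>r\<ge>max (N + 2) M. s5 r = s r" using 5(4) 1(4) by simp
    ultimately show "\<exists>t s'. exec ?R s t s' \<and> s' 0 = enc (foldl (g x) (ini x) (xs x)) \<and> t \<le> ?C x \<and>
        (\<forall>r\<ge>max (N + 2) M. s' r = s r)"
      using exec.Seq[OF 1(1) exec.Seq[OF e(1) exec.Seq[OF e(2) exec.Seq[OF e(3) 5(1)]]]] 5(2) by blast
  qed
qed

lemma polytime_comp2:
  assumes "polytime (\<lambda>p. h (fst p) (snd p))" "polytime f" "polytime g"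
  shows "polytime (\<lambda>x. h (f x) (g x))"
  using polytime_comp[OF assms(1) polytime_Pair[OF assms(2,3)]] by (simp only: fst_conv snd_conv)

lemma polytime_not: "polytime b \<Longrightarrow> polytime (\<lambda>x. \<not> b x)"
  using polytime_if[OF _ polytime_False polytime_True, of b] by (simp add: if_bool_eq_conj cong: if_cong)

lemma polytime_conj: "polytime b \<Longrightarrow> polytime c \<Longrightarrow> polytime (\<lambda>x. b x \<and> c x)"
  using polytime_if[OF _ _ polytime_False, of b c]
  by (rule back_subst[where P = polytime]) (auto simp: fun_eq_iff)

lemma polytime_disj: "polytime b \<Longrightarrow> polytime c \<Longrightarrow> polytime (\<lambda>x. b x \<or> c x)"
  using polytime_not[OF polytime_conj[OF polytime_not polytime_not], of b c] by simp

lemma polytime_le: "polytime f \<Longrightarrow> polytime g \<Longrightarrow> polytime (\<lambda>x. (f x :: int) \<le> g x)"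
  using polytime_not[OF polytime_less, of g f] by (simp add: not_less)

lemma polytime_eq: "polytime f \<Longrightarrow> polytime g \<Longrightarrow> polytime (\<lambda>x. (f x :: int) = g x)"
  using polytime_conj[OF polytime_le polytime_le, of f g g f] by (simp add: eq_iff)

lemma polytime_revappend:
  assumes "polytime f" "polytime g"
  shows "polytime (\<lambda>x. rev (f x) @ g x :: 'b::encodable list)"
proof -
  have *: "foldl (\<lambda>acc a. a # acc) ys xs = rev xs @ ys" for xs ys :: "'b list"
    by (induction xs arbitrary: ys) auto
  have "polytime (\<lambda>x. foldl (\<lambda>acc a. a # acc) (g x) (f x))"
  proof (rule polytime_foldl[where g = "\<lambda>_ acc a. a # acc" and B = "\<lambda>x. esize (f x) + esize (g x)"])
    fix x n
    have "esize (take n (f x)) \<le> esize (f x)"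
      using esize_append[of "take n (f x)" "drop n (f x)"] vsize_pos[of "enc (drop n (f x))"] by simp
    thus "esize (foldl (\<lambda>acc a. a # acc) (g x) (take n (f x))) \<le> esize (f x) + esize (g x)"
      using esize_append[of "rev (take n (f x))" "g x"] by (simp add: * esize_rev)
  qed (intro assms polytime_Cons polytime_fst polytime_snd polytime_id poly_bounded_add polytime_bounded)+
  thus ?thesis by (simp add: *)
qed

lemma polytime_rev: "polytime f \<Longrightarrow> polytime (\<lambda>x. rev (f x))"
  using polytime_revappend[OF _ polytime_Nil, of f] by simp

lemma polytime_append: "polytime f \<Longrightarrow> polytime g \<Longrightarrow> polytime (\<lambda>x. f x @ g x)"
  using polytime_revappend[OF polytime_rev, of f g] by simp

(* binders are pushed into pairs: the body of a comprehension over x is a function of (x, a) *)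
lemma polytime_concat_map:
  fixes f :: "'a::encodable \<Rightarrow> 'b::encodable \<Rightarrow> 'c::encodable list"
  assumes f: "polytime (\<lambda>p. f (fst p) (snd p))" and xs: "polytime xs"
  shows "polytime (\<lambda>x. concat (map (f x) (xs x)))"
proof -
  have *: "foldl (\<lambda>acc a. acc @ h a) ys as = ys @ concat (map h as)" for h :: "'b \<Rightarrow> 'c list" and ys as
    by (induction as arbitrary: ys) auto
  obtain q where q: "\<And>p. esize (f (fst p) (snd p)) \<le> poly q (esize p)"
    using polytime_bounded[OF f] unfolding poly_bounded_def by blast
  let ?B = "\<lambda>x. 1 + esize (xs x) * (poly q (1 + esize x + esize (xs x)))"
  have "polytime (\<lambda>x. foldl (\<lambda>acc a. acc @ f x a) [] (xs x))"
  proof (rule polytime_foldl[where g = "\<lambda>x acc a. acc @ f x a" and B = ?B])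
    show "polytime (\<lambda>p :: 'a \<times> 'c list \<times> 'b. fst (snd p) @ f (fst p) (snd (snd p)))"
      by (intro polytime_append polytime_comp2[OF f] polytime_fst polytime_snd polytime_id)
    show "poly_bounded ?B"
      by (intro poly_bounded_add poly_bounded_mult poly_bounded_poly poly_bounded_const poly_bounded_esize_id
          polytime_bounded xs)
    fix x n
    let ?Q = "poly q (1 + esize x + esize (xs x))"
    have "esize (f x a) \<le> ?Q" if "a \<in> set (xs x)" for a
    proof -
      have "esize (x, a) \<le> 1 + esize x + esize (xs x)" using esize_mem[OF that] by (simp add: esize_Pair)
      thus ?thesis using q[of "(x, a)"] poly_nat_mono order_trans by fastforce
    qed
    hence "esize (concat (map (f x) as)) \<le> 1 + length as * ?Q" if "set as \<subseteq> set (xs x)" for as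
      using that
    proof (induction as)
      case (Cons a as)
      have "esize (concat (map (f x) as)) \<le> 1 + length as * ?Q" using Cons by simp
      moreover have "esize (f x a) \<le> ?Q" using Cons.prems by simp
      ultimately show ?case using esize_append[of "f x a" "concat (map (f x) as)"] by simp
    qed (simp add: esize_Nil)
    from this[OF set_take_subset[of n]]
    have "esize (concat (map (f x) (take n (xs x)))) \<le> 1 + length (take n (xs x)) * ?Q" .
    also have "\<dots> \<le> ?B x"
      using length_le_esize[of "xs x"] by (intro add_left_mono mult_le_mono1) simp
    finally show "esize (foldl (\<lambda>acc a. acc @ f x a) [] (take n (xs x))) \<le> ?B x" by (simp add: *)
  qed (intro polytime_Nil xs)+
  thus ?thesis by (simp add: *)
qed

lemma polytime_map:
  assumes "polytime (\<lambda>p. f (fst p) (snd p))" "polytime xs"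
  shows "polytime (\<lambda>x. map (f x) (xs x))"
proof -
  have "concat (map (\<lambda>a. [h a]) as) = map h as" for h :: "'b \<Rightarrow> 'c" and as by (induction as) auto
  thus ?thesis
    using polytime_concat_map[where f = "\<lambda>x a. [f x a]", OF polytime_Cons[OF assms(1) polytime_Nil] assms(2)] by simp
qed

lemma polytime_filter:
  assumes "polytime (\<lambda>p. P (fst p) (snd p))" "polytime xs"
  shows "polytime (\<lambda>x. filter (P x) (xs x))"
proof -
  have "concat (map (\<lambda>a. if h a then [a] else []) as) = filter h as" for h :: "'b \<Rightarrow> bool" and as by (induction as) auto
  thus ?thesis
    using polytime_concat_map[where f = "\<lambda>x a. if P x a then [a] else []",
        OF polytime_if[OF assms(1) polytime_Cons[OF polytime_snd[OF polytime_id] polytime_Nil] polytime_Nil] assms(2)]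
    by simp
qed

text \<open>If the size of the result is at most the sum of the sizes of the arguments, an
  accumulator never exceeds the start value plus the part of the list consumed.\<close>

lemma polytime_foldl_subadditive:
  fixes xs :: "'a::encodable \<Rightarrow> int list"
  assumes op: "polytime (\<lambda>p. h (fst p) (snd p))" and "polytime xs"
    and size: "\<And>m n. vsize (VInt (h m n)) \<le> vsize (VInt m) + vsize (VInt n)"
  shows "polytime (\<lambda>x. foldl h c (xs x))"
proof (rule polytime_foldl[where g = "\<lambda>_. h" and B = "\<lambda>x. vsize (VInt c) + esize (xs x)"])
  fix x n
  have "esize (foldl h d as) \<le> vsize (VInt d) + esize as" for d as
  proof (induction as arbitrary: d)
    case (Cons a as)
    show ?case using Cons[of "h d a"] size[of d a] by (simp add: esize_Cons enc_int_def)
  qed (simp add: enc_int_def)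
  moreover have "esize (take n (xs x)) \<le> esize (xs x)"
    using esize_append[of "take n (xs x)" "drop n (xs x)"] vsize_pos[of "enc (drop n (xs x))"] by simp
  ultimately show "esize (foldl h c (take n (xs x))) \<le> vsize (VInt c) + esize (xs x)"
    by (meson add_left_mono order_trans)
qed (intro assms polytime_lit polytime_comp2[OF op] polytime_fst polytime_snd polytime_id poly_bounded_add
    poly_bounded_const polytime_bounded)+

lemma polytime_sum_list:
  assumes "polytime xs" shows "polytime (\<lambda>x. sum_list (xs x) :: int)"
proof -
  have *: "foldl (+) c as = c + sum_list as" for c :: int and as by (induction as arbitrary: c) auto
  have "polytime (\<lambda>x. foldl (+) 0 (xs x))"
    by (rule polytime_foldl_subadditive[OF _ assms vsize_VInt_add])
      (intro polytime_add polytime_fst polytime_snd polytime_id)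
  thus ?thesis by (simp add: *)
qed

lemma polytime_prod_list:
  assumes "polytime xs" shows "polytime (\<lambda>x. prod_list (xs x) :: int)"
proof -
  have *: "foldl (*) c as = c * prod_list as" for c :: int and as by (induction as arbitrary: c) (auto simp: mult_ac)
  have "polytime (\<lambda>x. foldl (*) 1 (xs x))"
    by (rule polytime_foldl_subadditive[OF _ assms vsize_VInt_mult])
      (intro polytime_mult polytime_fst polytime_snd polytime_id)
  thus ?thesis by (simp add: *)
qed

lemmas polytime_intros = polytime_id polytime_lit polytime_True polytime_False polytime_Nil polytime_Pair
  polytime_fst polytime_snd polytime_Cons polytime_add polytime_diff polytime_mult polytime_div
  polytime_less polytime_le polytime_eq polytime_not polytime_conj polytime_disj polytime_if polytime_null
  polytime_case_list polytime_append polytime_concat_map polytime_map polytime_filter polytime_sum_list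
  polytime_prod_list

section \<open>Rounding the load of one facility\<close>

text \<open>One facility, with clients laid out on a line as consecutive intervals of length
  \<open>w j\<close>, farthest client first, and the line cut into slots of length \<open>U\<close>.
  A slot is meant to take one client, and \<open>w j\<close> divided by \<open>U\<close> is the
  fraction of the client at this facility.\<close>

locale slots =
  fixes J :: "int set" and d w :: "int \<Rightarrow> int" and U :: int
  assumes finite_J: "finite J" and U_pos: "0 < U"
    and w_bounds: "j \<in> J \<Longrightarrow> 0 \<le> w j" "j \<in> J \<Longrightarrow> w j \<le> U"
    and d_nonneg: "j \<in> J \<Longrightarrow> 0 \<le> d j"
begin

definition prec :: "int \<Rightarrow> int \<Rightarrow> bool" where
  "prec a b \<longleftrightarrow> d b < d a \<or> d a = d b \<and> a < b"

definition prefix :: "int set \<Rightarrow> int \<Rightarrow> int" where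
  "prefix A j = (\<Sum>a\<in>{a \<in> A. prec a j}. w a)"

text \<open>The length of the part of slot \<open>s\<close>, that is of the interval from
  \<open>s * U\<close> to \<open>(s + 1) * U\<close>, lying below \<open>t\<close>. The difference
  of two values measures how much of an interval falls into the slot.\<close>

definition clamp :: "int \<Rightarrow> int \<Rightarrow> int" where
  "clamp s t = max 0 (min U (t - s * U))"

definition overlap :: "int \<Rightarrow> int \<Rightarrow> int" where
  "overlap j s = clamp s (prefix J j + w j) - clamp s (prefix J j)"

text \<open>The slots of the first and the last unit of the client's interval. The interval is
  half-open, hence the \<open>- 1\<close>: ending exactly at a slot boundary does not reach the next
  slot.\<close>

definition adjacent :: "int \<Rightarrow> int set" where
  "adjacent j = {prefix J j div U, (prefix J j + w j - 1) div U}"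

lemma ex_last:
  assumes "finite A" "A \<noteq> {}" shows "\<exists>m\<in>A. \<forall>a\<in>A. a \<noteq> m \<longrightarrow> prec a m"
  using assms
proof (induction rule: finite_ne_induct)
  case (insert x A)
  then obtain m where "m \<in> A" "\<forall>a\<in>A. a \<noteq> m \<longrightarrow> prec a m" by blast
  thus ?case
    by (cases "prec x m") (auto simp: prec_def)
qed simp

text \<open>Induction removes the last client in the order: its prefix is the whole rest, and no
  other prefix changes. The set is arbitrary because the telescoping is also needed for an initial
  segment of the clients.\<close>

lemma sum_prefix_telescope:
  assumes "finite A"
  shows "(\<Sum>j\<in>A. f (prefix A j + w j) - f (prefix A j)) = f (\<Sum>j\<in>A. w j) - (f 0 :: int)"
  using assms
proof (induction "card A" arbitrary: A)
  case (Suc n)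
  hence "A \<noteq> {}" by auto
  then obtain m where m: "m \<in> A" "\<forall>a\<in>A. a \<noteq> m \<longrightarrow> prec a m" using ex_last Suc.prems by blast
  let ?B = "A - {m}"
  have eq: "prefix A j = prefix ?B j" if "j \<in> ?B" for j
  proof -
    have "{a \<in> A. prec a j} = {a \<in> ?B. prec a j}" using m that by (auto simp: prec_def)
    thus ?thesis by (simp add: prefix_def)
  qed
  have "{a \<in> A. prec a m} = ?B" using m by (auto simp: prec_def)
  hence pm: "prefix A m = (\<Sum>j\<in>?B. w j)" by (simp add: prefix_def)
  have "(\<Sum>j\<in>A. f (prefix A j + w j) - f (prefix A j))
      = f (prefix A m + w m) - f (prefix A m) + (\<Sum>j\<in>?B. f (prefix A j + w j) - f (prefix A j))"
    using Suc.prems m by (simp add: sum.remove)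
  also have "(\<Sum>j\<in>?B. f (prefix A j + w j) - f (prefix A j)) = f (\<Sum>j\<in>?B. w j) - f 0"
    using Suc.hyps(1)[of ?B] Suc.hyps(2) Suc.prems m by (simp add: eq)
  finally show ?case using Suc.prems m pm by (simp add: sum.remove add.commute)
qed simp

lemma overlap_nonneg: "j \<in> J \<Longrightarrow> 0 \<le> overlap j s"
  using w_bounds(1)[of j] unfolding overlap_def clamp_def by linarith

lemma prefix_nonneg: "0 \<le> prefix J j"
  unfolding prefix_def by (rule sum_nonneg) (use w_bounds in auto)

lemma sum_overlap_le: "s \<ge> 0 \<Longrightarrow> (\<Sum>j\<in>J. overlap j s) \<le> U"
  unfolding overlap_def
  by (subst sum_prefix_telescope[OF finite_J]) (use U_pos in \<open>auto simp: clamp_def\<close>)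

text \<open>Since \<open>w j\<close> is at most \<open>U\<close>, the first and last slot touched
  coincide or are neighbours, so no slot in between is missed.\<close>

lemma sum_overlap_adjacent:
  assumes "j \<in> J" "0 < w j" shows "(\<Sum>s\<in>adjacent j. overlap j s) = w j"
proof -
  let ?p = "prefix J j"
  let ?s = "?p div U" and ?r = "(?p + w j - 1) div U"
  have s: "?s * U \<le> ?p" "?p < (?s + 1) * U"
    using U_pos by (auto simp: algebra_simps) (metis mult.commute pos_mod_sign le_add_same_cancel1 mult_div_mod_eq,
      metis add.commute add_less_cancel_left mult.commute mult_div_mod_eq pos_mod_bound)
  have r: "?r * U \<le> ?p + w j - 1" "?p + w j - 1 < (?r + 1) * U"
    using U_pos by (auto simp: algebra_simps) (smt (verit) mult.commute pos_mod_sign mult_div_mod_eq,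
      smt (verit) mult.commute mult_div_mod_eq pos_mod_bound)
  have "?s \<le> ?r" using assms U_pos by (intro zdiv_mono1) auto
  moreover have "?r \<le> (?p + 1 * U) div U" using w_bounds[OF assms(1)] U_pos by (intro zdiv_mono1) auto
  hence "?r \<le> ?s + 1" using U_pos by simp
  ultimately consider "?r = ?s" | "?r = ?s + 1" by linarith
  thus ?thesis
  proof cases
    case 1
    have "overlap j ?s = w j"
      using s r w_bounds[OF assms(1)] unfolding overlap_def clamp_def 1 by (auto simp: algebra_simps)
    thus ?thesis by (simp add: adjacent_def 1)
  next
    case 2
    have "overlap j ?s + overlap j (?s + 1) = w j"
      using s r w_bounds[OF assms(1)] unfolding overlap_def clamp_def 2 by (auto simp: algebra_simps)
    thus ?thesis by (simp add: adjacent_def 2)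
  qed
qed

lemma adjacent_nonneg: "j \<in> J \<Longrightarrow> 0 < w j \<Longrightarrow> s \<in> adjacent j \<Longrightarrow> 0 \<le> s"
  using prefix_nonneg[of j] U_pos by (auto simp: adjacent_def pos_imp_zdiv_nonneg_iff)

(* the slot before one that j reaches is filled by clients at least as far away as j *)
lemma distance_le_previous_slot:
  assumes j: "j \<in> J" "0 < w j" "s + 1 \<in> adjacent j" and "0 \<le> s"
  shows "U * d j \<le> (\<Sum>a\<in>J. overlap a s * d a)"
proof -
  let ?D = "{a \<in> J. prec a j \<or> a = j}"
  have fin: "finite ?D" using finite_J by simp
  have eq: "prefix ?D a = prefix J a" if "a \<in> ?D" for a
  proof -
    have "{b \<in> ?D. prec b a} = {b \<in> J. prec b a}" using that by (auto simp: prec_def)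
    thus ?thesis by (simp add: prefix_def)
  qed
  have "?D = insert j {a \<in> J. prec a j}" using j by auto
  hence W: "(\<Sum>a\<in>?D. w a) = prefix J j + w j"
    using finite_J by (simp add: prefix_def prec_def)
  have "(s + 1) * U \<le> prefix J j + w j"
  proof -
    have "s + 1 \<le> (prefix J j + w j - 1) div U"
      using j(2,3) U_pos zdiv_mono1[of "prefix J j" "prefix J j + w j - 1" U] by (auto simp: adjacent_def)
    hence "(s + 1) * U \<le> (prefix J j + w j - 1) div U * U" using U_pos by simp
    also have "\<dots> \<le> prefix J j + w j - 1"
      by (metis U_pos add.commute le_add_same_cancel2 mult.commute pos_mod_sign mult_div_mod_eq)
    finally show ?thesis by simp
  qed
  moreover have "0 \<le> s * U" using \<open>0 \<le> s\<close> U_pos by simp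
  ultimately have "clamp s (\<Sum>a\<in>?D. w a) - clamp s 0 = U"
    using U_pos unfolding W clamp_def by (simp add: algebra_simps)
  moreover have "(\<Sum>a\<in>?D. overlap a s) = clamp s (\<Sum>a\<in>?D. w a) - clamp s 0"
    unfolding overlap_def sum_prefix_telescope[OF fin, symmetric] by (rule sum.cong) (simp_all add: eq)
  ultimately have "(\<Sum>a\<in>?D. overlap a s) = U" by linarith
  hence "U * d j = (\<Sum>a\<in>?D. overlap a s * d j)"
    by (metis sum_distrib_right)
  also have "\<dots> \<le> (\<Sum>a\<in>?D. overlap a s * d a)"
    by (intro sum_mono mult_left_mono overlap_nonneg) (auto simp: prec_def)
  also have "\<dots> \<le> (\<Sum>a\<in>J. overlap a s * d a)"
    by (intro sum_mono2 finite_J) (use overlap_nonneg d_nonneg in auto)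
  finally show ?thesis .
qed

lemma sum_clamp: "0 \<le> t \<Longrightarrow> (\<Sum>s<n. clamp (int s) t) = min t (int n * U)"
  using U_pos by (induction n) (auto simp: clamp_def algebra_simps min_def max_def)

lemma sum_overlap_slots_le:
  assumes "j \<in> J" shows "(\<Sum>s<n. overlap j (int s)) \<le> w j"
  using w_bounds[OF assms] prefix_nonneg[of j]
  by (simp add: overlap_def sum_subtractf sum_clamp min_def)

text \<open>The client in slot 0 costs at most \<open>T\<close>. A client in slot
  \<open>s + 1\<close> is at most as far as the weighted average distance in slot \<open>s\<close>,
  and as slots are used once, these averages add up to at most the fractional load.\<close>

lemma matched_load_le:
  assumes N: "N \<subseteq> J" "\<And>j. j \<in> N \<Longrightarrow> 0 < w j \<and> \<sigma> j \<in> adjacent j" "inj_on \<sigma> N"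
    and T: "\<And>j. j \<in> N \<Longrightarrow> d j \<le> T" "0 \<le> T"
  shows "U * (\<Sum>j\<in>N. d j) \<le> U * T + (\<Sum>j\<in>J. w j * d j)"
proof -
  have fin: "finite N" using N(1) finite_J finite_subset by blast
  let ?Z = "{j \<in> N. \<sigma> j = 0}" and ?P = "{j \<in> N. \<sigma> j \<noteq> 0}"
  have pos: "0 < \<sigma> j" if "j \<in> ?P" for j
    using adjacent_nonneg[of j "\<sigma> j"] N that by force
  have "(\<Sum>j\<in>?Z. d j) \<le> T"
  proof (cases "?Z = {}")
    case False
    then obtain z where z: "z \<in> ?Z" by blast
    hence "?Z = {z}" using N(3) by (auto simp: inj_on_def)
    thus ?thesis using z T by auto
  next
    case True
    show ?thesis unfolding True using T by simp
  qed
  hence Z: "U * (\<Sum>j\<in>?Z. d j) \<le> U * T" using U_pos by simp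
  \<comment> \<open>All predecessors of used slots lie among the first \<open>n\<close> slots, so
    their overlaps with one client sum to at most its weight.\<close>
  define n where "n = nat (Max (insert 0 (\<sigma> ` N)))"
  have n: "\<sigma> j - 1 \<in> int ` {..<n}" if "j \<in> ?P" for j
  proof -
    have "\<sigma> j \<le> Max (insert 0 (\<sigma> ` N))" using that fin by (intro Max_ge) auto
    hence "\<sigma> j - 1 = int (nat (\<sigma> j - 1))" "nat (\<sigma> j - 1) < n" using pos[OF that] by (auto simp: n_def)
    thus ?thesis by blast
  qed
  have inj: "inj_on (\<lambda>j. \<sigma> j - 1) ?P" using N(3) by (auto simp: inj_on_def)
  have "(\<Sum>j\<in>?P. U * d j) \<le> (\<Sum>j\<in>?P. \<Sum>a\<in>J. overlap a (\<sigma> j - 1) * d a)"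
  proof (rule sum_mono)
    fix j assume j: "j \<in> ?P"
    show "U * d j \<le> (\<Sum>a\<in>J. overlap a (\<sigma> j - 1) * d a)"
      by (rule distance_le_previous_slot) (use j N pos[OF j] in auto)
  qed
  also have "\<dots> = (\<Sum>a\<in>J. (\<Sum>j\<in>?P. overlap a (\<sigma> j - 1)) * d a)"
    by (subst sum.swap) (simp add: sum_distrib_right)
  also have "\<dots> \<le> (\<Sum>a\<in>J. w a * d a)"
  proof (intro sum_mono mult_right_mono d_nonneg)
    fix a assume a: "a \<in> J"
    have "(\<Sum>j\<in>?P. overlap a (\<sigma> j - 1)) = (\<Sum>s\<in>(\<lambda>j. \<sigma> j - 1) ` ?P. overlap a s)"
      by (simp add: sum.reindex[OF inj])
    also have "\<dots> \<le> (\<Sum>s\<in>int ` {..<n}. overlap a s)"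
      by (intro sum_mono2) (use n overlap_nonneg[OF a] in auto)
    also have "\<dots> = (\<Sum>s<n. overlap a (int s))" by (simp add: sum.reindex)
    also have "\<dots> \<le> w a" by (rule sum_overlap_slots_le[OF a])
    finally show "(\<Sum>j\<in>?P. overlap a (\<sigma> j - 1)) \<le> w a" .
  qed
  finally have P: "U * (\<Sum>j\<in>?P. d j) \<le> (\<Sum>a\<in>J. w a * d a)" by (simp add: sum_distrib_left)
  have "(\<Sum>j\<in>N. d j) = (\<Sum>j\<in>?Z. d j) + (\<Sum>j\<in>?P. d j)"
    using fin by (subst sum.union_disjoint[symmetric]) (auto intro!: sum.cong)
  thus ?thesis using Z P by (simp add: distrib_left)
qed

end

section \<open>Bipartite matching by auction\<close>

text \<open>A slot not yet in the state gets the empty sum 0. Labels play the role of prices, and an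
  occupied slot never becomes free again, so a label is not lost when an owner is evicted.\<close>

definition label :: "('s \<times> int \<times> 'j) list \<Rightarrow> 's \<Rightarrow> int" where
  "label st s = sum_list (map (\<lambda>e. fst (snd e)) (filter (\<lambda>e. fst e = s) st))"

(* an unassigned client takes an adjacent slot of least label and evicts its owner; state entries are (slot, label, client) *)
definition auction_step :: "('j \<times> 's) list \<Rightarrow> 'j list \<Rightarrow> ('s \<times> int \<times> 'j) list \<Rightarrow> ('s \<times> int \<times> 'j) list" where
  "auction_step E js st = (case filter (\<lambda>j. filter (\<lambda>e. snd (snd e) = j) st = []) js of [] \<Rightarrow> st
    | j # _ \<Rightarrow> (case filter (\<lambda>s. filter (\<lambda>s'. label st s' < label st s) (map snd (filter (\<lambda>e. fst e = j) E)) = [])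
          (map snd (filter (\<lambda>e. fst e = j) E)) of [] \<Rightarrow> st
        | s # _ \<Rightarrow> (s, label st s + 1, j) # filter (\<lambda>e. fst e \<noteq> s) st))"

definition auction :: "('j \<times> 's) list \<Rightarrow> 'j list \<Rightarrow> 'u list \<Rightarrow> ('s \<times> int \<times> 'j) list" where
  "auction E js fuel = foldl (\<lambda>st _. auction_step E js st) [] fuel"

definition total_label :: "('s \<times> int \<times> 'j) list \<Rightarrow> int" where
  "total_label st = sum_list (map (\<lambda>e. fst (snd e)) st)"

lemma label_absent: "s \<notin> fst ` set st \<Longrightarrow> label st s = 0"
proof -
  assume "s \<notin> fst ` set st"
  hence "filter (\<lambda>e. fst e = s) st = []" by (auto simp: filter_empty_conv)
  thus ?thesis by (simp add: label_def)
qed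

lemma label_present: "distinct (map fst st) \<Longrightarrow> (s, l, j) \<in> set st \<Longrightarrow> label st s = l"
proof (induction st)
  case (Cons e st)
  show ?case
  proof (cases "e = (s, l, j)")
    case True
    hence "s \<notin> fst ` set st" using Cons.prems by auto
    thus ?thesis using label_absent[of s st] True by (simp add: label_def)
  next
    case False
    hence "(s, l, j) \<in> set st" using Cons.prems by auto
    moreover from this have "s \<in> fst ` set st" by force
    hence "fst e \<noteq> s" using Cons.prems(1) by auto
    ultimately show ?thesis using Cons by (simp add: label_def)
  qed
qed simp

lemma label_update:
  "label ((s, l, j) # filter (\<lambda>e. fst e \<noteq> s) st) s' = (if s' = s then l else label st s')"
proof -
  have "filter (\<lambda>e. fst e = s \<and> fst e \<noteq> s) st = []" by (simp add: filter_empty_conv)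
  moreover have "s' \<noteq> s \<Longrightarrow> filter (\<lambda>e. fst e = s' \<and> fst e \<noteq> s) st = filter (\<lambda>e. fst e = s') st"
    by (rule filter_cong) auto
  ultimately show ?thesis by (auto simp: label_def conj_commute)
qed

lemma total_label_filter:
  "total_label (filter (\<lambda>e. fst e \<noteq> s) st) = total_label st - label st s"
  by (induction st) (auto simp: total_label_def label_def)

locale hall_graph =
  fixes E :: "('j \<times> 's) list" and js :: "'j list"
  assumes hall: "S \<subseteq> set js \<Longrightarrow> card S \<le> card {s. \<exists>j\<in>S. (j, s) \<in> set E}"
begin

text \<open>The last clause is complementary slackness up to one unit: an owner sits on a slot whose
  label exceeds that of any other neighbour by at most 1. It survives later rounds because labels
  only grow.\<close>

definition auction_inv :: "('s \<times> int \<times> 'j) list \<Rightarrow> bool" where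
  "auction_inv st \<longleftrightarrow> distinct (map fst st) \<and> distinct (map (\<lambda>e. snd (snd e)) st) \<and>
    (\<forall>(s, l, j) \<in> set st. j \<in> set js \<and> (j, s) \<in> set E \<and> 1 \<le> l \<and> l \<le> int (card (set js)) + 1 \<and>
      (\<forall>s'. (j, s') \<in> set E \<longrightarrow> l \<le> label st s' + 1))"

(* Let j0 be unassigned with all adjacent labels at least h. The clients on slots of label at least t, together with
  j0, have all their neighbours among the slots of label at least t - 1, so Hall's condition makes their number grow
  each time t decreases, from h down to 1. *)
lemma min_label_le:
  assumes inv: "auction_inv st" and j0: "j0 \<in> set js" "j0 \<notin> (\<lambda>e. snd (snd e)) ` set st"
    and h: "\<And>s. (j0, s) \<in> set E \<Longrightarrow> h \<le> label st s"
  shows "h \<le> int (card (set js))"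
proof (rule ccontr)
  assume "\<not> h \<le> int (card (set js))"
  hence big: "int (card (set js)) < h" by simp
  define A where "A t = {e \<in> set st. t \<le> fst (snd e)}" for t
  define S where "S t = insert j0 ((\<lambda>e. snd (snd e)) ` A t)" for t
  have d: "inj_on fst (set st)" "inj_on (\<lambda>e. snd (snd e)) (set st)"
    using inv by (auto simp: auction_inv_def distinct_map)
  have fin: "finite (A t)" for t by (simp add: A_def)
  have cS: "card (S t) = card (A t) + 1" for t
  proof -
    have "card ((\<lambda>e. snd (snd e)) ` A t) = card (A t)"
      by (rule card_image, rule inj_on_subset[OF d(2)]) (auto simp: A_def)
    moreover have "j0 \<notin> (\<lambda>e. snd (snd e)) ` A t" using j0 by (auto simp: A_def)
    ultimately show ?thesis using fin by (simp add: S_def)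
  qed
  have sub: "S t \<subseteq> set js" for t using inv j0 by (fastforce simp: S_def A_def auction_inv_def)
  have present: "s \<in> fst ` A t" if "t \<le> label st s" "1 \<le> t" for s t
  proof -
    have "s \<in> fst ` set st" using label_absent[of s st] that by force
    then obtain l j where e: "(s, l, j) \<in> set st" by force
    moreover have "label st s = l" using label_present[OF _ e] inv by (auto simp: auction_inv_def)
    ultimately show ?thesis using that by (force simp: A_def)
  qed
  have step: "card (S (t + 1)) < card (S t)" if t: "1 \<le> t" "t < h" for t
  proof -
    have "{s. \<exists>j\<in>S (t + 1). (j, s) \<in> set E} \<subseteq> fst ` A t"
    proof safe
      fix j s assume j: "j \<in> S (t + 1)" "(j, s) \<in> set E"
      show "s \<in> fst ` A t"
      proof (cases "j = j0")
        case True
        thus ?thesis using h[of s] j t by (intro present) auto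
      next
        case False
        then obtain s' l where e: "(s', l, j) \<in> set st" "t + 1 \<le> l" using j(1) by (auto simp: S_def A_def)
        hence "l \<le> label st s + 1" using inv j(2) by (fastforce simp: auction_inv_def)
        thus ?thesis using e t by (intro present) auto
      qed
    qed
    hence "card (S (t + 1)) \<le> card (fst ` A t)"
      using hall[OF sub] fin card_mono by (meson finite_imageI order_trans)
    also have "\<dots> \<le> card (A t)" by (rule card_image_le[OF fin])
    finally show ?thesis using cS[of t] by simp
  qed
  have "int k < h \<Longrightarrow> k + 1 \<le> card (S (h - int k))" for k
  proof (induction k)
    case (Suc k)
    have "h - int (Suc k) + 1 = h - int k" by simp
    thus ?case using Suc step[of "h - int (Suc k)"] by (simp add: algebra_simps)
  qed (simp add: cS)
  from this[of "card (set js)"] have "card (set js) + 1 \<le> card (S (h - int (card (set js))))" using big by simp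
  thus False using card_mono[OF _ sub, of "h - int (card (set js))"] by simp
qed

lemma auction_step_inv:
  assumes inv: "auction_inv st" and ex: "set js - (\<lambda>e. snd (snd e)) ` set st \<noteq> {}"
  shows "auction_inv (auction_step E js st)" "total_label (auction_step E js st) = total_label st + 1"
proof -
  have "filter (\<lambda>j. filter (\<lambda>e. snd (snd e) = j) st = []) js \<noteq> []"
    using ex by (force simp: filter_empty_conv)
  then obtain j r where j: "filter (\<lambda>j. filter (\<lambda>e. snd (snd e) = j) st = []) js = j # r"
    by (cases "filter (\<lambda>j. filter (\<lambda>e. snd (snd e) = j) st = []) js") auto
  from arg_cong[OF j, of set] have j': "j \<in> set js" "j \<notin> (\<lambda>e. snd (snd e)) ` set st"
    by (auto simp: filter_empty_conv set_eq_iff)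
  let ?nb = "map snd (filter (\<lambda>e. fst e = j) E)"
  have nb: "set ?nb = {s. (j, s) \<in> set E}" by force
  let ?mins = "filter (\<lambda>s. filter (\<lambda>s'. label st s' < label st s) ?nb = []) ?nb"
  have "card {j} \<le> card {s. (j, s) \<in> set E}" using hall[of "{j}"] j' by simp
  hence ne: "set ?nb \<noteq> {}" unfolding nb by (cases "{s. (j, s) \<in> set E} = {}") auto
  then obtain m where "m \<in> set ?nb" "\<forall>s'\<in>set ?nb. \<not> label st s' < label st m"
    using ex_is_arg_min_if_finite[of "set ?nb" "label st"] unfolding is_arg_min_def by blast
  hence "m \<in> set ?mins" by (auto simp: filter_empty_conv)
  then obtain s r' where s: "?mins = s # r'" by (cases ?mins) auto
  from arg_cong[OF s, of set] have "s \<in> set ?mins" by simp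
  hence "s \<in> set ?nb" "\<forall>s'\<in>set ?nb. \<not> label st s' < label st s" by (auto simp: filter_empty_conv)
  hence s': "(j, s) \<in> set E" "\<And>s'. (j, s') \<in> set E \<Longrightarrow> label st s \<le> label st s'"
    unfolding nb by auto
  let ?st = "(s, label st s + 1, j) # filter (\<lambda>e. fst e \<noteq> s) st"
  have step: "auction_step E js st = ?st"
    by (simp add: auction_step_def j s)
  show "total_label (auction_step E js st) = total_label st + 1"
    unfolding step using total_label_filter[of s st] by (simp add: total_label_def)
  \<comment> \<open>The label chosen is the minimum over all neighbours of an unassigned client,
    which Hall's condition bounds; raising it by 1 then respects the invariant.\<close>
  have le: "label st s \<le> int (card (set js))"
    by (rule min_label_le[OF inv j']) (rule s'(2))
  have lab0: "0 \<le> label st s"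
    unfolding label_def by (rule sum_list_nonneg) (use inv in \<open>fastforce simp: auction_inv_def\<close>)
  have mono: "label st s'' \<le> label ?st s''" for s'' by (simp add: label_update)
  have "distinct (map fst ?st)"
    using inv by (auto simp: auction_inv_def distinct_map_filter)
  moreover have "distinct (map (\<lambda>e. snd (snd e)) ?st)"
    using inv j'(2) by (auto simp: auction_inv_def distinct_map_filter)
  moreover have "j'' \<in> set js \<and> (j'', s'') \<in> set E \<and> 1 \<le> l \<and> l \<le> int (card (set js)) + 1 \<and>
      (\<forall>s'. (j'', s') \<in> set E \<longrightarrow> l \<le> label ?st s' + 1)" if "(s'', l, j'') \<in> set ?st" for s'' l j''
  proof (cases "(s'', l, j'') = (s, label st s + 1, j)")
    case True
    hence eq: "s'' = s" "l = label st s + 1" "j'' = j" by auto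
    have "label st s + 1 \<le> label ?st a + 1" if "(j, a) \<in> set E" for a
      using s'(2)[OF that] mono[of a] by linarith
    thus ?thesis unfolding eq using j' s'(1) le lab0 by simp
  next
    case False
    hence "(s'', l, j'') \<in> set st" using that by auto
    with inv have *: "j'' \<in> set js \<and> (j'', s'') \<in> set E \<and> 1 \<le> l \<and> l \<le> int (card (set js)) + 1"
      "\<And>a. (j'', a) \<in> set E \<Longrightarrow> l \<le> label st a + 1"
      by (auto simp: auction_inv_def)
    have "l \<le> label ?st a + 1" if "(j'', a) \<in> set E" for a
      using *(2)[OF that] mono[of a] by linarith
    thus ?thesis using *(1) by blast
  qed
  ultimately show "auction_inv (auction_step E js st)" unfolding step auction_inv_def by blast
qed

lemma auction_step_done:
  assumes "set js \<subseteq> (\<lambda>e. snd (snd e)) ` set st" shows "auction_step E js st = st"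
proof -
  have "filter (\<lambda>j. filter (\<lambda>e. snd (snd e) = j) st = []) js = []"
    using assms by (force simp: filter_empty_conv)
  thus ?thesis by (simp add: auction_step_def)
qed

lemma auction_progress:
  "auction_inv (auction E js fuel) \<and>
    (set js \<subseteq> (\<lambda>e. snd (snd e)) ` set (auction E js fuel) \<or> total_label (auction E js fuel) = int (length fuel))"
proof (induction fuel rule: rev_induct)
  case Nil
  show ?case by (simp add: auction_def auction_inv_def total_label_def)
next
  case (snoc u fuel)
  have eq: "auction E js (fuel @ [u]) = auction_step E js (auction E js fuel)" by (simp add: auction_def)
  show ?case
  proof (cases "set js \<subseteq> (\<lambda>e. snd (snd e)) ` set (auction E js fuel)")
    case True
    thus ?thesis using snoc unfolding eq by (simp add: auction_step_done)
  next
    case False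
    hence "set js - (\<lambda>e. snd (snd e)) ` set (auction E js fuel) \<noteq> {}" by blast
    thus ?thesis using snoc False auction_step_inv unfolding eq by fastforce
  qed
qed

text \<open>While some client is unassigned, every round raises the total label by 1. The total is
  bounded, as at most \<open>length E\<close> slots ever occur and no label exceeds the number of
  clients plus 1.\<close>

lemma auction_complete:
  assumes "length E * (length js + 1) < length fuel"
  shows "set js \<subseteq> (\<lambda>e. snd (snd e)) ` set (auction E js fuel)"
proof (rule ccontr)
  let ?st = "auction E js fuel"
  assume "\<not> ?thesis"
  hence total: "total_label ?st = int (length fuel)" and inv: "auction_inv ?st" using auction_progress[of fuel] by auto
  have "total_label ?st \<le> int (length ?st) * (int (card (set js)) + 1)"
  proof -
    have "\<And>e. e \<in> set ?st \<Longrightarrow> fst (snd e) \<le> int (card (set js)) + 1"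
      using inv by (fastforce simp: auction_inv_def)
    hence "sum_list (map (\<lambda>e. fst (snd e)) ?st) \<le> sum_list (map (\<lambda>_. int (card (set js)) + 1) ?st)"
      by (rule sum_list_mono)
    thus ?thesis by (simp add: total_label_def sum_list_triv)
  qed
  moreover have "length ?st \<le> length E"
  proof -
    have "length ?st = card (fst ` set ?st)"
      using inv distinct_card[of "map fst ?st"] by (auto simp: auction_inv_def)
    also have "\<dots> \<le> card (snd ` set E)"
      by (rule card_mono) (use inv in \<open>force simp: auction_inv_def\<close>)+
    also have "\<dots> \<le> length E" by (metis card_image_le card_length finite_set order_trans)
    finally show ?thesis .
  qed
  moreover have "int (card (set js)) + 1 \<le> int (length js + 1)" using card_length[of js] by simp
  ultimately have "total_label ?st \<le> int (length E) * int (length js + 1)"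
    by (smt (verit) mult_mono of_nat_0_le_iff of_nat_mono)
  thus False using assms total by (metis of_nat_mult of_nat_less_iff not_less)
qed

end

text \<open>Double counting: clients of \<open>S\<close> spend at least 1 each on their neighbours,
  and each neighbour absorbs at most 1.\<close>

lemma fractional_hall:
  fixes g :: "'j \<Rightarrow> 's \<Rightarrow> real"
  assumes "finite S" "finite E"
    and nonneg: "\<And>j s. (j, s) \<in> E \<Longrightarrow> 0 \<le> g j s"
    and cover: "\<And>j. j \<in> S \<Longrightarrow> 1 \<le> (\<Sum>s\<in>{s. (j, s) \<in> E}. g j s)"
    and pack: "\<And>s. (\<Sum>j\<in>{j \<in> S. (j, s) \<in> E}. g j s) \<le> 1"
  shows "card S \<le> card {s. \<exists>j\<in>S. (j, s) \<in> E}"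
proof -
  let ?N = "{s. \<exists>j\<in>S. (j, s) \<in> E}"
  have finN: "finite ?N" by (rule finite_subset[of _ "snd ` E"]) (use assms(2) in force)+
  have "real (card S) \<le> (\<Sum>j\<in>S. \<Sum>s\<in>{s. (j, s) \<in> E}. g j s)"
    using sum_mono[of S "\<lambda>_. 1" "\<lambda>j. \<Sum>s\<in>{s. (j, s) \<in> E}. g j s"] cover by simp
  also have "\<dots> = (\<Sum>j\<in>S. \<Sum>s\<in>?N. if (j, s) \<in> E then g j s else 0)"
    by (intro sum.cong refl sum.mono_neutral_cong_left finN) auto
  also have "\<dots> = (\<Sum>s\<in>?N. \<Sum>j\<in>S. if (j, s) \<in> E then g j s else 0)" by (rule sum.swap)
  also have "\<dots> = (\<Sum>s\<in>?N. \<Sum>j\<in>{j \<in> S. (j, s) \<in> E}. g j s)"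
    by (intro sum.cong refl sum.mono_neutral_cong_right assms(1)) auto
  also have "\<dots> \<le> real (card ?N)" using sum_mono[of ?N _ "\<lambda>_. 1", OF pack] by simp
  finally show ?thesis by simp
qed

section \<open>The rounding algorithm\<close>

(* a table entry is a key with a numerator and a denominator *)
type_synonym row = "(int \<times> int \<times> int) list"
type_synonym matrix = "(int \<times> row) list"
type_synonym inp = "int list \<times> int list \<times> matrix \<times> (int \<times> int) \<times> (int \<times> int) \<times> (matrix \<times> row) \<times> (int \<times> int) \<times> int"

definition facs :: "inp \<Rightarrow> int list" where "facs v = fst v"
definition clis :: "inp \<Rightarrow> int list" where "clis v = fst (snd v)"
definition dtab :: "inp \<Rightarrow> matrix" where "dtab v = fst (snd (snd v))"
definition rawT :: "inp \<Rightarrow> int \<times> int" where "rawT v = fst (snd (snd (snd v)))"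
definition xtab :: "inp \<Rightarrow> matrix" where "xtab v = fst (fst (snd (snd (snd (snd (snd v))))))"
definition ytab :: "inp \<Rightarrow> row" where "ytab v = snd (fst (snd (snd (snd (snd (snd v))))))"
definition raweps :: "inp \<Rightarrow> int \<times> int" where "raweps v = fst (snd (snd (snd (snd (snd (snd v))))))"

definition entries :: "matrix \<Rightarrow> row" where "entries t = concat (map snd t)"

(* a common denominator of all numbers of the input; every quantity below is an integer multiple of its inverse *)
definition scale :: "inp \<Rightarrow> int" where
  "scale v = prod_list (map (\<lambda>e. snd (snd e)) (entries (dtab v) @ entries (xtab v) @ ytab v)) * (snd (rawT v) * snd (raweps v))"

definition scaled :: "inp \<Rightarrow> int \<times> int \<Rightarrow> int" where
  "scaled v q = fst q * (scale v div snd q)"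

(* keys are unique, so the sum reads off a single value *)
definition look :: "inp \<Rightarrow> row \<Rightarrow> int \<Rightarrow> int" where
  "look v t k = sum_list (map (\<lambda>e. scaled v (snd e)) (filter (\<lambda>e. fst e = k) t))"

definition look2 :: "inp \<Rightarrow> matrix \<Rightarrow> int \<Rightarrow> int \<Rightarrow> int" where
  "look2 v t k l = look v (entries (filter (\<lambda>r. fst r = k) t)) l"

definition dval :: "inp \<Rightarrow> int \<Rightarrow> int \<Rightarrow> int" where "dval v p q = look2 v (dtab v) p q"
definition xval :: "inp \<Rightarrow> int \<Rightarrow> int \<Rightarrow> int" where "xval v i j = look2 v (xtab v) i j"
definition yval :: "inp \<Rightarrow> int \<Rightarrow> int" where "yval v i = look v (ytab v) i"
definition Tval :: "inp \<Rightarrow> int" where "Tval v = scaled v (rawT v)"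
definition eps :: "inp \<Rightarrow> int" where "eps v = scaled v (raweps v)"

definition large :: "inp \<Rightarrow> int \<Rightarrow> bool" where
  "large v i \<longleftrightarrow> eps v \<le> 16 * yval v i"

definition smalls :: "inp \<Rightarrow> int list" where
  "smalls v = filter (\<lambda>i. \<not> large v i) (facs v)"

definition served_large :: "inp \<Rightarrow> int \<Rightarrow> bool" where
  "served_large v j \<longleftrightarrow> 2 * sum_list (map (\<lambda>i. xval v i j) (smalls v)) \<le> eps v"

definition ball_mass :: "inp \<Rightarrow> int \<Rightarrow> int \<Rightarrow> int" where
  "ball_mass v i r = sum_list (map (\<lambda>a. yval v a) (filter (\<lambda>a. dval v i a \<le> r) (smalls v)))"

definition radii :: "inp \<Rightarrow> int \<Rightarrow> int list" where
  "radii v i = filter (\<lambda>r. eps v \<le> 4 * ball_mass v i r) (map (\<lambda>a. dval v i a) (smalls v))"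

definition min_of :: "int list \<Rightarrow> int" where
  "min_of xs = (case filter (\<lambda>r. filter (\<lambda>r'. r' < r) xs = []) xs of [] \<Rightarrow> 0 | r # _ \<Rightarrow> r)"

definition radius :: "inp \<Rightarrow> int \<Rightarrow> int" where
  "radius v i = min_of (radii v i)"

definition far :: "inp \<Rightarrow> int \<Rightarrow> int \<Rightarrow> bool" where
  "far v i j \<longleftrightarrow> Tval v < dval v i j + 4 * radius v i"

definition served_far :: "inp \<Rightarrow> int \<Rightarrow> bool" where
  "served_far v j \<longleftrightarrow> \<not> served_large v j \<and>
     eps v \<le> 4 * sum_list (map (\<lambda>i. xval v i j) (filter (\<lambda>i. far v i j) (smalls v)))"

definition served_near :: "inp \<Rightarrow> int \<Rightarrow> bool" where
  "served_near v j \<longleftrightarrow> \<not> served_large v j \<and> \<not> served_far v j"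

text \<open>Bounds the load caused at the new place when the near clients of \<open>i\<close> are
  moved there: the move costs at most four radii of \<open>i\<close> per unit, whatever facility of
  the cluster becomes the target.\<close>

definition move_cost :: "inp \<Rightarrow> int \<Rightarrow> int" where
  "move_cost v i = sum_list (map (\<lambda>j. xval v i j * (dval v i j + 4 * radius v i))
     (filter (\<lambda>j. served_near v j \<and> \<not> far v i j) (clis v)))"

definition uncovered :: "inp \<Rightarrow> int list \<Rightarrow> int list" where
  "uncovered v cs = filter (\<lambda>i. filter (\<lambda>c. dval v i c \<le> 2 * radius v i) cs = []) (smalls v)"

definition add_center :: "inp \<Rightarrow> int list \<Rightarrow> int list" where
  "add_center v cs = (case filter (\<lambda>i. filter (\<lambda>a. radius v a < radius v i) (uncovered v cs) = []) (uncovered v cs) of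
     [] \<Rightarrow> cs | i # _ \<Rightarrow> i # cs)"

text \<open>The list of facilities only counts rounds: each round covers at least one further small
  facility, or nothing is left to do.\<close>

definition centers :: "inp \<Rightarrow> int list" where
  "centers v = foldl (\<lambda>cs _. add_center v cs) [] (facs v)"

definition center :: "inp \<Rightarrow> int \<Rightarrow> int" where
  "center v i = (case filter (\<lambda>c. dval v i c \<le> 2 * radius v i \<and> radius v c \<le> radius v i) (centers v) of
     [] \<Rightarrow> 0 | c # _ \<Rightarrow> c)"

definition ranked :: "inp \<Rightarrow> int \<Rightarrow> int \<Rightarrow> bool" where
  "ranked v a b \<longleftrightarrow> radius v a < radius v b \<or> (radius v a = radius v b \<and> a \<le> b)"

text \<open>Running totals of moving costs along the ranking of a cluster, rounded down in units of
  an eighth of \<open>eps v * Tval v\<close>. As \<open>i\<close> itself is included in its total,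
  the difference of totals from the first facility of a group to its last does not contain the cost
  of the first, which may be arbitrarily large.\<close>

definition bucket :: "inp \<Rightarrow> int \<Rightarrow> int" where
  "bucket v i = 8 * sum_list (map (\<lambda>a. move_cost v a)
     (filter (\<lambda>a. center v a = center v i \<and> ranked v a i) (smalls v))) div (eps v * Tval v)"

(* A cluster is cut into groups along increasing radius, such that moving the clients of all but the first
  facility of a group costs at most half the load bound; they move to that first facility. *)
definition peers :: "inp \<Rightarrow> int \<Rightarrow> int list" where
  "peers v i = filter (\<lambda>a. center v a = center v i \<and> bucket v a = bucket v i) (smalls v)"

definition target :: "inp \<Rightarrow> int \<Rightarrow> int" where
  "target v i = (case filter (\<lambda>a. filter (\<lambda>b. \<not> ranked v a b) (peers v i) = []) (peers v i) of [] \<Rightarrow> 0 | a # _ \<Rightarrow> a)"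

text \<open>The fraction of client \<open>j\<close> at \<open>i\<close> is
  \<open>weight v i j\<close> over \<open>capacity v i\<close>. For large facilities this means
  dividing \<open>x\<close> by 1 - \<epsilon>/2, for small ones multiplying it by 4/\<epsilon>, both
  without leaving the integers.\<close>

definition capacity :: "inp \<Rightarrow> int \<Rightarrow> int" where
  "capacity v i = (if large v i then 2 * scale v - eps v else eps v)"

definition raw_weight :: "inp \<Rightarrow> int \<Rightarrow> int \<Rightarrow> int" where
  "raw_weight v i j = (if large v i then (if served_large v j then 2 * xval v i j else 0)
     else if served_far v j then (if far v i j then 4 * xval v i j else 0)
     else if served_near v j then 4 * sum_list (map (\<lambda>a. xval v a j) (filter (\<lambda>a. \<not> far v a j \<and> target v a = i) (smalls v)))
     else 0)"

text \<open>Rescaling may push a fraction above 1. Cutting it off at 1 loses no coverage, since the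
  client is then fully covered by this facility alone.\<close>

definition weight :: "inp \<Rightarrow> int \<Rightarrow> int \<Rightarrow> int" where
  "weight v i j = (if raw_weight v i j \<le> capacity v i then raw_weight v i j else capacity v i)"

definition fill :: "inp \<Rightarrow> int \<Rightarrow> int \<Rightarrow> int" where
  "fill v i j = sum_list (map (\<lambda>a. weight v i a)
     (filter (\<lambda>a. dval v i j < dval v i a \<or> (dval v i a = dval v i j \<and> a < j)) (clis v)))"

(* weights do not exceed the capacity, so the interval of a client meets at most two slots *)
definition slot_edges :: "inp \<Rightarrow> int \<Rightarrow> int \<Rightarrow> (int \<times> int \<times> int) list" where
  "slot_edges v i j = (if 0 < weight v i j
     then [(j, i, fill v i j div capacity v i), (j, i, (fill v i j + weight v i j - 1) div capacity v i)] else [])"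

definition edges :: "inp \<Rightarrow> (int \<times> int \<times> int) list" where
  "edges v = concat (map (\<lambda>i. concat (map (\<lambda>j. slot_edges v i j) (clis v))) (facs v))"

text \<open>A list of length \<open>(length (edges v) + 1) * (length (clis v) + 1)\<close>, just
  beyond the number of rounds after which the auction must have ended; the extra elements make the
  inequality strict.\<close>

definition fuel :: "inp \<Rightarrow> int list" where
  "fuel v = concat (map (\<lambda>_. 0 # clis v) ((0, 0, 0) # edges v))"

definition matching :: "inp \<Rightarrow> ((int \<times> int) \<times> int \<times> int) list" where
  "matching v = auction (edges v) (clis v) (fuel v)"

definition assigned :: "inp \<Rightarrow> int \<Rightarrow> int \<Rightarrow> bool" where
  "assigned v i j \<longleftrightarrow> filter (\<lambda>e. fst (fst e) = i \<and> snd (snd e) = j) (matching v) \<noteq> []"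

definition opened :: "inp \<Rightarrow> int \<Rightarrow> bool" where
  "opened v i \<longleftrightarrow> filter (\<lambda>e. fst (fst e) = i) (matching v) \<noteq> []"

definition zero_one :: "bool \<Rightarrow> int \<times> int" where
  "zero_one b = (if b then 1 else 0, 1)"

definition rounding :: "inp \<Rightarrow> matrix \<times> row" where
  "rounding v = (map (\<lambda>i. (i, map (\<lambda>j. (j, zero_one (assigned v i j))) (clis v))) (facs v),
     map (\<lambda>i. (i, zero_one (opened v i))) (facs v))"

subsection \<open>Polynomial running time\<close>

lemma polytime_eq_pair:
  "polytime f \<Longrightarrow> polytime g \<Longrightarrow> polytime (\<lambda>x. (f x :: int \<times> int) = g x)"
  unfolding prod_eq_iff by (intro polytime_intros)

lemma polytime_components:
  assumes "polytime f"
  shows "polytime (\<lambda>x. facs (f x))" "polytime (\<lambda>x. clis (f x))" "polytime (\<lambda>x. dtab (f x))"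
    "polytime (\<lambda>x. rawT (f x))" "polytime (\<lambda>x. xtab (f x))" "polytime (\<lambda>x. ytab (f x))" "polytime (\<lambda>x. raweps (f x))"
  unfolding facs_def clis_def dtab_def rawT_def xtab_def ytab_def raweps_def
  by (intro polytime_intros assms)+

lemma polytime_entries: "polytime t \<Longrightarrow> polytime (\<lambda>x. entries (t x))"
  by (rule polytime_comp[where f = entries]) (unfold entries_def, intro polytime_intros)

lemma polytime_scale: "polytime f \<Longrightarrow> polytime (\<lambda>x. scale (f x))"
  by (rule polytime_comp[where f = scale])
    (unfold scale_def, intro polytime_intros polytime_components polytime_entries)

lemma polytime_scaled: "polytime f \<Longrightarrow> polytime g \<Longrightarrow> polytime (\<lambda>x. scaled (f x) (g x))"
  by (rule polytime_comp2[where h = scaled])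
    (unfold scaled_def, intro polytime_intros polytime_scale)

lemma polytime_comp3:
  assumes "polytime (\<lambda>p. h (fst p) (fst (snd p)) (snd (snd p)))" "polytime f" "polytime g" "polytime k"
  shows "polytime (\<lambda>x. h (f x) (g x) (k x))"
  using polytime_comp[OF assms(1) polytime_Pair[OF assms(2) polytime_Pair[OF assms(3,4)]]] by (simp only: fst_conv snd_conv)

lemma polytime_comp4:
  assumes "polytime (\<lambda>p. h (fst p) (fst (snd p)) (fst (snd (snd p))) (snd (snd (snd p))))"
    "polytime f" "polytime g" "polytime k" "polytime l"
  shows "polytime (\<lambda>x. h (f x) (g x) (k x) (l x))"
  using polytime_comp[OF assms(1) polytime_Pair[OF assms(2) polytime_Pair[OF assms(3) polytime_Pair[OF assms(4,5)]]]]
  by (simp only: fst_conv snd_conv)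

text \<open>One rule per function of the algorithm, stated with composed arguments so that backward
  chaining can descend through a definition, even below binders whose variables have become
  projections of a pair.\<close>

named_theorems polytime_consts

lemmas [polytime_consts] = polytime_components polytime_entries polytime_scale polytime_scaled

lemma polytime_look [polytime_consts]:
  "polytime f \<Longrightarrow> polytime g \<Longrightarrow> polytime h \<Longrightarrow> polytime (\<lambda>x. look (f x) (g x) (h x))"
  by (rule polytime_comp3[where h = look])
    (unfold look_def, intro polytime_intros polytime_consts)

lemma polytime_look2 [polytime_consts]:
  "polytime f \<Longrightarrow> polytime g \<Longrightarrow> polytime h \<Longrightarrow> polytime k \<Longrightarrow> polytime (\<lambda>x. look2 (f x) (g x) (h x) (k x))"
  by (rule polytime_comp4[where h = look2])
    (unfold look2_def, intro polytime_intros polytime_consts)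

lemma polytime_dval [polytime_consts]:
  "polytime f \<Longrightarrow> polytime g \<Longrightarrow> polytime h \<Longrightarrow> polytime (\<lambda>x. dval (f x) (g x) (h x))"
  by (rule polytime_comp3[where h = dval])
    (unfold dval_def, intro polytime_intros polytime_consts)

lemma polytime_xval [polytime_consts]:
  "polytime f \<Longrightarrow> polytime g \<Longrightarrow> polytime h \<Longrightarrow> polytime (\<lambda>x. xval (f x) (g x) (h x))"
  by (rule polytime_comp3[where h = xval])
    (unfold xval_def, intro polytime_intros polytime_consts)

lemma polytime_yval [polytime_consts]:
  "polytime f \<Longrightarrow> polytime g \<Longrightarrow> polytime (\<lambda>x. yval (f x) (g x))"
  by (rule polytime_comp2[where h = yval])
    (unfold yval_def, intro polytime_intros polytime_consts)

lemma polytime_Tval [polytime_consts]: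
  "polytime f \<Longrightarrow> polytime (\<lambda>x. Tval (f x))"
  by (rule polytime_comp[where f = Tval])
    (unfold Tval_def, intro polytime_intros polytime_consts)

lemma polytime_eps [polytime_consts]:
  "polytime f \<Longrightarrow> polytime (\<lambda>x. eps (f x))"
  by (rule polytime_comp[where f = eps])
    (unfold eps_def, intro polytime_intros polytime_consts)

lemma polytime_large [polytime_consts]:
  "polytime f \<Longrightarrow> polytime g \<Longrightarrow> polytime (\<lambda>x. large (f x) (g x))"
  by (rule polytime_comp2[where h = large])
    (unfold large_def, intro polytime_intros polytime_consts)

lemma polytime_smalls [polytime_consts]:
  "polytime f \<Longrightarrow> polytime (\<lambda>x. smalls (f x))"
  by (rule polytime_comp[where f = smalls])
    (unfold smalls_def, intro polytime_intros polytime_consts)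

lemma polytime_served_large [polytime_consts]:
  "polytime f \<Longrightarrow> polytime g \<Longrightarrow> polytime (\<lambda>x. served_large (f x) (g x))"
  by (rule polytime_comp2[where h = served_large])
    (unfold served_large_def, intro polytime_intros polytime_consts)

lemma polytime_ball_mass [polytime_consts]:
  "polytime f \<Longrightarrow> polytime g \<Longrightarrow> polytime h \<Longrightarrow> polytime (\<lambda>x. ball_mass (f x) (g x) (h x))"
  by (rule polytime_comp3[where h = ball_mass])
    (unfold ball_mass_def, intro polytime_intros polytime_consts)

lemma polytime_radii [polytime_consts]:
  "polytime f \<Longrightarrow> polytime g \<Longrightarrow> polytime (\<lambda>x. radii (f x) (g x))"
  by (rule polytime_comp2[where h = radii])
    (unfold radii_def, intro polytime_intros polytime_consts)

lemma polytime_min_of [polytime_consts]: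
  "polytime f \<Longrightarrow> polytime (\<lambda>x. min_of (f x))"
  by (rule polytime_comp[where f = min_of])
    (unfold min_of_def, intro polytime_intros polytime_consts)

lemma polytime_radius [polytime_consts]:
  "polytime f \<Longrightarrow> polytime g \<Longrightarrow> polytime (\<lambda>x. radius (f x) (g x))"
  by (rule polytime_comp2[where h = radius])
    (unfold radius_def, intro polytime_intros polytime_consts)

lemma polytime_far [polytime_consts]:
  "polytime f \<Longrightarrow> polytime g \<Longrightarrow> polytime h \<Longrightarrow> polytime (\<lambda>x. far (f x) (g x) (h x))"
  by (rule polytime_comp3[where h = far])
    (unfold far_def, intro polytime_intros polytime_consts)

lemma polytime_served_far [polytime_consts]:
  "polytime f \<Longrightarrow> polytime g \<Longrightarrow> polytime (\<lambda>x. served_far (f x) (g x))"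
  by (rule polytime_comp2[where h = served_far])
    (unfold served_far_def, intro polytime_intros polytime_consts)

lemma polytime_served_near [polytime_consts]:
  "polytime f \<Longrightarrow> polytime g \<Longrightarrow> polytime (\<lambda>x. served_near (f x) (g x))"
  by (rule polytime_comp2[where h = served_near])
    (unfold served_near_def, intro polytime_intros polytime_consts)

lemma polytime_move_cost [polytime_consts]:
  "polytime f \<Longrightarrow> polytime g \<Longrightarrow> polytime (\<lambda>x. move_cost (f x) (g x))"
  by (rule polytime_comp2[where h = move_cost])
    (unfold move_cost_def, intro polytime_intros polytime_consts)

lemma polytime_uncovered [polytime_consts]:
  "polytime f \<Longrightarrow> polytime g \<Longrightarrow> polytime (\<lambda>x. uncovered (f x) (g x))"
  by (rule polytime_comp2[where h = uncovered])
    (unfold uncovered_def, intro polytime_intros polytime_consts)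

lemma polytime_add_center [polytime_consts]:
  "polytime f \<Longrightarrow> polytime g \<Longrightarrow> polytime (\<lambda>x. add_center (f x) (g x))"
  by (rule polytime_comp2[where h = add_center])
    (unfold add_center_def, intro polytime_intros polytime_consts)

lemma polytime_centers [polytime_consts]:
  assumes "polytime f" shows "polytime (\<lambda>x. centers (f x))"
proof (rule polytime_comp[where f = centers, OF _ assms], unfold centers_def)
  let ?B = "\<lambda>v. 1 + esize (facs v) * Suc (esize (facs v))"
  show "polytime (\<lambda>v. foldl (\<lambda>cs _. add_center v cs) [] (facs v))"
  proof (rule polytime_foldl[where g = "\<lambda>v cs _. add_center v cs" and B = ?B])
    show "polytime (\<lambda>p :: inp \<times> int list \<times> int. add_center (fst p) (fst (snd p)))"
      by (intro polytime_intros polytime_consts)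
    show "poly_bounded ?B"
      by (intro poly_bounded_add poly_bounded_mult poly_bounded_Suc poly_bounded_const polytime_bounded polytime_consts polytime_id)
    fix v n assume n: "n \<le> length (facs v)"
    \<comment> \<open>The size bound has to hold for arbitrary input: entries come from the list of
      facilities and at most one is added per round.\<close>
    have step: "set (add_center v cs) \<subseteq> set (facs v) \<and> length (add_center v cs) \<le> length cs + 1"
      if "set cs \<subseteq> set (facs v)" for cs
    proof (cases "filter (\<lambda>i. filter (\<lambda>a. radius v a < radius v i) (uncovered v cs) = []) (uncovered v cs)")
      case (Cons i r)
      from arg_cong[OF this, of set] have "i \<in> set (facs v)" by (auto simp: uncovered_def smalls_def)
      thus ?thesis using that Cons by (simp add: add_center_def)
    qed (use that in \<open>simp add: add_center_def\<close>)
    have "set (foldl (\<lambda>cs _. add_center v cs) [] as) \<subseteq> set (facs v)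
        \<and> length (foldl (\<lambda>cs _. add_center v cs) [] as) \<le> length as" for as :: "int list"
      by (induction as rule: rev_induct) (use step in \<open>auto intro: order_trans\<close>)
    from this[of "take n (facs v)"] n
    have "set (foldl (\<lambda>cs _. add_center v cs) [] (take n (facs v))) \<subseteq> set (facs v)"
      "length (foldl (\<lambda>cs _. add_center v cs) [] (take n (facs v))) \<le> esize (facs v)"
      using length_le_esize[of "facs v"] by auto
    thus "esize (foldl (\<lambda>cs _. add_center v cs) [] (take n (facs v))) \<le> ?B v"
      by (intro esize_list_le) (auto intro: esize_mem)
  qed (intro polytime_intros polytime_consts)+
qed

lemma polytime_center [polytime_consts]:
  "polytime f \<Longrightarrow> polytime g \<Longrightarrow> polytime (\<lambda>x. center (f x) (g x))"
  by (rule polytime_comp2[where h = center])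
    (unfold center_def, intro polytime_intros polytime_consts)

lemma polytime_ranked [polytime_consts]:
  "polytime f \<Longrightarrow> polytime g \<Longrightarrow> polytime h \<Longrightarrow> polytime (\<lambda>x. ranked (f x) (g x) (h x))"
  by (rule polytime_comp3[where h = ranked])
    (unfold ranked_def, intro polytime_intros polytime_consts)

lemma polytime_bucket [polytime_consts]:
  "polytime f \<Longrightarrow> polytime g \<Longrightarrow> polytime (\<lambda>x. bucket (f x) (g x))"
  by (rule polytime_comp2[where h = bucket])
    (unfold bucket_def, intro polytime_intros polytime_consts)

lemma polytime_peers [polytime_consts]:
  "polytime f \<Longrightarrow> polytime g \<Longrightarrow> polytime (\<lambda>x. peers (f x) (g x))"
  by (rule polytime_comp2[where h = peers])
    (unfold peers_def, intro polytime_intros polytime_consts)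

lemma polytime_target [polytime_consts]:
  "polytime f \<Longrightarrow> polytime g \<Longrightarrow> polytime (\<lambda>x. target (f x) (g x))"
  by (rule polytime_comp2[where h = target])
    (unfold target_def, intro polytime_intros polytime_consts)

lemma polytime_capacity [polytime_consts]:
  "polytime f \<Longrightarrow> polytime g \<Longrightarrow> polytime (\<lambda>x. capacity (f x) (g x))"
  by (rule polytime_comp2[where h = capacity])
    (unfold capacity_def, intro polytime_intros polytime_consts)

lemma polytime_raw_weight [polytime_consts]:
  "polytime f \<Longrightarrow> polytime g \<Longrightarrow> polytime h \<Longrightarrow> polytime (\<lambda>x. raw_weight (f x) (g x) (h x))"
  by (rule polytime_comp3[where h = raw_weight])
    (unfold raw_weight_def, intro polytime_intros polytime_consts)

lemma polytime_weight [polytime_consts]: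
  "polytime f \<Longrightarrow> polytime g \<Longrightarrow> polytime h \<Longrightarrow> polytime (\<lambda>x. weight (f x) (g x) (h x))"
  by (rule polytime_comp3[where h = weight])
    (unfold weight_def, intro polytime_intros polytime_consts)

lemma polytime_fill [polytime_consts]:
  "polytime f \<Longrightarrow> polytime g \<Longrightarrow> polytime h \<Longrightarrow> polytime (\<lambda>x. fill (f x) (g x) (h x))"
  by (rule polytime_comp3[where h = fill])
    (unfold fill_def, intro polytime_intros polytime_consts)

lemma polytime_slot_edges [polytime_consts]:
  "polytime f \<Longrightarrow> polytime g \<Longrightarrow> polytime h \<Longrightarrow> polytime (\<lambda>x. slot_edges (f x) (g x) (h x))"
  by (rule polytime_comp3[where h = slot_edges])
    (unfold slot_edges_def, intro polytime_intros polytime_consts)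

lemma polytime_edges [polytime_consts]:
  "polytime f \<Longrightarrow> polytime (\<lambda>x. edges (f x))"
  by (rule polytime_comp[where f = edges])
    (unfold edges_def, intro polytime_intros polytime_consts)

lemma polytime_fuel [polytime_consts]:
  "polytime f \<Longrightarrow> polytime (\<lambda>x. fuel (f x))"
  by (rule polytime_comp[where f = fuel])
    (unfold fuel_def, intro polytime_intros polytime_consts)

text \<open>Polynomial size of the state must not depend on Hall's condition, which may fail on
  infeasible input. Here labels are bounded by the number of rounds instead, which is enough because
  that number is the length of a list already built.\<close>

lemma auction_step_bounds:
  assumes "distinct (map fst st)"
    "\<forall>(s, l, j) \<in> set st. s \<in> snd ` set E \<and> 0 \<le> l \<and> l \<le> k \<and> j \<in> set js" and "0 \<le> k"
  shows "distinct (map fst (auction_step E js st)) \<and> length (auction_step E js st) \<le> length st + 1 \<and>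
    (\<forall>(s, l, j) \<in> set (auction_step E js st). s \<in> snd ` set E \<and> 0 \<le> l \<and> l \<le> k + 1 \<and> j \<in> set js)"
proof -
  have stay: ?thesis if "auction_step E js st = st" using assms unfolding that by fastforce
  show ?thesis
  proof (cases "filter (\<lambda>j. filter (\<lambda>e. snd (snd e) = j) st = []) js")
    case Nil
    thus ?thesis by (intro stay) (simp add: auction_step_def)
  next
    case (Cons j r)
    from arg_cong[OF Cons, of set] have j: "j \<in> set js" by auto
    let ?nb = "map snd (filter (\<lambda>e. fst e = j) E)"
    show ?thesis
    proof (cases "filter (\<lambda>s. filter (\<lambda>s'. label st s' < label st s) ?nb = []) ?nb")
      case Nil
      thus ?thesis by (intro stay) (simp add: auction_step_def Cons)
    next
      case (Cons s r')
      from arg_cong[OF Cons, of set] have "s \<in> set ?nb" by (auto simp del: set_map)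
      hence s: "s \<in> snd ` set E" by auto
      have eq: "auction_step E js st = (s, label st s + 1, j) # filter (\<lambda>e. fst e \<noteq> s) st"
        by (simp add: auction_step_def Cons \<open>filter (\<lambda>j. filter (\<lambda>e. snd (snd e) = j) st = []) js = j # r\<close>)
      have "0 \<le> label st s \<and> label st s \<le> k"
      proof (cases "s \<in> fst ` set st")
        case True
        then obtain l j where e: "(s, l, j) \<in> set st" by force
        show ?thesis using label_present[OF assms(1) e] e assms(2) by auto
      qed (use assms(3) in \<open>simp add: label_absent\<close>)
      thus ?thesis using assms s j unfolding eq by (auto simp: distinct_map_filter intro: le_SucI)
    qed
  qed
qed

lemma polytime_label:
  "polytime f \<Longrightarrow> polytime g \<Longrightarrow> polytime (\<lambda>x. label (f x :: ((int \<times> int) \<times> int \<times> int) list) (g x))"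
  by (rule polytime_comp2[where h = label]) (unfold label_def, intro polytime_intros polytime_eq_pair)

lemma polytime_auction_step:
  assumes "polytime f" "polytime g" "polytime h"
  shows "polytime (\<lambda>x. auction_step (f x :: (int \<times> int \<times> int) list) (g x) (h x))"
  by (rule polytime_comp3[where h = auction_step, OF _ assms])
    (unfold auction_step_def, intro polytime_intros polytime_eq_pair polytime_label)

lemma polytime_auction:
  fixes E :: "'a::encodable \<Rightarrow> (int \<times> int \<times> int) list" and js :: "'a \<Rightarrow> int list" and us :: "'a \<Rightarrow> int list"
  assumes "polytime E" "polytime js" "polytime us"
  shows "polytime (\<lambda>x. auction (E x) (js x) (us x))"
proof (unfold auction_def, rule polytime_foldl[where g = "\<lambda>x st _. auction_step (E x) (js x) st"])
  let ?B = "\<lambda>x. 1 + esize (us x) * Suc (3 + esize (E x) + esize (us x) + esize (js x))"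
  show "polytime (\<lambda>p :: 'a \<times> ((int \<times> int) \<times> int \<times> int) list \<times> int. auction_step (E (fst p)) (js (fst p)) (fst (snd p)))"
    by (intro polytime_auction_step polytime_comp[OF assms(1)] polytime_comp[OF assms(2)] polytime_intros)
  show "poly_bounded ?B"
    by (intro poly_bounded_add poly_bounded_mult poly_bounded_Suc poly_bounded_const polytime_bounded assms)
  fix x n
  let ?st = "\<lambda>as :: int list. foldl (\<lambda>st _. auction_step (E x) (js x) st) [] as"
  have inv: "distinct (map fst (?st as)) \<and> length (?st as) \<le> length as \<and>
    (\<forall>(s, l, j) \<in> set (?st as). s \<in> snd ` set (E x) \<and> 0 \<le> l \<and> l \<le> int (length as) \<and> j \<in> set (js x))" for as
  proof (induction as rule: rev_induct)
    case (snoc a as)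
    thus ?case using auction_step_bounds[of "?st as" "E x" "int (length as)" "js x"] by (auto simp: add.commute)
  qed simp
  let ?as = "take n (us x)"
  have len: "length ?as \<le> esize (us x)" using length_le_esize[of "us x"] by simp
  show "esize (?st ?as) \<le> ?B x"
  proof (rule esize_list_le)
    show "length (?st ?as) \<le> esize (us x)" using inv[of ?as] len by linarith
    fix e assume e: "e \<in> set (?st ?as)"
    obtain s l j where [simp]: "e = (s, l, j)" by (cases e)
    from inv[of ?as] e have *: "s \<in> snd ` set (E x)" "0 \<le> l" "l \<le> int (length ?as)" "j \<in> set (js x)" by auto
    from *(1) obtain i where "(i, s) \<in> set (E x)" by force
    hence "Suc (esize i + esize s) \<le> esize (E x)" using esize_mem[of "(i, s)" "E x"] by (simp add: esize_Pair)
    moreover have "esize l \<le> 1 + esize (us x)" using vsize_VInt_le[of l] *(2,3) len by (simp add: enc_int_def)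
    moreover have "esize j \<le> esize (js x)" by (rule esize_mem[OF *(4)])
    ultimately show "esize e \<le> 3 + esize (E x) + esize (us x) + esize (js x)" by (simp add: esize_Pair)
  qed
qed (intro assms polytime_intros)+

lemma polytime_matching [polytime_consts]: "polytime f \<Longrightarrow> polytime (\<lambda>x. matching (f x))"
  by (rule polytime_comp[where f = matching])
    (unfold matching_def, intro polytime_auction polytime_intros polytime_consts)

lemma polytime_assigned [polytime_consts]:
  "polytime f \<Longrightarrow> polytime g \<Longrightarrow> polytime h \<Longrightarrow> polytime (\<lambda>x. assigned (f x) (g x) (h x))"
  by (rule polytime_comp3[where h = assigned])
    (unfold assigned_def, intro polytime_intros polytime_consts)

lemma polytime_opened [polytime_consts]:
  "polytime f \<Longrightarrow> polytime g \<Longrightarrow> polytime (\<lambda>x. opened (f x) (g x))"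
  by (rule polytime_comp2[where h = opened])
    (unfold opened_def, intro polytime_intros polytime_consts)

lemma polytime_zero_one [polytime_consts]:
  "polytime f \<Longrightarrow> polytime (\<lambda>x. zero_one (f x))"
  by (rule polytime_comp[where f = zero_one])
    (unfold zero_one_def, intro polytime_intros polytime_consts)

lemma polytime_rounding: "polytime rounding"
  by (unfold rounding_def, intro polytime_intros polytime_consts)

section \<open>Correctness of the rounding\<close>

lemma case_filter:
  assumes "\<exists>a\<in>set xs. P a"
  shows "(case filter P xs of [] \<Rightarrow> z | a # _ \<Rightarrow> a) \<in> set xs \<and> P (case filter P xs of [] \<Rightarrow> z | a # _ \<Rightarrow> a)"
proof (cases "filter P xs")
  case Nil
  thus ?thesis using assms by (auto simp: filter_empty_conv)
next
  case (Cons a r)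
  hence "a \<in> set xs \<and> P a" by (metis Cons_eq_filterD in_set_conv_decomp)
  thus ?thesis by (simp add: Cons)
qed

lemma min_of: 
  assumes "xs \<noteq> []" shows "min_of xs \<in> set xs" "r \<in> set xs \<Longrightarrow> min_of xs \<le> r"
proof -
  have "Min (set xs) \<in> set xs" "\<forall>r'\<in>set xs. \<not> r' < Min (set xs)" using assms by (auto simp: not_less)
  hence "\<exists>r\<in>set xs. filter (\<lambda>r'. r' < r) xs = []" by (auto simp: filter_empty_conv)
  from case_filter[OF this, of 0] show "min_of xs \<in> set xs" "r \<in> set xs \<Longrightarrow> min_of xs \<le> r"
    unfolding min_of_def[symmetric] by (auto simp: filter_empty_conv not_less)
qed

text \<open>The LP constraints multiplied by the common denominator \<open>scale v\<close>, which
  thus stands for 1; the load constraint, a product of two quantities, is multiplied by its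
  square.\<close>

locale scaled_lp =
  fixes v :: inp
  assumes distinct: "distinct (facs v)" "distinct (clis v)"
    and eps_pos: "0 < eps v" and eps_less: "eps v < scale v" and T_pos: "0 < Tval v"
    and d_nonneg: "p \<in> set (facs v) \<union> set (clis v) \<Longrightarrow> q \<in> set (facs v) \<union> set (clis v) \<Longrightarrow> 0 \<le> dval v p q"
    and d_refl: "p \<in> set (facs v) \<union> set (clis v) \<Longrightarrow> dval v p p = 0"
    and d_sym: "p \<in> set (facs v) \<union> set (clis v) \<Longrightarrow> q \<in> set (facs v) \<union> set (clis v) \<Longrightarrow> dval v p q = dval v q p"
    and d_triangle: "p \<in> set (facs v) \<union> set (clis v) \<Longrightarrow> q \<in> set (facs v) \<union> set (clis v) \<Longrightarrow>
      r \<in> set (facs v) \<union> set (clis v) \<Longrightarrow> dval v p r \<le> dval v p q + dval v q r"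
    and x_nonneg: "i \<in> set (facs v) \<Longrightarrow> j \<in> set (clis v) \<Longrightarrow> 0 \<le> xval v i j"
    and x_le_y: "i \<in> set (facs v) \<Longrightarrow> j \<in> set (clis v) \<Longrightarrow> xval v i j \<le> yval v i"
    and y_nonneg: "i \<in> set (facs v) \<Longrightarrow> 0 \<le> yval v i"
    and y_le: "i \<in> set (facs v) \<Longrightarrow> yval v i \<le> scale v"
    and x_sum: "j \<in> set (clis v) \<Longrightarrow> (\<Sum>i\<in>set (facs v). xval v i j) = scale v"
    and x_load: "i \<in> set (facs v) \<Longrightarrow> (\<Sum>j\<in>set (clis v). dval v i j * xval v i j) \<le> Tval v * yval v i"
    and x_support: "i \<in> set (facs v) \<Longrightarrow> j \<in> set (clis v) \<Longrightarrow> Tval v < dval v i j \<Longrightarrow> xval v i j = 0"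
begin

abbreviation F where "F \<equiv> set (facs v)"
abbreviation C where "C \<equiv> set (clis v)"
abbreviation M where "M \<equiv> scale v"
abbreviation e where "e \<equiv> eps v"
abbreviation T where "T \<equiv> Tval v"
abbreviation d where "d \<equiv> dval v"
abbreviation x where "x \<equiv> xval v"
abbreviation y where "y \<equiv> yval v"
abbreviation \<rho> where "\<rho> \<equiv> radius v"
abbreviation S where "S \<equiv> set (smalls v)"

definition Y :: int where "Y = (\<Sum>i\<in>F. y i)"
definition mass :: "int \<Rightarrow> int" where "mass j = (\<Sum>i\<in>S. x i j)"
definition cost :: "int \<Rightarrow> int" where "cost j = (\<Sum>i\<in>S. x i j * d i j)"

lemma S_eq: "S = {i \<in> F. \<not> large v i}" by (auto simp: smalls_def)

lemma S_F: "i \<in> S \<Longrightarrow> i \<in> F" by (simp add: S_eq)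

lemma distinct_smalls: "distinct (smalls v)" using distinct by (simp add: smalls_def)

lemma sum_smalls: "sum_list (map f (filter P (smalls v))) = (\<Sum>i\<in>{i \<in> S. P i}. (f i :: int))"
  using distinct_smalls by (simp add: sum_list_distinct_conv_sum_set)

lemma sum_smalls_all: "sum_list (map f (smalls v)) = (\<Sum>i\<in>S. (f i :: int))"
  using distinct_smalls by (simp add: sum_list_distinct_conv_sum_set)

lemma sum_clis: "sum_list (map f (filter P (clis v))) = (\<Sum>i\<in>{i \<in> C. P i}. (f i :: int))"
  using distinct by (simp add: sum_list_distinct_conv_sum_set)

lemma served_large_iff: "served_large v j \<longleftrightarrow> 2 * mass j \<le> e"
  by (simp add: served_large_def mass_def sum_smalls_all)

lemma ball_mass_eq: "ball_mass v i r = (\<Sum>a\<in>{a \<in> S. d i a \<le> r}. y a)"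
  by (simp add: ball_mass_def sum_smalls)

lemma Y_nonneg: "0 \<le> Y" unfolding Y_def by (rule sum_nonneg) (rule y_nonneg)

lemma sum_S_le_Y: "A \<subseteq> F \<Longrightarrow> (\<Sum>a\<in>A. y a) \<le> Y"
  unfolding Y_def by (rule sum_mono2) (auto intro: y_nonneg)

lemma cost_nonneg: "j \<in> C \<Longrightarrow> 0 \<le> cost j"
  unfolding cost_def by (intro sum_nonneg mult_nonneg_nonneg x_nonneg d_nonneg) (auto dest: S_F)

lemma mass_le: "j \<in> C \<Longrightarrow> mass j \<le> (\<Sum>a\<in>S. y a)"
  unfolding mass_def by (intro sum_mono x_le_y) (auto dest: S_F)

section \<open>Radii of small facilities against connection costs\<close>

lemma radius_nonneg: "i \<in> S \<Longrightarrow> 0 \<le> \<rho> i"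
proof (cases "radii v i = []")
  case True thus ?thesis by (simp add: radius_def min_of_def)
next
  case False
  assume i: "i \<in> S"
  from min_of(1)[OF False] have "\<rho> i \<in> d i ` S" by (auto simp: radius_def radii_def)
  thus ?thesis using i d_nonneg by (auto dest!: S_F)
qed

(* If every client is served by large facilities, the radii are junk, but then they do not matter. *)
lemma radii_nonempty:
  assumes "j \<in> C" "\<not> served_large v j" "i \<in> S" shows "radii v i \<noteq> []"
proof -
  have big: "e < 4 * (\<Sum>a\<in>S. y a)"
    using mass_le[OF assms(1)] assms(2) eps_pos by (simp add: served_large_iff)
  let ?r = "Max (d i ` S)"
  have "?r \<in> d i ` S" using assms(3) by (intro Max_in) auto
  moreover have "{a \<in> S. d i a \<le> ?r} = S" by auto
  ultimately have "?r \<in> set (radii v i)" using big by (auto simp: radii_def ball_mass_eq)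
  thus ?thesis by force
qed

lemma radius_ball:
  assumes "j \<in> C" "\<not> served_large v j" "i \<in> S" shows "e \<le> 4 * (\<Sum>a\<in>{a \<in> S. d i a \<le> \<rho> i}. y a)"
proof -
  have "\<rho> i \<in> set (radii v i)" using min_of(1)[OF radii_nonempty[OF assms]] by (simp add: radius_def)
  thus ?thesis by (simp add: radii_def ball_mass_eq)
qed

text \<open>The mass of the open ball is attained at its largest occurring distance, a candidate
  smaller than the minimal radius, which therefore failed the test.\<close>

lemma radius_inner:
  assumes "j \<in> C" "\<not> served_large v j" "i \<in> S" shows "4 * (\<Sum>a\<in>{a \<in> S. d i a < \<rho> i}. y a) < e"
proof (cases "{a \<in> S. d i a < \<rho> i} = {}")
  case True
  show ?thesis unfolding True using eps_pos by simp
next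
  case False
  let ?B = "{a \<in> S. d i a < \<rho> i}" and ?r = "Max (d i ` {a \<in> S. d i a < \<rho> i})"
  have r: "?r \<in> d i ` ?B" using False by (intro Max_in) auto
  hence less: "?r < \<rho> i" by auto
  have "d i a \<le> ?r" if "a \<in> ?B" for a using that by (intro Max_ge) auto
  hence "{a \<in> S. d i a \<le> ?r} = ?B" using less by fastforce
  moreover have "?r \<notin> set (radii v i)"
    using min_of(2)[OF radii_nonempty[OF assms], of ?r] less by (auto simp: radius_def[symmetric])
  ultimately show ?thesis using r by (auto simp: radii_def ball_mass_eq)
qed

text \<open>At least half of the small assignment of \<open>j\<close> lies outside the open ball of
  \<open>i\<close>. Each such facility is at distance at least the radius minus \<open>d i j\<close>
  from \<open>j\<close>, so this half already costs that much per unit.\<close>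

lemma mass_radius_le:
  assumes j: "j \<in> C" "\<not> served_large v j" and i: "i \<in> S"
  shows "mass j * \<rho> i \<le> mass j * d i j + 2 * cost j"
proof -
  let ?N = "{a \<in> S. d i a < \<rho> i}" and ?R = "{a \<in> S. \<not> d i a < \<rho> i}"
  have split: "mass j = (\<Sum>a\<in>?N. x a j) + (\<Sum>a\<in>?R. x a j)"
    unfolding mass_def by (subst sum.union_disjoint[symmetric]) (auto intro: sum.cong)
  have "(\<Sum>a\<in>?N. x a j) \<le> (\<Sum>a\<in>?N. y a)"
    by (intro sum_mono x_le_y j) (auto dest: S_F)
  \<comment> \<open>The open ball carries less than a quarter of \<open>e\<close>, while
    \<open>mass j\<close> exceeds half of \<open>e\<close>.\<close>
  hence half: "mass j \<le> 2 * (\<Sum>a\<in>?R. x a j)"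
    using radius_inner[OF j i] j(2) split by (simp add: served_large_iff)
  have mass_pos: "0 \<le> mass j" using j(2) eps_pos by (simp add: served_large_iff)
  show ?thesis
  proof (cases "d i j \<le> \<rho> i")
    case True
    have "(\<Sum>a\<in>?R. x a j * (\<rho> i - d i j)) \<le> (\<Sum>a\<in>?R. x a j * d a j)"
    proof (intro sum_mono mult_left_mono)
      fix a assume a: "a \<in> ?R"
      have "d i a \<le> d i j + d j a" "d j a = d a j"
        using a i j by (auto intro!: d_triangle d_sym dest: S_F)
      thus "\<rho> i - d i j \<le> d a j" using a by simp
      show "0 \<le> x a j" using a j by (auto intro!: x_nonneg dest: S_F)
    qed
    also have "\<dots> \<le> cost j"
      unfolding cost_def using j by (intro sum_mono2) (auto intro!: mult_nonneg_nonneg x_nonneg d_nonneg dest: S_F)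
    finally have "2 * ((\<Sum>a\<in>?R. x a j) * (\<rho> i - d i j)) \<le> 2 * cost j" by (simp add: sum_distrib_right)
    moreover have "mass j * (\<rho> i - d i j) \<le> 2 * (\<Sum>a\<in>?R. x a j) * (\<rho> i - d i j)"
      using half True by (intro mult_right_mono) auto
    ultimately show ?thesis by (simp add: algebra_simps)
  next
    case False
    hence "mass j * \<rho> i \<le> mass j * d i j" using mass_pos by (intro mult_left_mono) auto
    thus ?thesis using cost_nonneg[OF j(1)] by simp
  qed
qed

text \<open>Averaging \<open>mass_radius_le\<close> over the assignment of \<open>j\<close> gives 3
  times the cost for one radius, and 1 + 4 times 3 is 13.\<close>

lemma sum_radius_le:
  assumes j: "j \<in> C" "\<not> served_large v j"
  shows "(\<Sum>i\<in>S. x i j * (d i j + 4 * \<rho> i)) \<le> 13 * cost j"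
proof -
  have pos: "0 < mass j" using j(2) eps_pos by (simp add: served_large_iff)
  have "mass j * (\<Sum>i\<in>S. x i j * \<rho> i) = (\<Sum>i\<in>S. x i j * (mass j * \<rho> i))"
    by (simp add: sum_distrib_left mult.left_commute)
  also have "\<dots> \<le> (\<Sum>i\<in>S. x i j * (mass j * d i j + 2 * cost j))"
    by (intro sum_mono mult_left_mono mass_radius_le j x_nonneg) (auto dest: S_F)
  also have "\<dots> = mass j * (\<Sum>i\<in>S. x i j * d i j) + 2 * cost j * (\<Sum>i\<in>S. x i j)"
    by (simp add: distrib_left sum.distrib sum_distrib_left mult_ac)
  also have "\<dots> = mass j * cost j + 2 * cost j * mass j"
    by (simp only: cost_def[symmetric] mass_def[symmetric])
  finally have "mass j * (\<Sum>i\<in>S. x i j * \<rho> i) \<le> mass j * (3 * cost j)" by (simp add: algebra_simps)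
  hence "(\<Sum>i\<in>S. x i j * \<rho> i) \<le> 3 * cost j" using pos by simp
  moreover have "(\<Sum>i\<in>S. x i j * (d i j + 4 * \<rho> i)) = cost j + 4 * (\<Sum>i\<in>S. x i j * \<rho> i)"
    by (simp add: cost_def distrib_left sum.distrib sum_distrib_left mult_ac)
  ultimately show ?thesis by simp
qed

lemma term_nonneg: "i \<in> S \<Longrightarrow> j \<in> C \<Longrightarrow> 0 \<le> x i j * (d i j + 4 * \<rho> i)"
  using x_nonneg d_nonneg radius_nonneg by (auto dest: S_F intro!: mult_nonneg_nonneg add_nonneg_nonneg)

lemma total_cost_le:
  "(\<Sum>j\<in>{j \<in> C. \<not> served_large v j}. \<Sum>i\<in>S. x i j * (d i j + 4 * \<rho> i)) \<le> 13 * (T * Y)"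
proof -
  have "(\<Sum>j\<in>{j \<in> C. \<not> served_large v j}. \<Sum>i\<in>S. x i j * (d i j + 4 * \<rho> i))
      \<le> (\<Sum>j\<in>{j \<in> C. \<not> served_large v j}. 13 * cost j)"
    by (rule sum_mono) (use sum_radius_le in auto)
  also have "\<dots> \<le> (\<Sum>j\<in>C. 13 * cost j)" by (rule sum_mono2) (auto intro: cost_nonneg)
  also have "\<dots> = 13 * (\<Sum>i\<in>S. \<Sum>j\<in>C. d i j * x i j)"
    unfolding cost_def sum_distrib_left[symmetric] by (subst sum.swap) (simp add: mult.commute)
  also have "(\<Sum>i\<in>S. \<Sum>j\<in>C. d i j * x i j) \<le> (\<Sum>i\<in>S. T * y i)"
    by (intro sum_mono x_load S_F)
  also have "\<dots> \<le> T * Y" unfolding sum_distrib_left[symmetric]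
    by (intro mult_left_mono sum_S_le_Y) (use T_pos S_F in auto)
  finally show ?thesis by simp
qed

subsection \<open>Counting large facilities and far clients\<close>

lemma card_large: "e * int (card {i \<in> F. large v i}) \<le> 16 * Y"
proof -
  have "e * int (card {i \<in> F. large v i}) = (\<Sum>i\<in>{i \<in> F. large v i}. e)" by simp
  also have "\<dots> \<le> (\<Sum>i\<in>{i \<in> F. large v i}. 16 * y i)" by (rule sum_mono) (simp add: large_def)
  also have "\<dots> \<le> 16 * Y" unfolding sum_distrib_left[symmetric] using sum_S_le_Y[of "{i \<in> F. large v i}"] by auto
  finally show ?thesis .
qed

lemma served_far_iff: "served_far v j \<longleftrightarrow> \<not> served_large v j \<and> e \<le> 4 * (\<Sum>i\<in>{i \<in> S. far v i j}. x i j)"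
  by (simp add: served_far_def sum_smalls)

text \<open>A far client has assignment at least a quarter of \<open>e\<close> on facilities where
  distance plus four radii exceeds \<open>T\<close>. It accounts for at least \<open>T * e\<close>
  divided by 4 of the total 13 \<open>T * Y\<close>.\<close>

lemma card_far: "e * int (card {j \<in> C. served_far v j}) \<le> 52 * Y"
proof -
  let ?B = "{j \<in> C. served_far v j}"
  have "T * (e * int (card ?B)) = (\<Sum>j\<in>?B. T * e)" by simp
  also have "\<dots> \<le> (\<Sum>j\<in>?B. 4 * (\<Sum>i\<in>S. x i j * (d i j + 4 * \<rho> i)))"
  proof (rule sum_mono)
    fix j assume j: "j \<in> ?B"
    have "T * e \<le> T * (4 * (\<Sum>i\<in>{i \<in> S. far v i j}. x i j))"
      using j T_pos by (intro mult_left_mono) (auto simp: served_far_iff)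
    also have "\<dots> = 4 * (\<Sum>i\<in>{i \<in> S. far v i j}. x i j * T)"
      by (simp add: sum_distrib_left mult_ac)
    also have "(\<Sum>i\<in>{i \<in> S. far v i j}. x i j * T) \<le> (\<Sum>i\<in>{i \<in> S. far v i j}. x i j * (d i j + 4 * \<rho> i))"
      using j by (intro sum_mono mult_left_mono) (auto simp: far_def dest: S_F intro: x_nonneg)
    also have "\<dots> \<le> (\<Sum>i\<in>S. x i j * (d i j + 4 * \<rho> i))"
      using j by (intro sum_mono2) (auto intro: term_nonneg)
    finally show "T * e \<le> 4 * (\<Sum>i\<in>S. x i j * (d i j + 4 * \<rho> i))" by simp
  qed
  also have "\<dots> = 4 * (\<Sum>j\<in>?B. \<Sum>i\<in>S. x i j * (d i j + 4 * \<rho> i))" by (simp add: sum_distrib_left)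
  also have "(\<Sum>j\<in>?B. \<Sum>i\<in>S. x i j * (d i j + 4 * \<rho> i))
      \<le> (\<Sum>j\<in>{j \<in> C. \<not> served_large v j}. \<Sum>i\<in>S. x i j * (d i j + 4 * \<rho> i))"
    by (intro sum_mono2) (auto simp: served_far_def intro!: sum_nonneg term_nonneg)
  also note total_cost_le
  finally have "T * (e * int (card ?B)) \<le> T * (52 * Y)" by simp
  thus ?thesis using T_pos by simp
qed

subsection \<open>Clusters of small facilities\<close>

lemma set_uncovered: "set (uncovered v cs) = {i \<in> S. \<forall>c\<in>set cs. 2 * \<rho> i < d i c}"
  by (auto simp: uncovered_def filter_empty_conv not_le)

text \<open>Centers are picked by increasing radius, so an uncovered facility has a radius at least
  as large as every center chosen so far. Being farther away than twice its own radius then implies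
  the same for the radius of the center.\<close>

definition center_inv :: "int list \<Rightarrow> bool" where
  "center_inv cs \<longleftrightarrow> set cs \<subseteq> S \<and>
    (\<forall>a\<in>set cs. \<forall>b\<in>set cs. a \<noteq> b \<longrightarrow> 2 * \<rho> a < d a b \<and> 2 * \<rho> b < d a b) \<and>
    (\<forall>i\<in>set (uncovered v cs). \<forall>c\<in>set cs. \<rho> c \<le> \<rho> i) \<and>
    (\<forall>i\<in>S. i \<notin> set (uncovered v cs) \<longrightarrow> (\<exists>c\<in>set cs. d i c \<le> 2 * \<rho> i \<and> \<rho> c \<le> \<rho> i))"

lemma add_center_step:
  assumes inv: "center_inv cs"
  shows "center_inv (add_center v cs) \<and>
    card (set (uncovered v (add_center v cs))) \<le> card (set (uncovered v cs)) - 1"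
proof (cases "uncovered v cs = []")
  case True
  thus ?thesis using inv by (simp add: add_center_def)
next
  case False
  let ?U = "uncovered v cs"
  have "\<exists>i\<in>set ?U. filter (\<lambda>a. \<rho> a < \<rho> i) ?U = []"
    using ex_is_arg_min_if_finite[of "set ?U" \<rho>] False unfolding is_arg_min_def
    by (auto simp: filter_empty_conv)
  then obtain i r where i: "filter (\<lambda>i. filter (\<lambda>a. \<rho> a < \<rho> i) ?U = []) ?U = i # r"
    by (cases "filter (\<lambda>i. filter (\<lambda>a. \<rho> a < \<rho> i) ?U = []) ?U") (auto simp: filter_empty_conv)
  from arg_cong[OF i, of set] have "i \<in> {i \<in> set ?U. filter (\<lambda>a. \<rho> a < \<rho> i) ?U = []}" by simp
  hence iU: "i \<in> set ?U" and min: "\<And>a. a \<in> set ?U \<Longrightarrow> \<rho> i \<le> \<rho> a" by (auto simp: filter_empty_conv not_less)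
  have eq: "add_center v cs = i # cs" by (simp add: add_center_def i)
  have iS: "i \<in> S" using iU by (simp add: set_uncovered)
  have sub: "set (uncovered v (i # cs)) \<subseteq> set ?U" by (auto simp: set_uncovered)
  have "d i i = 0" using iS d_refl S_F by blast
  hence "i \<notin> set (uncovered v (i # cs))" using radius_nonneg[OF iS] by (auto simp: set_uncovered)
  hence "set (uncovered v (i # cs)) \<subseteq> set ?U - {i}" using sub by blast
  hence "card (set (uncovered v (i # cs))) \<le> card (set ?U - {i})" by (intro card_mono) auto
  hence card: "card (set (uncovered v (i # cs))) \<le> card (set ?U) - 1" using iU by simp
  have new: "2 * \<rho> i < d i c \<and> 2 * \<rho> c < d i c \<and> d c i = d i c" if "c \<in> set cs" for c
  proof -
    have "2 * \<rho> i < d i c" using iU that by (auto simp: set_uncovered)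
    moreover have "\<rho> c \<le> \<rho> i" using inv iU that by (auto simp: center_inv_def)
    moreover have "c \<in> S" using inv that by (auto simp: center_inv_def)
    hence "d c i = d i c" using iS by (intro d_sym) (auto dest: S_F)
    ultimately show ?thesis by linarith
  qed
  have "center_inv (i # cs)"
    unfolding center_inv_def
  proof (intro conjI)
    show "set (i # cs) \<subseteq> S" using inv iS by (auto simp: center_inv_def)
    show "\<forall>a\<in>set (i # cs). \<forall>b\<in>set (i # cs). a \<noteq> b \<longrightarrow> 2 * \<rho> a < d a b \<and> 2 * \<rho> b < d a b"
      using inv new by (auto simp: center_inv_def)
    show "\<forall>a\<in>set (uncovered v (i # cs)). \<forall>c\<in>set (i # cs). \<rho> c \<le> \<rho> a"
      using inv sub min by (auto simp: center_inv_def)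
    show "\<forall>a\<in>S. a \<notin> set (uncovered v (i # cs)) \<longrightarrow> (\<exists>c\<in>set (i # cs). d a c \<le> 2 * \<rho> a \<and> \<rho> c \<le> \<rho> a)"
    proof safe
      fix a assume a: "a \<in> S" "a \<notin> set (uncovered v (i # cs))"
      show "\<exists>c\<in>set (i # cs). d a c \<le> 2 * \<rho> a \<and> \<rho> c \<le> \<rho> a"
      proof (cases "a \<in> set ?U")
        case True
        hence "d a i \<le> 2 * \<rho> a" using a by (auto simp: set_uncovered not_less)
        thus ?thesis using min[OF True] by auto
      next
        case False
        thus ?thesis using inv a by (auto simp: center_inv_def)
      qed
    qed
  qed
  thus ?thesis using card eq by simp
qed

text \<open>The number of rounds is the number of facilities, hence at least the number of small
  ones, and each round lowers the number of uncovered ones until it is 0.\<close>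

lemma centers_inv: "center_inv (centers v)" "set (uncovered v (centers v)) = {}"
proof -
  have init: "center_inv []" "set (uncovered v []) = S" by (auto simp: center_inv_def set_uncovered)
  have "center_inv (foldl (\<lambda>cs _. add_center v cs) [] as) \<and>
    card (set (uncovered v (foldl (\<lambda>cs _. add_center v cs) [] as))) \<le> card S - length as" for as :: "int list"
  proof (induction as rule: rev_induct)
    case (snoc a as)
    thus ?case using add_center_step[of "foldl (\<lambda>cs _. add_center v cs) [] as"] by (simp, linarith)
  qed (simp add: init)
  from this[of "facs v"] have "center_inv (centers v)" "card (set (uncovered v (centers v))) \<le> card S - length (facs v)"
    by (auto simp: centers_def)
  moreover have "card S \<le> length (facs v)"
    by (metis card_length length_filter_le order_trans smalls_def)
  ultimately show "center_inv (centers v)" "set (uncovered v (centers v)) = {}" by auto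
qed

lemma center:
  assumes "i \<in> S"
  shows "center v i \<in> set (centers v)" "d i (center v i) \<le> 2 * \<rho> i" "\<rho> (center v i) \<le> \<rho> i"
proof -
  have "\<exists>c\<in>set (centers v). d i c \<le> 2 * \<rho> i \<and> \<rho> c \<le> \<rho> i"
  proof -
    from centers_inv(1) have "\<forall>i\<in>S. i \<notin> set (uncovered v (centers v)) \<longrightarrow>
        (\<exists>c\<in>set (centers v). d i c \<le> 2 * \<rho> i \<and> \<rho> c \<le> \<rho> i)"
      unfolding center_inv_def by (elim conjE)
    thus ?thesis using centers_inv(2) assms by simp
  qed
  from case_filter[OF this, of 0] show "center v i \<in> set (centers v)" "d i (center v i) \<le> 2 * \<rho> i" "\<rho> (center v i) \<le> \<rho> i"
    unfolding center_def by blast+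
qed

lemma centers_S: "set (centers v) \<subseteq> S" using centers_inv by (simp add: center_inv_def)

text \<open>Distinct centers are more than twice the larger radius apart, so their balls are
  disjoint, and each ball contains mass at least a quarter of \<open>e\<close>. The client in the
  hypothesis guarantees that the radii are meaningful.\<close>

lemma card_centers:
  assumes "j \<in> C" "\<not> served_large v j"
  shows "e * int (card (set (centers v))) \<le> 4 * Y"
proof -
  let ?ball = "\<lambda>c. {a \<in> S. d c a \<le> \<rho> c}"
  have "e * int (card (set (centers v))) = (\<Sum>c\<in>set (centers v). e)" by simp
  also have "\<dots> \<le> (\<Sum>c\<in>set (centers v). 4 * (\<Sum>a\<in>?ball c. y a))"
    by (intro sum_mono radius_ball[OF assms]) (use centers_S in auto)
  also have "\<dots> = 4 * (\<Sum>a\<in>(\<Union>c\<in>set (centers v). ?ball c). y a)"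
  proof -
    have disj: "\<forall>a\<in>set (centers v). \<forall>b\<in>set (centers v). a \<noteq> b \<longrightarrow> ?ball a \<inter> ?ball b = {}"
    proof (intro ballI impI, rule ccontr)
      fix a b assume ab: "a \<in> set (centers v)" "b \<in> set (centers v)" "a \<noteq> b" "?ball a \<inter> ?ball b \<noteq> {}"
      then obtain z where z: "z \<in> S" "d a z \<le> \<rho> a" "d b z \<le> \<rho> b" by blast
      have "a \<in> S" "b \<in> S" using ab centers_S by auto
      hence "d a b \<le> d a z + d z b" "d z b = d b z" using z by (auto intro!: d_triangle d_sym dest: S_F)
      moreover have "2 * \<rho> a < d a b \<and> 2 * \<rho> b < d a b" using centers_inv(1) ab by (simp add: center_inv_def)
      ultimately show False using z by linarith
    qed
    show ?thesis by (subst sum.UNION_disjoint[OF _ _ disj]) (auto simp: sum_distrib_left)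
  qed
  also have "\<dots> \<le> 4 * Y" using sum_S_le_Y[of "\<Union>c\<in>set (centers v). ?ball c"] by (auto dest: S_F)
  finally show ?thesis .
qed

lemma ranked_linear: "ranked v a b \<or> ranked v b a" "ranked v a b \<Longrightarrow> ranked v b c \<Longrightarrow> ranked v a c"
  "ranked v a b \<Longrightarrow> ranked v b a \<Longrightarrow> a = b" "ranked v a a"
  by (auto simp: ranked_def)

lemma ex_least: "finite A \<Longrightarrow> A \<noteq> {} \<Longrightarrow> \<exists>a\<in>A. \<forall>b\<in>A. ranked v a b"
proof (induction rule: finite_ne_induct)
  case (insert a A)
  then obtain m where "m \<in> A" "\<forall>b\<in>A. ranked v m b" by blast
  thus ?case using ranked_linear by (cases "ranked v a m") blast+
qed (simp add: ranked_linear)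

lemma ex_greatest: "finite A \<Longrightarrow> A \<noteq> {} \<Longrightarrow> \<exists>a\<in>A. \<forall>b\<in>A. ranked v b a"
proof (induction rule: finite_ne_induct)
  case (insert a A)
  then obtain m where "m \<in> A" "\<forall>b\<in>A. ranked v b m" by blast
  thus ?case using ranked_linear by (cases "ranked v m a") blast+
qed (simp add: ranked_linear)

lemma set_peers: "set (peers v i) = {a \<in> S. center v a = center v i \<and> bucket v a = bucket v i}"
  by (auto simp: peers_def)

lemma target_cong: "peers v a = peers v b \<Longrightarrow> target v a = target v b"
  by (simp add: target_def)

lemma target:
  assumes "i \<in> S"
  shows "target v i \<in> S" "center v (target v i) = center v i" "bucket v (target v i) = bucket v i"
    "b \<in> set (peers v i) \<Longrightarrow> ranked v (target v i) b" "target v (target v i) = target v i"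
proof -
  have "i \<in> set (peers v i)" using assms by (simp add: set_peers)
  hence "\<exists>a\<in>set (peers v i). \<forall>b\<in>set (peers v i). ranked v a b" by (intro ex_least) auto
  hence "\<exists>a\<in>set (peers v i). filter (\<lambda>b. \<not> ranked v a b) (peers v i) = []" by (simp add: filter_empty_conv)
  from case_filter[OF this, of 0]
  have *: "target v i \<in> set (peers v i)" "\<forall>b\<in>set (peers v i). ranked v (target v i) b"
    unfolding target_def[symmetric] by (auto simp: filter_empty_conv)
  thus **: "target v i \<in> S" "center v (target v i) = center v i" "bucket v (target v i) = bucket v i"
    "b \<in> set (peers v i) \<Longrightarrow> ranked v (target v i) b" by (auto simp: set_peers)
  have "peers v (target v i) = peers v i" by (simp add: peers_def **)
  thus "target v (target v i) = target v i" by (rule target_cong)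
qed

text \<open>Two hops through the common center, each at most two radii; the target ranks first in
  its group and so has no larger radius. This is the origin of the factor 4 in \<open>far\<close>
  and \<open>move_cost\<close>.\<close>

lemma target_distance:
  assumes "i \<in> S" shows "d i (target v i) \<le> 4 * \<rho> i"
proof -
  let ?t = "target v i" and ?c = "center v i"
  have t: "?t \<in> S" using target assms by blast
  have c: "?c \<in> S" using center(1)[OF assms] centers_S by blast
  have "ranked v ?t i" using assms target(4)[of i i] by (simp add: set_peers)
  hence "\<rho> ?t \<le> \<rho> i" by (auto simp: ranked_def)
  moreover have "d ?t ?c \<le> 2 * \<rho> ?t" using center(2)[OF t] target(2)[OF assms] by simp
  moreover have "d i ?c \<le> 2 * \<rho> i" by (rule center(2)[OF assms])
  moreover have "d i ?t \<le> d i ?c + d ?c ?t" "d ?c ?t = d ?t ?c"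
    using assms t c by (auto intro!: d_triangle d_sym dest: S_F)
  ultimately show ?thesis by linarith
qed

lemma move_cost_eq: "move_cost v i = (\<Sum>j\<in>{j \<in> C. served_near v j \<and> \<not> far v i j}. x i j * (d i j + 4 * \<rho> i))"
  by (simp add: move_cost_def sum_clis)

lemma move_cost_nonneg: "i \<in> S \<Longrightarrow> 0 \<le> move_cost v i"
  unfolding move_cost_eq by (intro sum_nonneg term_nonneg) auto

definition accum :: "int \<Rightarrow> int" where
  "accum i = (\<Sum>a\<in>{a \<in> S. center v a = center v i \<and> ranked v a i}. move_cost v a)"

lemma bucket_eq: "bucket v i = 8 * accum i div (e * T)"
  by (simp add: bucket_def accum_def sum_smalls)

lemma accum_nonneg: "0 \<le> accum i"
  unfolding accum_def by (intro sum_nonneg move_cost_nonneg) auto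

lemma eT_pos: "0 < e * T" using eps_pos T_pos by simp

text \<open>With \<open>m\<close> the last facility of the group, the moved ones together with all
  that rank up to \<open>t\<close> are counted in \<open>accum m\<close>. Since \<open>t\<close> and
  \<open>m\<close> share a bucket, their totals differ by less than one unit.\<close>

lemma moved_cost_le:
  assumes "t \<in> S" "target v t = t"
  shows "8 * (\<Sum>a\<in>{a \<in> S. target v a = t \<and> a \<noteq> t}. move_cost v a) \<le> e * T"
proof (cases "{a \<in> S. target v a = t \<and> a \<noteq> t} = {}")
  case True
  show ?thesis unfolding True using eT_pos by simp
next
  case False
  let ?A = "{a \<in> S. target v a = t \<and> a \<noteq> t}"
  obtain m where m: "m \<in> ?A" "\<forall>b\<in>?A. ranked v b m" using ex_greatest[OF _ False] by auto
  have A: "center v a = center v t \<and> bucket v a = bucket v t \<and> ranked v t a \<and> \<not> ranked v a t" if "a \<in> ?A" for a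
  proof -
    have "ranked v (target v a) a" using that target(4)[of a a] by (simp add: set_peers)
    thus ?thesis using that target(2,3)[of a] ranked_linear(3)[of a t] by auto
  qed
  let ?P = "{a \<in> S. center v a = center v t \<and> ranked v a t}"
  have "?A \<inter> ?P = {}" using A by auto
  moreover have "?A \<union> ?P \<subseteq> {a \<in> S. center v a = center v m \<and> ranked v a m}"
    using A m ranked_linear(2) by fastforce
  ultimately have "(\<Sum>a\<in>?A. move_cost v a) + accum t \<le> accum m"
    unfolding accum_def by (subst sum.union_disjoint[symmetric]) (auto intro!: sum_mono2 move_cost_nonneg)
  moreover have "8 * accum m < 8 * accum t + e * T"
  proof -
    have "8 * accum m div (e * T) = 8 * accum t div (e * T)" using A[OF m(1)] by (simp add: bucket_eq)
    thus ?thesis using eT_pos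
      by (smt (verit) minus_mult_div_eq_mod pos_mod_bound pos_mod_sign)
  qed
  ultimately show ?thesis by linarith
qed

lemma total_move_cost: "(\<Sum>i\<in>S. move_cost v i) \<le> 13 * (T * Y)"
proof -
  have "(\<Sum>i\<in>S. move_cost v i) \<le> (\<Sum>i\<in>S. \<Sum>j\<in>{j \<in> C. \<not> served_large v j}. x i j * (d i j + 4 * \<rho> i))"
    unfolding move_cost_eq by (intro sum_mono sum_mono2) (auto simp: served_near_def intro: term_nonneg)
  also have "\<dots> = (\<Sum>j\<in>{j \<in> C. \<not> served_large v j}. \<Sum>i\<in>S. x i j * (d i j + 4 * \<rho> i))" by (rule sum.swap)
  also note total_cost_le
  finally show ?thesis .
qed

text \<open>Targets of one cluster lie in different buckets, numbered from 0 to the rounded total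
  cost of the cluster. The rounded totals sum to 8 times 13 \<open>Y\<close>, and the one extra
  bucket per cluster costs 4 \<open>Y\<close> by the number of centers.\<close>

lemma card_targets:
  assumes "j \<in> C" "\<not> served_large v j"
  shows "e * int (card (target v ` S)) \<le> 108 * Y"
proof -
  let ?Z = "\<lambda>c. {t \<in> target v ` S. center v t = c}"
  let ?Q = "\<lambda>c. \<Sum>a\<in>{a \<in> S. center v a = c}. move_cost v a"
  have per: "e * T * int (card (?Z c)) \<le> 8 * ?Q c + e * T" if c: "c \<in> set (centers v)" for c
  proof -
    have fixed: "t \<in> S \<and> target v t = t" if "t \<in> ?Z c" for t
    proof -
      from that obtain i where "i \<in> S" "t = target v i" by blast
      thus ?thesis using target(1,5)[of i] by simp
    qed
    have inj: "inj_on (bucket v) (?Z c)"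
    proof (rule inj_onI)
      fix a b assume ab: "a \<in> ?Z c" "b \<in> ?Z c" "bucket v a = bucket v b"
      hence "peers v a = peers v b" by (simp add: peers_def)
      from target_cong[OF this] show "a = b" using fixed[OF ab(1)] fixed[OF ab(2)] by simp
    qed
    have "bucket v ` ?Z c \<subseteq> {0..8 * ?Q c div (e * T)}"
    proof (rule image_subsetI)
      fix a assume a: "a \<in> ?Z c"
      have ca: "center v a = c" using a by blast
      have "accum a \<le> ?Q c"
        unfolding accum_def ca by (intro sum_mono2) (auto intro: move_cost_nonneg)
      hence "8 * accum a div (e * T) \<le> 8 * ?Q c div (e * T)" using eT_pos by (intro zdiv_mono1) auto
      moreover have "0 \<le> 8 * accum a div (e * T)"
        using eT_pos accum_nonneg[of a] by (simp add: pos_imp_zdiv_nonneg_iff)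
      ultimately show "bucket v a \<in> {0..8 * ?Q c div (e * T)}" by (simp add: bucket_eq)
    qed
    hence "card (?Z c) \<le> card {0..8 * ?Q c div (e * T)}"
      by (metis (no_types, lifting) card_image[OF inj] card_mono finite_atLeastAtMost_int)
    moreover have "0 \<le> ?Q c" by (intro sum_nonneg move_cost_nonneg) auto
    hence "0 \<le> 8 * ?Q c div (e * T)" using eT_pos by (simp add: pos_imp_zdiv_nonneg_iff)
    ultimately have "int (card (?Z c)) \<le> 8 * ?Q c div (e * T) + 1" by simp
    hence "e * T * int (card (?Z c)) \<le> e * T * (8 * ?Q c div (e * T) + 1)"
      using eT_pos by (intro mult_left_mono) auto
    also have "\<dots> \<le> 8 * ?Q c + e * T"
    proof -
      have "p * (q div p) \<le> q" if "0 < p" for p q :: int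
        using pos_mod_sign[OF that, of q] minus_mod_eq_mult_div[of q p] by linarith
      from this[OF eT_pos] show ?thesis by (simp add: distrib_left)
    qed
    finally show ?thesis .
  qed
  have "target v ` S \<subseteq> (\<Union>c\<in>set (centers v). ?Z c)" using target(1) center(1) by fastforce
  hence "card (target v ` S) \<le> card (\<Union>c\<in>set (centers v). ?Z c)" by (intro card_mono) auto
  also have "\<dots> \<le> (\<Sum>c\<in>set (centers v). card (?Z c))" by (rule card_UN_le) simp
  finally have "e * T * int (card (target v ` S)) \<le> e * T * (\<Sum>c\<in>set (centers v). int (card (?Z c)))"
    using eT_pos by (intro mult_left_mono) (auto simp flip: of_nat_sum)
  also have "\<dots> = (\<Sum>c\<in>set (centers v). e * T * int (card (?Z c)))" by (rule sum_distrib_left)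
  also have "\<dots> \<le> (\<Sum>c\<in>set (centers v). 8 * ?Q c + e * T)" by (rule sum_mono[OF per])
  also have "\<dots> = 8 * (\<Sum>c\<in>set (centers v). ?Q c) + T * (e * int (card (set (centers v))))"
    by (simp add: sum.distrib sum_distrib_left)
  also have "(\<Sum>c\<in>set (centers v). ?Q c) = (\<Sum>i\<in>S. move_cost v i)"
    by (rule sum.group) (use center(1) in auto)
  also have "8 * (\<Sum>i\<in>S. move_cost v i) + T * (e * int (card (set (centers v)))) \<le> 8 * (13 * (T * Y)) + T * (4 * Y)"
    by (intro add_mono mult_left_mono total_move_cost card_centers[OF assms]) (use T_pos in auto)
  finally have "T * (e * int (card (target v ` S))) \<le> T * (108 * Y)" by (simp add: mult_ac)
  thus ?thesis using T_pos by simp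
qed

subsection \<open>The fractional assignment\<close>

lemma capacity_pos: "0 < capacity v i"
  using eps_pos eps_less by (simp add: capacity_def)

lemma raw_weight_small:
  "i \<in> S \<Longrightarrow> raw_weight v i j = (if served_far v j then (if far v i j then 4 * x i j else 0)
     else if served_near v j then 4 * (\<Sum>a\<in>{a \<in> S. \<not> far v a j \<and> target v a = i}. x a j) else 0)"
  by (simp add: raw_weight_def sum_smalls S_eq)

lemma raw_weight_nonneg: "i \<in> F \<Longrightarrow> j \<in> C \<Longrightarrow> 0 \<le> raw_weight v i j"
  unfolding raw_weight_def sum_smalls by (auto intro!: sum_nonneg x_nonneg dest: S_F)

lemma weight_bounds:
  assumes "i \<in> F" "j \<in> C"
  shows "0 \<le> weight v i j" "weight v i j \<le> capacity v i" "weight v i j \<le> raw_weight v i j"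
  using raw_weight_nonneg[OF assms] capacity_pos[of i] by (auto simp: weight_def)

text \<open>The LP gives this where \<open>x\<close> itself is positive. A near client arrives from
  a facility \<open>a\<close> that is not far, and the triangle inequality with at most four radii
  of \<open>a\<close> stays within \<open>T\<close>.\<close>

lemma support_distance:
  assumes "i \<in> F" "j \<in> C" "0 < weight v i j" shows "d i j \<le> T"
proof (rule ccontr)
  assume far: "\<not> d i j \<le> T"
  hence x0: "x i j = 0" using x_support assms by simp
  have "0 < raw_weight v i j" using assms weight_bounds by force
  moreover have "(\<Sum>a\<in>{a \<in> S. \<not> far v a j \<and> target v a = i}. x a j) = 0"
  proof -
    have "{a \<in> S. \<not> far v a j \<and> target v a = i} = {}"
    proof safe
      fix a assume a: "a \<in> S" "\<not> far v a j" "i = target v a"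
      have "d i j \<le> d i a + d a j" "d i a = d a i"
        using assms a by (auto intro!: d_triangle d_sym dest: S_F)
      thus "a \<in> {}" using far a(2) target_distance[OF a(1)] a(3) by (simp add: far_def)
    qed
    thus ?thesis by (simp only: sum.empty)
  qed
  ultimately show False by (auto simp: raw_weight_def sum_smalls x0 split: if_splits)
qed

text \<open>After dividing by scale and capacity, the fractional load is at most (1 + \<epsilon>) T.
  The two kinds of facilities need separate arguments: rescaling for large ones, the slack left by a
  small \<open>y\<close> for small ones.\<close>

lemma weight_load:
  assumes i: "i \<in> F"
  shows "M * (\<Sum>j\<in>C. weight v i j * d i j) \<le> capacity v i * ((M + e) * T)"
proof -
  have "(\<Sum>j\<in>C. weight v i j * d i j) \<le> (\<Sum>j\<in>C. raw_weight v i j * d i j)"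
    using i by (intro sum_mono mult_right_mono weight_bounds d_nonneg) auto
  hence le: "M * (\<Sum>j\<in>C. weight v i j * d i j) \<le> M * (\<Sum>j\<in>C. raw_weight v i j * d i j)"
    using eps_pos eps_less by (intro mult_left_mono) auto
  show ?thesis
  proof (cases "large v i")
    case True
    have "(\<Sum>j\<in>C. raw_weight v i j * d i j) \<le> (\<Sum>j\<in>C. 2 * (d i j * x i j))"
      using True i x_nonneg d_nonneg by (intro sum_mono) (auto simp: raw_weight_def mult.commute)
    also have "\<dots> = 2 * (\<Sum>j\<in>C. d i j * x i j)" by (simp add: sum_distrib_left)
    also have "\<dots> \<le> 2 * (T * y i)" using x_load[OF i] by simp
    also have "\<dots> \<le> 2 * (T * M)" using y_le[OF i] T_pos by simp
    finally have "M * (\<Sum>j\<in>C. raw_weight v i j * d i j) \<le> M * (2 * (T * M))"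
      using eps_pos eps_less by (intro mult_left_mono) auto
    also have "\<dots> = (2 * M * M) * T" by (simp add: mult_ac)
    also have "\<dots> \<le> ((2 * M - e) * (M + e)) * T"
    proof (rule mult_right_mono)
      \<comment> \<open>This says that 1 / (1 - \<epsilon>/2) is at most 1 + \<epsilon> for
        \<epsilon> below 1.\<close>
      have "0 \<le> e * (M - e)" using eps_pos eps_less by simp
      thus "2 * M * M \<le> (2 * M - e) * (M + e)" by (simp add: algebra_simps)
    qed (use T_pos in simp)
    finally show ?thesis using le True by (simp add: capacity_def mult_ac)
  next
    case False
    hence iS: "i \<in> S" using i by (simp add: S_eq)
    let ?A = "{a \<in> S. target v a = i \<and> a \<noteq> i}"
    let ?w = "\<lambda>j. if served_near v j then (\<Sum>a\<in>{a \<in> ?A. \<not> far v a j}. 4 * (x a j * (d a j + 4 * \<rho> a))) else 0"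
    have "raw_weight v i j * d i j \<le> 4 * (d i j * x i j) + ?w j" if j: "j \<in> C" for j
    proof -
      have x0: "0 \<le> x i j" and d0: "0 \<le> d i j" using i j x_nonneg d_nonneg by auto
      have w0: "0 \<le> ?w j" using j by (auto intro!: sum_nonneg term_nonneg)
      show ?thesis
      proof (cases "served_near v j")
        case True
        hence nf: "\<not> served_far v j" by (simp add: served_near_def)
        \<comment> \<open>The term of \<open>i\<close> is added unconditionally; it separates the
          facility's own assignment from what is moved to it.\<close>
        have "(\<Sum>a\<in>{a \<in> S. \<not> far v a j \<and> target v a = i}. x a j)
            \<le> (\<Sum>a\<in>insert i {a \<in> ?A. \<not> far v a j}. x a j)"
          using x0 j x_nonneg by (intro sum_mono2) (auto dest: S_F)
        also have "\<dots> = x i j + (\<Sum>a\<in>{a \<in> ?A. \<not> far v a j}. x a j)" by (subst sum.insert) auto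
        finally have "(\<Sum>a\<in>{a \<in> S. \<not> far v a j \<and> target v a = i}. x a j) * d i j
            \<le> (x i j + (\<Sum>a\<in>{a \<in> ?A. \<not> far v a j}. x a j)) * d i j"
          using d0 by (rule mult_right_mono)
        also have "\<dots> = d i j * x i j + (\<Sum>a\<in>{a \<in> ?A. \<not> far v a j}. x a j * d i j)"
          unfolding distrib_right sum_distrib_right by (simp add: mult.commute)
        also have "(\<Sum>a\<in>{a \<in> ?A. \<not> far v a j}. x a j * d i j)
            \<le> (\<Sum>a\<in>{a \<in> ?A. \<not> far v a j}. x a j * (d a j + 4 * \<rho> a))"
        proof (intro sum_mono mult_left_mono)
          fix a assume a: "a \<in> {a \<in> ?A. \<not> far v a j}"
          have "d i j \<le> d i a + d a j" "d i a = d a i"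
            using i j a by (auto intro!: d_triangle d_sym dest: S_F)
          thus "d i j \<le> d a j + 4 * \<rho> a" using target_distance[of a] a by simp
          show "0 \<le> x a j" using a j x_nonneg S_F by blast
        qed
        finally show ?thesis using True nf by (simp add: raw_weight_small[OF iS] flip: sum_distrib_left)
      next
        case False
        thus ?thesis using x0 d0 by (simp add: raw_weight_small[OF iS] mult.commute)
      qed
    qed
    hence "(\<Sum>j\<in>C. raw_weight v i j * d i j) \<le> (\<Sum>j\<in>C. 4 * (d i j * x i j) + ?w j)" by (rule sum_mono)
    also have "\<dots> = 4 * (\<Sum>j\<in>C. d i j * x i j) + (\<Sum>j\<in>C. ?w j)"
      by (simp add: sum.distrib sum_distrib_left)
    also have "(\<Sum>j\<in>C. ?w j) = 4 * (\<Sum>a\<in>?A. move_cost v a)"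
    proof -
      have "(\<Sum>j\<in>C. ?w j) = (\<Sum>j\<in>C. \<Sum>a\<in>?A. if served_near v j \<and> \<not> far v a j then 4 * (x a j * (d a j + 4 * \<rho> a)) else 0)"
        by (intro sum.cong refl) (auto simp: sum.inter_filter intro!: sum.neutral sum.cong)
      also have "\<dots> = (\<Sum>a\<in>?A. \<Sum>j\<in>C. if served_near v j \<and> \<not> far v a j then 4 * (x a j * (d a j + 4 * \<rho> a)) else 0)"
        by (rule sum.swap)
      also have "\<dots> = (\<Sum>a\<in>?A. 4 * move_cost v a)"
        unfolding move_cost_eq sum_distrib_left by (rule sum.cong[OF refl]) (simp add: sum.inter_filter)
      finally show ?thesis by (simp add: sum_distrib_left)
    qed
    finally have raw: "(\<Sum>j\<in>C. raw_weight v i j * d i j) \<le> 4 * (\<Sum>j\<in>C. d i j * x i j) + 4 * (\<Sum>a\<in>?A. move_cost v a)" .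
    have own: "16 * (\<Sum>j\<in>C. d i j * x i j) \<le> e * T"
    proof -
      have "16 * (\<Sum>j\<in>C. d i j * x i j) \<le> T * (16 * y i)" using x_load[OF i] by simp
      also have "\<dots> \<le> T * e" using False T_pos by (intro mult_left_mono) (auto simp: large_def)
      finally show ?thesis by (simp add: mult.commute)
    qed
    have moved: "8 * (\<Sum>a\<in>?A. move_cost v a) \<le> e * T"
    proof (cases "target v i = i")
      case True
      thus ?thesis by (rule moved_cost_le[OF iS])
    next
      case False
      \<comment> \<open>Targets are fixed points of \<open>target\<close>, so nothing moves to a
        facility that moves itself.\<close>
      have "?A = {}" using target(5) False by blast
      thus ?thesis using eT_pos by (simp only: sum.empty)
    qed
    have "(\<Sum>j\<in>C. raw_weight v i j * d i j) \<le> e * T" using raw own moved eT_pos by linarith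
    hence "M * (\<Sum>j\<in>C. raw_weight v i j * d i j) \<le> M * (e * T)"
      using eps_pos eps_less by (intro mult_left_mono) auto
    also have "\<dots> \<le> (M + e) * (e * T)" using eps_pos eT_pos by (intro mult_right_mono) auto
    finally show ?thesis using le False by (simp add: capacity_def mult_ac)
  qed
qed

text \<open>If a weight is cut off, that facility alone covers the client. Otherwise the three kinds
  of clients each find enough raw weight: 2 \<open>M\<close> - \<open>e\<close> on large facilities,
  \<open>e\<close> on far ones, or \<open>e\<close> on targets, since more than half of
  \<open>e\<close> minus a quarter of \<open>e\<close> remains near.\<close>

lemma weight_cover:
  assumes j: "j \<in> C"
  shows "1 \<le> (\<Sum>i\<in>F. real_of_int (weight v i j) / real_of_int (capacity v i))"
proof -
  have nonneg: "0 \<le> real_of_int (weight v i j) / real_of_int (capacity v i)" if "i \<in> F" for i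
    using weight_bounds(1)[OF that j] capacity_pos[of i] by (simp add: less_imp_le)
  show ?thesis
  proof (cases "\<exists>i\<in>F. weight v i j = capacity v i")
    case True
    then obtain i where i: "i \<in> F" "weight v i j = capacity v i" by blast
    have "1 = real_of_int (weight v i j) / real_of_int (capacity v i)" using i capacity_pos[of i] by simp
    also have "\<dots> \<le> (\<Sum>i\<in>F. real_of_int (weight v i j) / real_of_int (capacity v i))"
      by (rule member_le_sum[OF i(1)]) (use nonneg in auto)
    finally show ?thesis .
  next
    case False
    hence eq: "weight v i j = raw_weight v i j" if "i \<in> F" for i
      using that by (auto simp: weight_def split: if_splits)
    \<comment> \<open>It is enough to exhibit facilities of a common capacity \<open>c\<close> whose
      raw weights sum to at least \<open>c\<close>.\<close>
    have reduce: ?thesis if "A \<subseteq> F" "\<And>i. i \<in> A \<Longrightarrow> capacity v i = c" "c \<le> (\<Sum>i\<in>A. raw_weight v i j)" "0 < c" for A c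
    proof -
      have "real_of_int c \<le> real_of_int (\<Sum>i\<in>A. raw_weight v i j)" using that(3) by (simp only: of_int_le_iff)
      hence "1 \<le> real_of_int (\<Sum>i\<in>A. raw_weight v i j) / real_of_int c" using that(4) by simp
      also have "\<dots> = (\<Sum>i\<in>A. real_of_int (weight v i j) / real_of_int (capacity v i))"
        using that by (auto simp: sum_divide_distrib eq subset_iff intro!: sum.cong)
      also have "\<dots> \<le> (\<Sum>i\<in>F. real_of_int (weight v i j) / real_of_int (capacity v i))"
        by (rule sum_mono2) (use that(1) nonneg in auto)
      finally show ?thesis .
    qed
    have cap_S: "capacity v i = e" if "i \<in> S" for i using that by (simp add: S_eq capacity_def)
    consider "served_large v j" | "served_far v j" | "served_near v j" unfolding served_near_def by blast
    thus ?thesis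
    proof cases
      case 1
      let ?L = "{i \<in> F. large v i}"
      have "M = (\<Sum>i\<in>?L. x i j) + mass j"
        unfolding mass_def x_sum[OF j, symmetric] S_eq by (subst sum.union_disjoint[symmetric]) (auto intro!: sum.cong)
      hence "2 * M - e \<le> (\<Sum>i\<in>?L. 2 * x i j)" using 1 by (simp add: served_large_iff flip: sum_distrib_left)
      also have "\<dots> = (\<Sum>i\<in>?L. raw_weight v i j)" using 1 by (intro sum.cong refl) (simp add: raw_weight_def)
      finally show ?thesis using eps_pos eps_less
        by (intro reduce[of ?L "2 * M - e"]) (auto simp: capacity_def)
    next
      case 2
      have "e \<le> 4 * (\<Sum>i\<in>{i \<in> S. far v i j}. x i j)" using 2 by (simp add: served_far_iff)
      also have "\<dots> = (\<Sum>i\<in>{i \<in> S. far v i j}. raw_weight v i j)"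
        unfolding sum_distrib_left using 2 by (intro sum.cong refl) (simp add: raw_weight_small)
      finally show ?thesis using eps_pos cap_S
        by (intro reduce[of "{i \<in> S. far v i j}" e]) (auto dest: S_F)
    next
      case 3
      hence nf: "\<not> served_far v j" "\<not> served_large v j" by (simp_all add: served_near_def)
      have "mass j = (\<Sum>i\<in>{i \<in> S. far v i j}. x i j) + (\<Sum>i\<in>{i \<in> S. \<not> far v i j}. x i j)"
        unfolding mass_def by (subst sum.union_disjoint[symmetric]) (auto intro!: sum.cong)
      hence "e \<le> 4 * (\<Sum>a\<in>{a \<in> S. \<not> far v a j}. x a j)"
        using nf by (simp add: served_far_iff served_large_iff)
      also have "(\<Sum>a\<in>{a \<in> S. \<not> far v a j}. x a j)
          = (\<Sum>i\<in>S. \<Sum>a\<in>{a \<in> {a \<in> S. \<not> far v a j}. target v a = i}. x a j)"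
        by (rule sum.group[symmetric]) (use target(1) in auto)
      also have "4 * \<dots> = (\<Sum>i\<in>S. raw_weight v i j)"
        unfolding sum_distrib_left using 3 nf by (intro sum.cong refl) (simp add: raw_weight_small sum_distrib_left conj_assoc)
      finally show ?thesis using eps_pos cap_S by (intro reduce[of S e]) (auto dest: S_F)
    qed
  qed
qed

subsection \<open>The integral assignment\<close>

lemma slots: "i \<in> F \<Longrightarrow> slots C (d i) (weight v i) (capacity v i)"
  using weight_bounds capacity_pos d_nonneg by unfold_locales auto

abbreviation adj :: "int \<Rightarrow> int \<Rightarrow> int set" where
  "adj i j \<equiv> slots.adjacent C (d i) (weight v i) (capacity v i) j"

abbreviation ov :: "int \<Rightarrow> int \<Rightarrow> int \<Rightarrow> int" where
  "ov i j s \<equiv> slots.overlap C (d i) (weight v i) (capacity v i) j s"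

lemma fill_eq: "i \<in> F \<Longrightarrow> fill v i j = slots.prefix (d i) (weight v i) C j"
  by (simp add: fill_def sum_clis slots.prefix_def[OF slots] slots.prec_def[OF slots])

lemma mem_edges: "(j, i, s) \<in> set (edges v) \<longleftrightarrow> i \<in> F \<and> j \<in> C \<and> 0 < weight v i j \<and> s \<in> adj i j"
proof -
  have "(j, i, s) \<in> set (edges v) \<longleftrightarrow> (\<exists>i'\<in>F. \<exists>j'\<in>C. (j, i, s) \<in> set (slot_edges v i' j'))"
    by (auto simp: edges_def)
  moreover have "(j, i, s) \<in> set (slot_edges v i' j') \<longleftrightarrow> j = j' \<and> i = i' \<and> 0 < weight v i j \<and> s \<in> adj i j"
    if "i' \<in> F" for i' j'
    using that by (auto simp: slot_edges_def fill_eq slots.adjacent_def[OF slots])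
  ultimately show ?thesis by auto
qed

text \<open>The overlaps divided by capacity form a fractional matching of clients to slots: each
  client is covered by \<open>weight_cover\<close>, and a slot has total length equal to the
  capacity.\<close>

lemma hall_edges: "hall_graph (edges v) (clis v)"
proof (unfold_locales, rule fractional_hall)
  let ?g = "\<lambda>j (i, s). real_of_int (ov i j s) / real_of_int (capacity v i)"
  fix A assume A: "A \<subseteq> C"
  show "finite A" "finite (set (edges v))" using A finite_subset by auto
  show "0 \<le> ?g j p" if "(j, p) \<in> set (edges v)" for j p
    using that capacity_pos slots.overlap_nonneg[OF slots]
    by (cases p) (auto simp: mem_edges less_imp_le)
  show "1 \<le> (\<Sum>p\<in>{p. (j, p) \<in> set (edges v)}. ?g j p)" if "j \<in> A" for j
  proof -
    have j: "j \<in> C" using that A by blast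
    let ?I = "{i \<in> F. 0 < weight v i j}"
    have fin: "finite (adj i j)" if "i \<in> F" for i by (simp add: slots.adjacent_def[OF slots[OF that]])
    have "{p. (j, p) \<in> set (edges v)} = Sigma ?I (\<lambda>i. adj i j)" using j by (auto simp: mem_edges)
    hence "(\<Sum>p\<in>{p. (j, p) \<in> set (edges v)}. ?g j p) = (\<Sum>i\<in>?I. \<Sum>s\<in>adj i j. ?g j (i, s))"
      using fin by (simp add: sum.Sigma)
    also have "\<dots> = (\<Sum>i\<in>?I. real_of_int (weight v i j) / real_of_int (capacity v i))"
    proof (rule sum.cong[OF refl])
      fix i assume i: "i \<in> ?I"
      have "(\<Sum>s\<in>adj i j. ov i j s) = weight v i j"
        using slots.sum_overlap_adjacent[OF slots j] i by blast
      thus "(\<Sum>s\<in>adj i j. ?g j (i, s)) = real_of_int (weight v i j) / real_of_int (capacity v i)"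
        by (simp flip: sum_divide_distrib of_int_sum)
    qed
    also have "\<dots> = (\<Sum>i\<in>F. real_of_int (weight v i j) / real_of_int (capacity v i))"
      using weight_bounds(1)[OF _ j] by (intro sum.mono_neutral_left) (auto simp: not_less order.antisym)
    finally show ?thesis using weight_cover[OF j] by simp
  qed
  show "(\<Sum>j\<in>{j \<in> A. (j, p) \<in> set (edges v)}. ?g j p) \<le> 1" for p
  proof (cases "{j \<in> A. (j, p) \<in> set (edges v)} = {}")
    case True
    show ?thesis unfolding True by simp
  next
    case False
    obtain i s where p: "p = (i, s)" by (cases p)
    from False obtain j where "(j, i, s) \<in> set (edges v)" by (auto simp: p)
    hence i: "i \<in> F" and s: "0 \<le> s" using slots.adjacent_nonneg[OF slots] by (auto simp: mem_edges)
    have "(\<Sum>j\<in>{j \<in> A. (j, i, s) \<in> set (edges v)}. ov i j s) \<le> (\<Sum>j\<in>C. ov i j s)"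
      using A slots.overlap_nonneg[OF slots[OF i]] by (intro sum_mono2) auto
    also have "\<dots> \<le> capacity v i" by (rule slots.sum_overlap_le[OF slots[OF i] s])
    finally show ?thesis using capacity_pos[of i]
      by (simp add: p flip: sum_divide_distrib of_int_sum)
  qed
qed

sublocale hall_graph "edges v" "clis v" by (rule hall_edges)

lemma matching_inv: "auction_inv (matching v)"
  unfolding matching_def using auction_progress by blast

lemma matching_complete: "C \<subseteq> (\<lambda>e. snd (snd e)) ` set (matching v)"
proof -
  have "length (concat (map (\<lambda>_. 0 # clis v) es)) = length es * (length (clis v) + 1)" for es :: "(int \<times> int \<times> int) list"
    by (induction es) auto
  hence "length (fuel v) = (length (edges v) + 1) * (length (clis v) + 1)"
    by (simp only: fuel_def list.size) simp
  thus ?thesis unfolding matching_def by (intro auction_complete) simp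
qed

lemma matchingD:
  assumes "((i, s), l, j) \<in> set (matching v)"
  shows "i \<in> F" "j \<in> C" "0 < weight v i j" "s \<in> adj i j"
  using matching_inv assms by (auto simp: auction_inv_def mem_edges)

lemma assigned_iff: "assigned v i j \<longleftrightarrow> (\<exists>s l. ((i, s), l, j) \<in> set (matching v))"
  by (force simp: assigned_def filter_empty_conv)

lemma opened_iff: "opened v i \<longleftrightarrow> (\<exists>j. assigned v i j)"
  unfolding assigned_iff by (force simp: opened_def filter_empty_conv)

lemma assigned_unique: "assigned v i j \<Longrightarrow> assigned v i' j \<Longrightarrow> i = i'"
proof -
  assume "assigned v i j" "assigned v i' j"
  then obtain s l s' l' where *: "((i, s), l, j) \<in> set (matching v)" "((i', s'), l', j) \<in> set (matching v)"
    by (auto simp: assigned_iff)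
  have "inj_on (\<lambda>e. snd (snd e)) (set (matching v))"
    using matching_inv by (simp add: auction_inv_def distinct_map)
  from inj_onD[OF this _ *] show "i = i'" by simp
qed

lemma assigned_ex1: assumes "j \<in> C" shows "\<exists>!i. i \<in> F \<and> assigned v i j"
proof -
  from matching_complete assms obtain i s l where "((i, s), l, j) \<in> set (matching v)" by force
  hence "i \<in> F \<and> assigned v i j" using matchingD(1) assigned_iff by blast
  thus ?thesis using assigned_unique by blast
qed

text \<open>One extra distance \<open>T\<close> from the slot rounding plus the fractional load (1 +
  \<epsilon>) T.\<close>

lemma assigned_load:
  assumes i: "i \<in> F"
  shows "M * (\<Sum>j\<in>{j \<in> C. assigned v i j}. d i j) \<le> (2 * M + e) * T"
proof -
  let ?N = "{j \<in> C. assigned v i j}"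
  define \<sigma> where "\<sigma> j = (SOME s. \<exists>l. ((i, s), l, j) \<in> set (matching v))" for j
  have \<sigma>: "\<exists>l. ((i, \<sigma> j), l, j) \<in> set (matching v)" if "j \<in> ?N" for j
    unfolding \<sigma>_def by (rule someI_ex) (use that in \<open>auto simp: assigned_iff\<close>)
  have "inj_on \<sigma> ?N"
  proof (rule inj_onI)
    fix a b assume ab: "a \<in> ?N" "b \<in> ?N" "\<sigma> a = \<sigma> b"
    have inj: "inj_on fst (set (matching v))" using matching_inv by (simp add: auction_inv_def distinct_map)
    obtain l l' where *: "((i, \<sigma> a), l, a) \<in> set (matching v)" "((i, \<sigma> a), l', b) \<in> set (matching v)"
      using \<sigma>[OF ab(1)] \<sigma>[OF ab(2)] ab(3) by auto
    from inj_onD[OF inj _ *] show "a = b" by simp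
  qed
  moreover have "0 < weight v i j \<and> \<sigma> j \<in> adj i j" if "j \<in> ?N" for j using \<sigma>[OF that] matchingD by blast
  moreover from this have "d i j \<le> T" if "j \<in> ?N" for j using that support_distance[OF i] by blast
  ultimately have "capacity v i * (\<Sum>j\<in>?N. d i j) \<le> capacity v i * T + (\<Sum>j\<in>C. weight v i j * d i j)"
    by (intro slots.matched_load_le[OF slots[OF i], of _ \<sigma>]) (use T_pos in auto)
  hence "M * (capacity v i * (\<Sum>j\<in>?N. d i j)) \<le> M * (capacity v i * T + (\<Sum>j\<in>C. weight v i j * d i j))"
    using eps_pos eps_less by (intro mult_left_mono) auto
  also have "\<dots> \<le> M * (capacity v i * T) + capacity v i * ((M + e) * T)"
    using weight_load[OF i] by (simp add: distrib_left)
  finally have "capacity v i * (M * (\<Sum>j\<in>?N. d i j)) \<le> capacity v i * ((2 * M + e) * T)"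
    by (simp add: algebra_simps)
  thus ?thesis using capacity_pos[of i] by simp
qed

text \<open>An open facility is large, or the single facility of some far client, or a target; the
  three counts give 16 + 52 + 108.\<close>

lemma card_opened: "e * int (card {i \<in> F. opened v i}) \<le> 176 * Y"
proof -
  let ?L = "{i \<in> F. large v i}" and ?B = "{j \<in> C. served_far v j}"
  let ?by = "\<lambda>j. THE i. i \<in> F \<and> assigned v i j"
  have cases: "large v i \<or> (served_far v j \<and> i = ?by j) \<or> (served_near v j \<and> i \<in> target v ` S)"
    if a: "i \<in> F" "assigned v i j" for i j
  proof -
    from a obtain s l where "((i, s), l, j) \<in> set (matching v)" by (auto simp: assigned_iff)
    note m = matchingD[OF this]
    have "0 < raw_weight v i j" using m weight_bounds[of i j] by linarith
    moreover have "?by j = i" using assigned_ex1[OF m(2)] a by (intro the1_equality) auto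
    moreover have "i \<in> target v ` S" if "(\<Sum>a\<in>{a \<in> S. \<not> far v a j \<and> target v a = i}. x a j) \<noteq> 0"
    proof -
      have "{a \<in> S. \<not> far v a j \<and> target v a = i} \<noteq> {}" using that by (metis sum.empty)
      thus ?thesis by blast
    qed
    ultimately show ?thesis by (auto simp: raw_weight_def sum_smalls split: if_splits)
  qed
  show ?thesis
  \<comment> \<open>The count of targets is available only if some client is not served by large
    facilities. Without such a client only large facilities receive positive weight.\<close>
  proof (cases "\<exists>j\<in>C. \<not> served_large v j")
    case False
    have "{i \<in> F. opened v i} \<subseteq> ?L"
    proof safe
      fix i assume i: "i \<in> F" "opened v i"
      then obtain j where j: "assigned v i j" by (auto simp: opened_iff)
      hence "j \<in> C" using matchingD(2) by (auto simp: assigned_iff)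
      thus "large v i" using cases[OF i(1) j] False by (auto simp: served_far_def served_near_def)
    qed
    hence "int (card {i \<in> F. opened v i}) \<le> int (card ?L)" by (simp add: card_mono)
    hence "e * int (card {i \<in> F. opened v i}) \<le> e * int (card ?L)" using eps_pos by (intro mult_left_mono) auto
    thus ?thesis using card_large Y_nonneg by linarith
  next
    case True
    then obtain j0 where j0: "j0 \<in> C" "\<not> served_large v j0" by blast
    have "{i \<in> F. opened v i} \<subseteq> ?L \<union> (?by ` ?B \<union> target v ` S)"
    proof
      fix i assume i: "i \<in> {i \<in> F. opened v i}"
      then obtain j where j: "assigned v i j" by (auto simp: opened_iff)
      hence "j \<in> C" using matchingD(2) by (auto simp: assigned_iff)
      thus "i \<in> ?L \<union> (?by ` ?B \<union> target v ` S)" using cases[of i j] i j by blast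
    qed
    hence "card {i \<in> F. opened v i} \<le> card (?L \<union> (?by ` ?B \<union> target v ` S))" by (intro card_mono) auto
    also have "\<dots> \<le> card ?L + (card (?by ` ?B) + card (target v ` S))"
      using card_Un_le[of ?L "?by ` ?B \<union> target v ` S"] card_Un_le[of "?by ` ?B" "target v ` S"] by linarith
    also have "card (?by ` ?B) \<le> card ?B" by (rule card_image_le) simp
    finally have "int (card {i \<in> F. opened v i}) \<le> int (card ?L) + (int (card ?B) + int (card (target v ` S)))" by linarith
    hence "e * int (card {i \<in> F. opened v i}) \<le> e * (int (card ?L) + (int (card ?B) + int (card (target v ` S))))"
      using eps_pos by (intro mult_left_mono) auto
    also have "\<dots> \<le> 16 * Y + (52 * Y + 108 * Y)"
      unfolding distrib_left by (intro add_mono card_large card_far card_targets[OF j0])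
    finally show ?thesis by simp
  qed
qed

end

section \<open>Decoding the input\<close>

definition fraction :: "real \<Rightarrow> int \<times> int" where
  "fraction r = quotient_of (THE q. of_rat q = r)"

lemma enc_rat_eq: "enc_rat r = enc (fraction r)"
  by (simp add: enc_rat_def fraction_def enc_prod_def enc_int_def split: prod.split)

lemma fraction_of_rat: "fraction (of_rat q) = quotient_of q"
  by (simp add: fraction_def)

lemma fraction:
  assumes "r \<in> \<rat>"
  shows "0 < snd (fraction r)" "r = real_of_int (fst (fraction r)) / real_of_int (snd (fraction r))"
proof -
  from assms obtain q where q: "r = of_rat q" by (auto simp: Rats_def)
  obtain a b where ab: "quotient_of q = (a, b)" by (cases "quotient_of q")
  show "0 < snd (fraction r)" using quotient_of_denom_pos'[of q] by (simp add: q fraction_of_rat)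
  have "fraction r = (a, b)" by (simp only: q fraction_of_rat ab)
  moreover have "r = real_of_int a / real_of_int b"
    unfolding q by (subst quotient_of_div[OF ab]) (simp add: of_rat_divide)
  ultimately show "r = real_of_int (fst (fraction r)) / real_of_int (snd (fraction r))" by simp
qed

lemma fraction_of_bool: "fraction (of_bool b) = zero_one b"
  using fraction_of_rat[of 0] fraction_of_rat[of 1] by (cases b) (simp_all add: zero_one_def)

definition table :: "nat set \<Rightarrow> (nat \<Rightarrow> 'a) \<Rightarrow> (int \<times> 'a) list" where
  "table A f = map (\<lambda>a. (int a, f a)) (sorted_list_of_set A)"

lemma enc_table_eq: "enc_table A (\<lambda>a. enc (f a)) = enc (table A f)"
  by (simp add: enc_table_def table_def enc_list_inst comp_def enc_prod_def enc_int_def)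

lemma filter_table:
  assumes "finite A" "k \<in> A" shows "filter (\<lambda>e. fst e = int k) (table A f) = [(int k, f k)]"
proof -
  have "distinct as \<Longrightarrow> filter (\<lambda>e. fst e = int k) (map (\<lambda>a. (int a, f a)) as) = (if k \<in> set as then [(int k, f k)] else [])"
    for as by (induction as) auto
  thus ?thesis using assms by (simp add: table_def)
qed

text \<open>The input is a list of values of different types, typed here as a nested tuple. The
  final 0 is the integer whose code equals the end of the list.\<close>

definition inp_of :: "nat set \<Rightarrow> nat set \<Rightarrow> (nat \<Rightarrow> nat \<Rightarrow> real) \<Rightarrow> real \<Rightarrow> real
    \<Rightarrow> (nat \<Rightarrow> nat \<Rightarrow> real) \<Rightarrow> (nat \<Rightarrow> real) \<Rightarrow> real \<Rightarrow> inp" where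
  "inp_of F C d T k x y \<epsilon> = (map int (sorted_list_of_set F), map int (sorted_list_of_set C),
     table (F \<union> C) (\<lambda>p. table (F \<union> C) (\<lambda>q. fraction (d p q))), fraction T, fraction k,
     (table F (\<lambda>i. table C (\<lambda>j. fraction (x i j))), table F (\<lambda>i. fraction (y i))), fraction \<epsilon>, 0)"

lemma enc_input_eq: "enc_input F C d T k x y \<epsilon> = enc (inp_of F C d T k x y \<epsilon>)"
proof -
  have "enc_set A = enc (map int (sorted_list_of_set A))" for A
    by (simp add: enc_set_def enc_list_inst comp_def enc_int_def)
  thus ?thesis
    unfolding enc_input_def inp_of_def enc_solution_def enc_rat_eq enc_table_eq
    by (simp add: enc_list_def enc_prod_def enc_int_def)
qed

lemma dvd_prod_list: "a \<in> set as \<Longrightarrow> a dvd prod_list (as :: int list)"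
  by (induction as) auto

lemma prod_list_pos: "(\<And>a. a \<in> set as \<Longrightarrow> 0 < a) \<Longrightarrow> 0 < prod_list (as :: int list)"
  by (induction as) auto

locale rational_instance =
  fixes F C :: "nat set" and d :: "nat \<Rightarrow> nat \<Rightarrow> real" and T k :: real
    and x :: "nat \<Rightarrow> nat \<Rightarrow> real" and y :: "nat \<Rightarrow> real" and \<epsilon> :: real
  assumes fin: "finite F" "finite C" and metric: "Metric_space (F \<union> C) d"
    and T: "0 < T" and k: "0 < k" and lp: "(x, y) \<in> SC_LP F C d T k" and eps: "\<epsilon> \<in> {0<..<1}"
    and rat: "rational_input F C d T k x y \<epsilon>"
begin

abbreviation v where "v \<equiv> inp_of F C d T k x y \<epsilon>"

lemma sets: "set (facs v) = int ` F" "set (clis v) = int ` C" "distinct (facs v)" "distinct (clis v)"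
  using fin by (simp_all add: facs_def clis_def inp_of_def distinct_map)

lemma tables: "dtab v = table (F \<union> C) (\<lambda>p. table (F \<union> C) (\<lambda>q. fraction (d p q)))"
  "xtab v = table F (\<lambda>i. table C (\<lambda>j. fraction (x i j)))" "ytab v = table F (\<lambda>i. fraction (y i))"
  "rawT v = fraction T" "raweps v = fraction \<epsilon>"
  by (simp_all add: dtab_def xtab_def ytab_def rawT_def raweps_def inp_of_def)

lemma rats: "p \<in> F \<union> C \<Longrightarrow> q \<in> F \<union> C \<Longrightarrow> d p q \<in> \<rat>" "T \<in> \<rat>" "\<epsilon> \<in> \<rat>"
  "i \<in> F \<Longrightarrow> j \<in> C \<Longrightarrow> x i j \<in> \<rat>" "i \<in> F \<Longrightarrow> y i \<in> \<rat>"
  using rat by (auto simp: rational_input_def)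

lemma set_table: "finite A \<Longrightarrow> set (table A f) = (\<lambda>a. (int a, f a)) ` A"
  by (simp add: table_def)

lemma set_entries:
  "finite A \<Longrightarrow> finite B \<Longrightarrow> set (entries (table A (\<lambda>a. table B (f a)))) = (\<Union>a\<in>A. (\<lambda>b. (int b, f a b)) ` B)"
  by (simp add: entries_def set_table image_UN)

definition dens :: "int list" where
  "dens = map (\<lambda>e. snd (snd e)) (entries (dtab v) @ entries (xtab v) @ ytab v)"

lemma scale_eq: "scale v = prod_list dens * (snd (fraction T) * snd (fraction \<epsilon>))"
  by (simp add: scale_def dens_def tables)

lemma set_dens: "set dens = (\<Union>p\<in>F \<union> C. \<Union>q\<in>F \<union> C. {snd (fraction (d p q))}) \<union>
    (\<Union>i\<in>F. \<Union>j\<in>C. {snd (fraction (x i j))}) \<union> (\<Union>i\<in>F. {snd (fraction (y i))})"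
proof -
  have "set dens = (\<lambda>e. snd (snd e)) ` set (entries (dtab v)) \<union> (\<lambda>e. snd (snd e)) ` set (entries (xtab v))
      \<union> (\<lambda>e. snd (snd e)) ` set (ytab v)"
    by (simp add: dens_def image_Un Un_assoc)
  moreover have "(\<lambda>e. snd (snd e)) ` set (entries (dtab v)) = (\<Union>p\<in>F \<union> C. \<Union>q\<in>F \<union> C. {snd (fraction (d p q))})"
    using fin unfolding tables by (subst set_entries) (simp, simp, force)
  moreover have "(\<lambda>e. snd (snd e)) ` set (entries (xtab v)) = (\<Union>i\<in>F. \<Union>j\<in>C. {snd (fraction (x i j))})"
    using fin unfolding tables by (subst set_entries) (simp, simp, force)
  moreover have "(\<lambda>e. snd (snd e)) ` set (ytab v) = (\<Union>i\<in>F. {snd (fraction (y i))})"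
    using fin unfolding tables by (subst set_table) (simp, force)
  ultimately show ?thesis by (simp only:)
qed

lemma scale_pos: "0 < scale v"
proof -
  have "0 < a" if "a \<in> set dens" for a using that fraction(1) rats unfolding set_dens by blast
  hence "0 < prod_list dens" by (rule prod_list_pos)
  thus ?thesis using fraction(1) rats(2,3) by (simp add: scale_eq)
qed

text \<open>The division in \<open>scaled\<close> is exact because the denominator divides the
  scale.\<close>

lemma real_scaled:
  assumes "r \<in> \<rat>" "snd (fraction r) dvd scale v"
  shows "real_of_int (scaled v (fraction r)) = r * real_of_int (scale v)"
proof -
  obtain m where m: "scale v = snd (fraction r) * m" using assms(2) by (elim dvdE)
  have "scale v div snd (fraction r) = m" using fraction(1)[OF assms(1)] m by simp
  hence "real_of_int (scaled v (fraction r)) = real_of_int (fst (fraction r)) * real_of_int m" by (simp add: scaled_def)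
  also have "\<dots> = r * real_of_int (scale v)"
    using fraction[OF assms(1)] m by (simp add: field_simps)
  finally show ?thesis .
qed

lemma dens_dvd: "a \<in> set dens \<Longrightarrow> a dvd scale v"
  unfolding scale_eq by (intro dvd_mult2 dvd_prod_list)

lemma mem_dens:
  "p \<in> F \<union> C \<Longrightarrow> q \<in> F \<union> C \<Longrightarrow> snd (fraction (d p q)) \<in> set dens"
  "i \<in> F \<Longrightarrow> j \<in> C \<Longrightarrow> snd (fraction (x i j)) \<in> set dens"
  "i \<in> F \<Longrightarrow> snd (fraction (y i)) \<in> set dens"
  unfolding set_dens by blast+

lemma real_T: "real_of_int (Tval v) = T * real_of_int (scale v)"
  and real_eps: "real_of_int (eps v) = \<epsilon> * real_of_int (scale v)"
  unfolding Tval_def eps_def tables by (intro real_scaled rats; simp add: scale_eq)+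

lemma look_table: "finite A \<Longrightarrow> a \<in> A \<Longrightarrow> look v (table A f) (int a) = scaled v (f a)"
  by (simp add: look_def filter_table)

lemma look2_table:
  "finite A \<Longrightarrow> finite B \<Longrightarrow> a \<in> A \<Longrightarrow> b \<in> B \<Longrightarrow> look2 v (table A (\<lambda>a. table B (f a))) (int a) (int b) = scaled v (f a b)"
  by (simp add: look2_def filter_table entries_def look_table)

lemma real_d: "p \<in> F \<union> C \<Longrightarrow> q \<in> F \<union> C \<Longrightarrow> real_of_int (dval v (int p) (int q)) = d p q * real_of_int (scale v)"
  unfolding dval_def tables using fin
  by (subst look2_table) (auto intro!: real_scaled rats dens_dvd mem_dens)

lemma real_x: "i \<in> F \<Longrightarrow> j \<in> C \<Longrightarrow> real_of_int (xval v (int i) (int j)) = x i j * real_of_int (scale v)"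
  unfolding xval_def tables using fin
  by (subst look2_table) (auto intro!: real_scaled rats dens_dvd mem_dens)

lemma real_y: "i \<in> F \<Longrightarrow> real_of_int (yval v (int i)) = y i * real_of_int (scale v)"
  unfolding yval_def tables using fin
  by (subst look_table) (auto intro!: real_scaled rats dens_dvd mem_dens)

lemma sum_int: "(\<Sum>i\<in>int ` A. f i) = (\<Sum>i\<in>A. f (int i))"
  by (simp add: sum.reindex)

lemma lp_facts:
  "j \<in> C \<Longrightarrow> (\<Sum>i\<in>F. x i j) = 1" "i \<in> F \<Longrightarrow> j \<in> C \<Longrightarrow> x i j \<le> y i" "i \<in> F \<Longrightarrow> 0 \<le> y i" "i \<in> F \<Longrightarrow> y i \<le> 1"
  "i \<in> F \<Longrightarrow> j \<in> C \<Longrightarrow> 0 \<le> x i j" "i \<in> F \<Longrightarrow> (\<Sum>j\<in>C. d i j * x i j) \<le> T * y i" "(\<Sum>i\<in>F. y i) \<le> k"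
  "i \<in> F \<Longrightarrow> j \<in> C \<Longrightarrow> T < d i j \<Longrightarrow> x i j = 0"
proof -
  have "fractional_assignment F C x y" "\<forall>i\<in>F. load C d x i \<le> T * y i" "(\<Sum>i\<in>F. y i) \<le> k"
    "\<forall>i\<in>F. \<forall>j\<in>C. T < d i j \<longrightarrow> x i j = 0"
    using lp unfolding SC_LP_def by blast+
  moreover from this(1) have "\<forall>j\<in>C. (\<Sum>i\<in>F. x i j) = 1" "\<forall>i\<in>F. \<forall>j\<in>C. x i j \<le> y i"
    "\<forall>i\<in>F. y i \<in> {0..1}" "\<forall>i\<in>F. \<forall>j\<in>C. x i j \<in> {0..1}"
    unfolding fractional_assignment_def by blast+
  ultimately show "j \<in> C \<Longrightarrow> (\<Sum>i\<in>F. x i j) = 1" "i \<in> F \<Longrightarrow> j \<in> C \<Longrightarrow> x i j \<le> y i" "i \<in> F \<Longrightarrow> 0 \<le> y i"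
    "i \<in> F \<Longrightarrow> y i \<le> 1" "i \<in> F \<Longrightarrow> j \<in> C \<Longrightarrow> 0 \<le> x i j" "i \<in> F \<Longrightarrow> (\<Sum>j\<in>C. d i j * x i j) \<le> T * y i"
    "(\<Sum>i\<in>F. y i) \<le> k" "i \<in> F \<Longrightarrow> j \<in> C \<Longrightarrow> T < d i j \<Longrightarrow> x i j = 0"
    by (simp_all add: load_def)
qed

lemma scaled_lp: "scaled_lp v"
proof -
  interpret Metric_space "F \<union> C" d by (rule metric)
  let ?M = "real_of_int (scale v)"
  have M: "0 < ?M" using scale_pos by simp
  have F: "\<exists>i'\<in>F. i = int i'" if "i \<in> set (facs v)" for i using that by (auto simp: sets)
  have C: "\<exists>j'\<in>C. j = int j'" if "j \<in> set (clis v)" for j using that by (auto simp: sets)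
  have FC: "\<exists>p'\<in>F \<union> C. p = int p'" if "p \<in> set (facs v) \<union> set (clis v)" for p using that by (auto simp: sets)
  show ?thesis
  proof
    show "distinct (facs v)" "distinct (clis v)" by (rule sets)+
    show "0 < eps v" "eps v < scale v" "0 < Tval v"
      using M real_eps real_T T eps by (simp_all flip: of_int_0_less_iff of_int_less_iff[where 'a = real])
    fix p q r
    assume p: "p \<in> set (facs v) \<union> set (clis v)"
    then obtain p' where p': "p = int p'" "p' \<in> F \<union> C" using FC by blast
    have "real_of_int (dval v p p) = 0" unfolding p'(1) using real_d p'(2) by simp
    thus "dval v p p = 0" by simp
    assume q: "q \<in> set (facs v) \<union> set (clis v)"
    then obtain q' where q': "q = int q'" "q' \<in> F \<union> C" using FC by blast
    have "0 \<le> real_of_int (dval v p q)" unfolding p'(1) q'(1) using real_d p'(2) q'(2) M by simp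
    thus "0 \<le> dval v p q" by simp
    have "real_of_int (dval v p q) = real_of_int (dval v q p)"
      unfolding p'(1) q'(1) using real_d p'(2) q'(2) by (simp add: commute)
    thus "dval v p q = dval v q p" by simp
    assume r: "r \<in> set (facs v) \<union> set (clis v)"
    then obtain r' where r': "r = int r'" "r' \<in> F \<union> C" using FC by blast
    have "d p' r' * ?M \<le> (d p' q' + d q' r') * ?M"
      using triangle[OF p'(2) q'(2) r'(2)] M by (intro mult_right_mono) auto
    hence "real_of_int (dval v p r) \<le> real_of_int (dval v p q + dval v q r)"
      unfolding p'(1) q'(1) r'(1) of_int_add using real_d p'(2) q'(2) r'(2) by (simp only: distrib_right)
    thus "dval v p r \<le> dval v p q + dval v q r" by (simp only: of_int_le_iff)
  next
    fix i assume "i \<in> set (facs v)"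
    then obtain i' where i': "i = int i'" "i' \<in> F" using F by blast
    have "0 \<le> real_of_int (yval v i)" unfolding i' using real_y i'(2) lp_facts M by simp
    thus "0 \<le> yval v i" by simp
    have "real_of_int (yval v i) \<le> ?M" unfolding i' using real_y i'(2) lp_facts M by simp
    thus "yval v i \<le> scale v" by simp
    \<comment> \<open>Both factors are scaled, so the load constraint is multiplied by the square of
      the scale.\<close>
    have "real_of_int (\<Sum>j\<in>set (clis v). dval v i j * xval v i j) = (\<Sum>j\<in>C. d i' j * x i' j) * (?M * ?M)"
      unfolding i' sets sum_int of_int_sum of_int_mult sum_distrib_right using i'(2)
      by (intro sum.cong refl) (simp add: real_d real_x)
    also have "\<dots> \<le> (T * y i') * (?M * ?M)" using lp_facts(6)[OF i'(2)] M by (intro mult_right_mono) auto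
    also have "\<dots> = real_of_int (Tval v * yval v i)" using i' real_T real_y by simp
    finally show "(\<Sum>j\<in>set (clis v). dval v i j * xval v i j) \<le> Tval v * yval v i" by (simp only: of_int_le_iff)
    fix j assume "j \<in> set (clis v)"
    then obtain j' where j': "j = int j'" "j' \<in> C" using C by blast
    have "0 \<le> real_of_int (xval v i j)" unfolding i' j' using real_x i'(2) j'(2) lp_facts M by simp
    thus "0 \<le> xval v i j" by simp
    have "real_of_int (xval v i j) \<le> real_of_int (yval v i)"
      unfolding i' j' using real_x real_y i'(2) j'(2) lp_facts(2) M by simp
    thus "xval v i j \<le> yval v i" by (simp only: of_int_le_iff)
    assume "Tval v < dval v i j"
    hence "real_of_int (Tval v) < real_of_int (dval v i j)" by simp
    hence "T < d i' j'" unfolding i' j' using real_T real_d i'(2) j'(2) M by simp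
    hence "real_of_int (xval v i j) = 0" unfolding i' j' using real_x i'(2) j'(2) lp_facts(8) by simp
    thus "xval v i j = 0" by simp
  next
    fix j assume "j \<in> set (clis v)"
    then obtain j' where j': "j = int j'" "j' \<in> C" using C by blast
    have "real_of_int (\<Sum>i\<in>set (facs v). xval v i j) = (\<Sum>i\<in>F. x i j') * ?M"
      unfolding j' sets sum_int of_int_sum sum_distrib_right using j'(2)
      by (intro sum.cong refl) (simp add: real_x)
    also have "\<dots> = ?M" using lp_facts(1)[OF j'(2)] by simp
    finally show "(\<Sum>i\<in>set (facs v). xval v i j) = scale v" by (simp only: of_int_eq_iff)
  qed
qed

sublocale scaled: scaled_lp v by (rule scaled_lp)

section \<open>The integral solution in the original instance\<close>

definition xsol :: "nat \<Rightarrow> nat \<Rightarrow> real" where "xsol i j = of_bool (assigned v (int i) (int j))"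
definition ysol :: "nat \<Rightarrow> real" where "ysol i = of_bool (opened v (int i))"

lemma map_facs: "map (\<lambda>i. (i, g i)) (facs v) = table F (\<lambda>i. g (int i))"
  by (simp add: table_def facs_def inp_of_def)

lemma map_clis: "map (\<lambda>j. (j, g j)) (clis v) = table C (\<lambda>j. g (int j))"
  by (simp add: table_def clis_def inp_of_def)

lemma enc_solution_eq: "enc_solution F C xsol ysol = enc (rounding v)"
proof -
  have "rounding v = (table F (\<lambda>i. table C (\<lambda>j. fraction (xsol i j))), table F (\<lambda>i. fraction (ysol i)))"
    unfolding rounding_def map_facs map_clis xsol_def ysol_def fraction_of_bool ..
  thus ?thesis
    unfolding enc_solution_def enc_rat_eq enc_table_eq by (simp only: enc_prod_def fst_conv snd_conv)
qed

lemma xsol_sum: assumes "j \<in> C" shows "(\<Sum>i\<in>F. xsol i j) = 1"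
proof -
  have "int j \<in> set (clis v)" using assms by (simp add: sets)
  from scaled.assigned_ex1[OF this] obtain i where i: "i \<in> F" "assigned v (int i) (int j)" by (auto simp: sets)
  have "xsol a j = (if a = i then 1 else 0)" for a
  proof (cases "a = i")
    case False
    hence "\<not> assigned v (int a) (int j)" using scaled.assigned_unique[OF _ i(2), of "int a"] by auto
    thus ?thesis using False by (simp add: xsol_def)
  qed (use i in \<open>simp add: xsol_def\<close>)
  thus ?thesis using fin i(1) by simp
qed

lemma xsol_load: assumes i: "i \<in> F" shows "load C d xsol i \<le> (2 + \<epsilon>) * T * ysol i"
proof (cases "opened v (int i)")
  case False
  hence "xsol i j = 0" for j by (auto simp: xsol_def scaled.opened_iff)
  thus ?thesis using False by (simp add: load_def ysol_def)
next
  case True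
  let ?M = "real_of_int (scale v)"
  have M: "0 < ?M" using scale_pos by simp
  have "int i \<in> set (facs v)" using i by (simp add: sets)
  from scaled.assigned_load[OF this]
  have "real_of_int (scale v * (\<Sum>j\<in>{j \<in> set (clis v). assigned v (int i) j}. dval v (int i) j))
      \<le> real_of_int ((2 * scale v + eps v) * Tval v)" by (simp only: of_int_le_iff)
  moreover have "real_of_int (\<Sum>j\<in>{j \<in> set (clis v). assigned v (int i) j}. dval v (int i) j) = load C d xsol i * ?M"
  proof -
    have "{j \<in> set (clis v). assigned v (int i) j} = int ` {j \<in> C. assigned v (int i) (int j)}" by (auto simp: sets)
    hence "real_of_int (\<Sum>j\<in>{j \<in> set (clis v). assigned v (int i) j}. dval v (int i) j)
        = (\<Sum>j\<in>{j \<in> C. assigned v (int i) (int j)}. d i j * ?M)"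
      using i by (simp add: sum_int real_d)
    also have "\<dots> = (\<Sum>j\<in>C. d i j * xsol i j * ?M)"
      using fin by (auto simp: sum.inter_filter xsol_def intro!: sum.cong)
    finally show ?thesis by (simp add: load_def sum_distrib_right)
  qed
  ultimately have "(load C d xsol i) * (?M * ?M) \<le> ((2 + \<epsilon>) * T) * (?M * ?M)"
    using real_eps real_T by (simp add: algebra_simps)
  hence "load C d xsol i \<le> (2 + \<epsilon>) * T" using M by (simp add: mult_le_cancel_right)
  thus ?thesis using True by (simp add: ysol_def)
qed

text \<open>The count of open facilities is linear in 1/\<epsilon>; it is weakened to the square
  using \<epsilon> < 1.\<close>

lemma ysol_sum: "(\<Sum>i\<in>F. ysol i) \<le> 176 / \<epsilon>\<^sup>2 * k"
proof -
  let ?M = "real_of_int (scale v)" and ?n = "card {i \<in> set (facs v). opened v i}"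
  have M: "0 < ?M" using scale_pos by simp
  have eps': "0 < \<epsilon>" "\<epsilon> < 1" using eps by auto
  have "{i \<in> set (facs v). opened v i} = int ` {i \<in> F. opened v (int i)}" by (auto simp: sets)
  hence "?n = card {i \<in> F. opened v (int i)}" by (simp add: card_image)
  hence n: "(\<Sum>i\<in>F. ysol i) = real ?n" using fin by (simp add: ysol_def of_bool_def sum.inter_filter[symmetric])
  have Y: "real_of_int scaled.Y = (\<Sum>i\<in>F. y i) * ?M"
    unfolding scaled.Y_def sets sum_int of_int_sum sum_distrib_right by (intro sum.cong refl real_y)
  have "real_of_int (eps v * int ?n) \<le> real_of_int (176 * scaled.Y)" using scaled.card_opened by (simp only: of_int_le_iff)
  hence "\<epsilon> * real ?n * ?M \<le> 176 * (\<Sum>i\<in>F. y i) * ?M" using real_eps Y by (simp add: mult_ac)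
  hence "\<epsilon> * real ?n \<le> 176 * (\<Sum>i\<in>F. y i)" using M by simp
  also have "\<dots> \<le> 176 * k" using lp_facts(7) by simp
  finally have le: "\<epsilon> * real ?n \<le> 176 * k" .
  have "\<epsilon>\<^sup>2 * real ?n = \<epsilon> * (\<epsilon> * real ?n)" by (simp add: power2_eq_square)
  also have "\<dots> \<le> 1 * (\<epsilon> * real ?n)" using eps' by (intro mult_right_mono) auto
  finally have "\<epsilon>\<^sup>2 * real ?n \<le> 176 * k" using le by simp
  thus ?thesis using eps' by (simp add: n field_simps)
qed

lemma solution: "integral_solution F C xsol ysol" "approximate_solution F C d T k (2 + \<epsilon>) (176 / \<epsilon>\<^sup>2) xsol ysol"
proof -
  show "integral_solution F C xsol ysol" by (auto simp: integral_solution_def xsol_def ysol_def)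
  have "xsol i j \<le> ysol i" "xsol i j \<in> {0..1}" "ysol i \<in> {0..1}" for i j
    by (auto simp: xsol_def ysol_def scaled.opened_iff)
  hence "fractional_assignment F C xsol ysol"
    using xsol_sum unfolding fractional_assignment_def by blast
  thus "approximate_solution F C d T k (2 + \<epsilon>) (176 / \<epsilon>\<^sup>2) xsol ysol"
    using xsol_load ysol_sum by (simp add: approximate_solution_def)
qed

end

theorem theorem4:
  shows "\<exists>(P :: com) (p :: nat poly) (K :: real). K > 0 \<and>
    (\<forall>(F :: nat set) (C :: nat set) d T k x y \<epsilon>.
       finite F \<longrightarrow> finite C \<longrightarrow> Metric_space (F \<union> C) d \<longrightarrow> T > 0 \<longrightarrow> k > 0 \<longrightarrow>
       (x, y) \<in> SC_LP F C d T k \<longrightarrow> \<epsilon> \<in> {0<..<1} \<longrightarrow>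
       rational_input F C d T k x y \<epsilon> \<longrightarrow>
       (\<exists>x' y'.
          computes_within P (enc_input F C d T k x y \<epsilon>) (enc_solution F C x' y')
            (poly p (vsize (enc_input F C d T k x y \<epsilon>))) \<and>
          integral_solution F C x' y' \<and>
          approximate_solution F C d T k (2 + \<epsilon>) (K / \<epsilon>\<^sup>2) x' y'))"
proof -
  obtain P N p where P: "\<And>v s. s 0 = enc v \<Longrightarrow>
    \<exists>t s'. exec P s t s' \<and> s' 0 = enc (rounding v) \<and> t \<le> poly p (esize v) \<and> (\<forall>r\<ge>N. s' r = s r)" "N > (0::nat)"
    by (rule polytimeE[OF polytime_rounding]) (rule that; assumption)
  have computes: "computes_within P (enc v) (enc (rounding v)) (poly p (esize v))" for v
    using P(1)[of "(\<lambda>_. VInt 0)(0 := enc v)" v] by (auto simp: computes_within_def)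
  show ?thesis
  proof (rule exI[of _ P], rule exI[of _ p], rule exI[of _ 176], intro conjI allI impI)
    fix F C :: "nat set" and d x y and T k \<epsilon> :: real
    assume "finite F" "finite C" "Metric_space (F \<union> C) d" "0 < T" "0 < k" "(x, y) \<in> SC_LP F C d T k"
      "\<epsilon> \<in> {0<..<1}" "rational_input F C d T k x y \<epsilon>"
    then interpret rational_instance F C d T k x y \<epsilon> by (rule rational_instance.intro)
    show "\<exists>x' y'. computes_within P (enc_input F C d T k x y \<epsilon>) (enc_solution F C x' y')
            (poly p (vsize (enc_input F C d T k x y \<epsilon>))) \<and>
          integral_solution F C x' y' \<and> approximate_solution F C d T k (2 + \<epsilon>) (176 / \<epsilon>\<^sup>2) x' y'"
      using computes[of v] solution unfolding enc_input_eq enc_solution_eq[symmetric] by blast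
  qed simp
qed

end
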